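(* Let $(\mathbf u^-,\mathbf B^-)\in\mathbf W_h$ be given with $\nabla\cdot\mathbf u^-=0$, and assume that $\mathbf B^-\in\mathbf L^\infty(\Omega)$. Then the mixed problem (one Picard step for the stationary Hall MHD system): given $\boldsymbol{\ell}\in\mathbf W_h^*$ and $g\in Q_h^*$, find $(\mathbf x,p)\in\mathbf W_h\times Q_h$ such that $$a(\mathbf x,\mathbf y)+b(\mathbf y,p)=\langle\boldsymbol{\ell},\mathbf y\rangle,\qquad b(\mathbf x,q)=\langle g,q\rangle\qquad\text{for all }(\mathbf y,q)\in\mathbf W_h\times Q_h,$$ is well-posed with respect to the norms $\|\cdot\|_X$ on $\mathbf W_h$ and $\|\cdot\|_Q$ on $Q_h$; that is, for all $\boldsymbol\ell$ and $g$ there is a unique solution $(\mathbf x,p)$, and there is a constant $C$ independent of $\boldsymbol\ell$ and $g$ such that $\|\mathbf x\|_X+\|p\|_Q\le C(\|\boldsymbol\ell\|_{\mathbf W_h^*}+\|g\|_{Q_h^*})$.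
   Context: $\Omega\subset\mathbb R^3$ is a bounded, simply connected Lipschitz polyhedron; $(\cdot,\cdot)$, $\|\cdot\|$ are the $L^2(\Omega)$ inner product and norm. Constants $\mathrm{Re},\mathrm{Re_m},S>0$ and $R_H\ge0$ are given. $H^h_0(\mathrm{grad})\subset H^1_0(\Omega)$, $\mathbf H^h_0(\mathrm{curl})\subset\mathbf H_0(\mathrm{curl},\Omega)$ (vanishing tangential trace), $\mathbf H^h_0(\mathrm{div})\subset\mathbf H_0(\mathrm{div},\Omega)$ (vanishing normal trace) and $L^2_h\subset L^2_0(\Omega)$ are conforming finite element spaces forming an exact discrete de Rham sequence $H^h_0(\mathrm{grad})\xrightarrow{\nabla}\mathbf H^h_0(\mathrm{curl})\xrightarrow{\nabla\times}\mathbf H^h_0(\mathrm{div})\xrightarrow{\nabla\cdot}L^2_h\to0$. $\mathbf V_h\subset[H^1_0(\Omega)]^3$, $Q_h\subset L^2_0(\Omega)$ are inf-sup stable finite element spaces for velocity and pressure. The mesh is fixed. The weak curl $\tilde\nabla_h\times:[L^2(\Omega)]^3\to\mathbf H^h_0(\mathrm{curl})$ is defined by $(\tilde\nabla_h\times\mathbf B,\mathbf k_h)=(\mathbf B,\nabla\times\mathbf k_h)$ for all $\mathbf k_h\in\mathbf H^h_0(\mathrm{curl})$. $\mathbf W_h:=\mathbf V_h\times\mathbf H^h_0(\mathrm{div})$. For $\mathbf x=(\mathbf u,\mathbf B),\ \mathbf y=(\mathbf v,\mathbf C)\in\mathbf W_h$ and $q\in Q_h$, $$\begin{aligned}a(\mathbf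 x,\mathbf y):=\ &\mathrm{Re}^{-1}(\nabla\mathbf u,\nabla\mathbf v)+((\mathbf u^-\cdot\nabla)\mathbf u,\mathbf v)-S((\tilde\nabla_h\times\mathbf B)\times\mathbf B^-,\mathbf v)+(\nabla\cdot\mathbf B,\nabla\cdot\mathbf C)\\&+\mathrm{Re_m}^{-1}(\tilde\nabla_h\times\mathbf B,\tilde\nabla_h\times\mathbf C)-(\mathbf u\times\mathbf B^-,\tilde\nabla_h\times\mathbf C)+R_H((\tilde\nabla_h\times\mathbf B)\times\mathbf B^-,\tilde\nabla_h\times\mathbf C),\end{aligned}$$ $$b(\mathbf x,q):=(\nabla\cdot\mathbf u,q).$$ The norms are $\|(\mathbf u,\mathbf B)\|_X^2:=\|\nabla\mathbf u\|^2+\|\nabla\cdot\mathbf B\|^2+\|\tilde\nabla_h\times\mathbf B\|^2$ and $\|p\|_Q:=\|p\|$; $\mathbf W_h^*$, $Q_h^*$ carry the corresponding dual norms. *)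

theory Defs
  imports "HOL-Analysis.Analysis" "HOL-Library.Function_Algebras"
begin

text \<open>Elements of the function spaces below are represented by functions on the whole of
  \<open>real^3\<close>; only their values on \<open>\<Omega>\<close> matter, and equality in \<open>L\<^sup>2(\<Omega>)\<close> is equality almost
  everywhere on \<open>\<Omega>\<close>.  The pointwise vector space structure makes \<^const>\<open>subspace\<close> and
  \<^const>\<open>span\<close> available for sets of such functions.\<close>

instantiation "fun" :: (type, real_vector) real_vector
begin

definition scaleR_fun :: "real \<Rightarrow> ('a \<Rightarrow> 'b) \<Rightarrow> 'a \<Rightarrow> 'b" where
  "scaleR_fun c f = (\<lambda>x. c *\<^sub>R f x)"

instance
  by standard (simp_all add: scaleR_fun_def fun_eq_iff scaleR_add_right scaleR_add_left)

end

type_synonym sfield = "real^3 \<Rightarrow> real"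
type_synonym vfield = "real^3 \<Rightarrow> real^3"


section \<open>Domain and mesh\<close>

text \<open>Near each boundary point, and in suitable orthogonal coordinates with last axis \<open>e\<close>,
  the set is the part below the graph of a Lipschitz function \<open>\<gamma>\<close>.\<close>

definition lipschitz_boundary :: "(real^3) set \<Rightarrow> bool" where
  "lipschitz_boundary \<Omega> \<longleftrightarrow>
     (\<forall>x\<in>frontier \<Omega>. \<exists>U e \<gamma> L. open U \<and> x \<in> U \<and> norm e = 1 \<and> L-lipschitz_on UNIV \<gamma> \<and>
        (\<forall>y\<in>U. y \<in> \<Omega> \<longleftrightarrow> y \<bullet> e < \<gamma> (y - (y \<bullet> e) *\<^sub>R e)))"

text \<open>The library's \<^const>\<open>polytope\<close> is convex; a polyhedral domain need not be.\<close>

definition lipschitz_polyhedron :: "(real^3) set \<Rightarrow> bool" where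
  "lipschitz_polyhedron \<Omega> \<longleftrightarrow>
     open \<Omega> \<and> connected \<Omega> \<and> \<Omega> \<noteq> {} \<and> lipschitz_boundary \<Omega> \<and>
     (\<exists>P. finite P \<and> (\<forall>K\<in>P. polytope K) \<and> closure \<Omega> = \<Union>P)"

definition is_mesh :: "(real^3) set \<Rightarrow> (real^3) set set \<Rightarrow> bool" where
  "is_mesh \<Omega> T \<longleftrightarrow>
     finite T \<and> (\<forall>K\<in>T. polytope K \<and> interior K \<noteq> {}) \<and> \<Union>T = closure \<Omega> \<and>
     (\<forall>K\<in>T. \<forall>L\<in>T. K \<noteq> L \<longrightarrow> interior K \<inter> interior L = {})"

text \<open>A finite element space over a mesh: on each cell \<open>K\<close> its members coincide with elements of
  a finite-dimensional space \<open>span F\<close> of shape functions, which need not be polynomials.\<close>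

definition fe_space :: "(real^3) set set \<Rightarrow> (real^3 \<Rightarrow> 'b::euclidean_space) set \<Rightarrow> bool" where
  "fe_space T V \<longleftrightarrow>
     subspace V \<and>
     (\<forall>K\<in>T. \<exists>F. finite F \<and> (\<forall>v\<in>V. \<exists>p\<in>span F. \<forall>x\<in>interior K. v x = p x))"


section \<open>Lebesgue spaces\<close>

definition ae_eq :: "(real^3) set \<Rightarrow> (real^3 \<Rightarrow> 'b) \<Rightarrow> (real^3 \<Rightarrow> 'b) \<Rightarrow> bool" where
  "ae_eq \<Omega> f g \<longleftrightarrow> (AE x in lebesgue_on \<Omega>. f x = g x)"

definition L2 :: "(real^3) set \<Rightarrow> (real^3 \<Rightarrow> 'b::euclidean_space) set" where
  "L2 \<Omega> = {f \<in> borel_measurable (lebesgue_on \<Omega>). integrable (lebesgue_on \<Omega>) (\<lambda>x. (norm (f x))\<^sup>2)}"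

definition L2_inner ::
    "(real^3) set \<Rightarrow> (real^3 \<Rightarrow> 'b::euclidean_space) \<Rightarrow> (real^3 \<Rightarrow> 'b) \<Rightarrow> real" where
  "L2_inner \<Omega> f g = (\<integral>x. f x \<bullet> g x \<partial>lebesgue_on \<Omega>)"

definition L2_norm :: "(real^3) set \<Rightarrow> (real^3 \<Rightarrow> 'b::euclidean_space) \<Rightarrow> real" where
  "L2_norm \<Omega> f = sqrt (L2_inner \<Omega> f f)"

definition L2_mean_zero :: "(real^3) set \<Rightarrow> sfield set" where
  "L2_mean_zero \<Omega> = {q \<in> L2 \<Omega>. (\<integral>x. q x \<partial>lebesgue_on \<Omega>) = 0}"

definition L_infinity :: "(real^3) set \<Rightarrow> (real^3 \<Rightarrow> 'b::euclidean_space) set" where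
  "L_infinity \<Omega> =
     {f \<in> borel_measurable (lebesgue_on \<Omega>). \<exists>M. AE x in lebesgue_on \<Omega>. norm (f x) \<le> M}"


section \<open>Test functions\<close>

definition pderiv3 :: "3 \<Rightarrow> sfield \<Rightarrow> sfield" where
  "pderiv3 i f x = frechet_derivative f (at x) (axis i 1)"

primrec C_k :: "nat \<Rightarrow> sfield \<Rightarrow> bool" where
  "C_k 0 f \<longleftrightarrow> continuous_on UNIV f"
| "C_k (Suc k) f \<longleftrightarrow> (\<forall>x. f differentiable (at x)) \<and> (\<forall>i. C_k k (pderiv3 i f))"

definition test_functions :: "(real^3) set \<Rightarrow> sfield set" where
  "test_functions \<Omega> =
     {\<phi>. (\<forall>k. C_k k \<phi>) \<and> (\<exists>K. compact K \<and> K \<subseteq> \<Omega> \<and> (\<forall>x. x \<notin> K \<longrightarrow> \<phi> x = 0))}"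

definition test_fields :: "(real^3) set \<Rightarrow> vfield set" where
  "test_fields \<Omega> = {\<Phi>. \<forall>i. (\<lambda>x. \<Phi> x $ i) \<in> test_functions \<Omega>}"

definition cgrad :: "sfield \<Rightarrow> vfield" where
  "cgrad f x = (\<chi> i. pderiv3 i f x)"

definition ccurl :: "vfield \<Rightarrow> vfield" where
  "ccurl \<Phi> x = vector
     [pderiv3 2 (\<lambda>y. \<Phi> y $ 3) x - pderiv3 3 (\<lambda>y. \<Phi> y $ 2) x,
      pderiv3 3 (\<lambda>y. \<Phi> y $ 1) x - pderiv3 1 (\<lambda>y. \<Phi> y $ 3) x,
      pderiv3 1 (\<lambda>y. \<Phi> y $ 2) x - pderiv3 2 (\<lambda>y. \<Phi> y $ 1) x]"


section \<open>Weak differential operators\<close>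

text \<open>The weak derivatives are determined only up to a null set; \<open>wgrad\<close>, \<open>wdiv\<close> and \<open>wcurl\<close>
  pick a representative and are meaningful only when one exists.\<close>

definition has_wgrad :: "(real^3) set \<Rightarrow> sfield \<Rightarrow> vfield \<Rightarrow> bool" where
  "has_wgrad \<Omega> u g \<longleftrightarrow> g \<in> L2 \<Omega> \<and>
     (\<forall>\<phi>\<in>test_functions \<Omega>. \<forall>i.
        L2_inner \<Omega> u (pderiv3 i \<phi>) = - L2_inner \<Omega> (\<lambda>x. g x $ i) \<phi>)"

definition has_wdiv :: "(real^3) set \<Rightarrow> vfield \<Rightarrow> sfield \<Rightarrow> bool" where
  "has_wdiv \<Omega> B d \<longleftrightarrow> d \<in> L2 \<Omega> \<and>
     (\<forall>\<phi>\<in>test_functions \<Omega>. L2_inner \<Omega> B (cgrad \<phi>) = - L2_inner \<Omega> d \<phi>)"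

definition has_wcurl :: "(real^3) set \<Rightarrow> vfield \<Rightarrow> vfield \<Rightarrow> bool" where
  "has_wcurl \<Omega> B c \<longleftrightarrow> c \<in> L2 \<Omega> \<and>
     (\<forall>\<Phi>\<in>test_fields \<Omega>. L2_inner \<Omega> B (ccurl \<Phi>) = L2_inner \<Omega> c \<Phi>)"

definition wgrad :: "(real^3) set \<Rightarrow> sfield \<Rightarrow> vfield" where
  "wgrad \<Omega> u = (SOME g. has_wgrad \<Omega> u g)"

definition wdiv :: "(real^3) set \<Rightarrow> vfield \<Rightarrow> sfield" where
  "wdiv \<Omega> B = (SOME d. has_wdiv \<Omega> B d)"

definition wcurl :: "(real^3) set \<Rightarrow> vfield \<Rightarrow> vfield" where
  "wcurl \<Omega> B = (SOME c. has_wcurl \<Omega> B c)"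

text \<open>Row \<open>i\<close> of \<open>wjac \<Omega> u\<close> is the gradient of the \<open>i\<close>-th component, so that
  \<open>(w \<cdot> \<nabla>)u\<close> is \<open>wjac \<Omega> u x *v w x\<close>, and the inner product of \<open>real^3^3\<close> is the Frobenius one.\<close>

definition wjac :: "(real^3) set \<Rightarrow> vfield \<Rightarrow> real^3 \<Rightarrow> real^3^3" where
  "wjac \<Omega> u x = (\<chi> i. wgrad \<Omega> (\<lambda>y. u y $ i) x)"


section \<open>Sobolev spaces\<close>

definition H1 :: "(real^3) set \<Rightarrow> sfield set" where
  "H1 \<Omega> = {u \<in> L2 \<Omega>. \<exists>g. has_wgrad \<Omega> u g}"

definition H1_vec :: "(real^3) set \<Rightarrow> vfield set" where
  "H1_vec \<Omega> = {u. \<forall>i. (\<lambda>x. u x $ i) \<in> H1 \<Omega>}"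

text \<open>The closure of the test functions in the \<open>H\<^sup>1\<close> norm.\<close>

definition H1_0 :: "(real^3) set \<Rightarrow> sfield set" where
  "H1_0 \<Omega> = {u \<in> H1 \<Omega>. \<exists>\<phi>. (\<forall>n::nat. \<phi> n \<in> test_functions \<Omega>) \<and>
     (\<lambda>n. L2_norm \<Omega> (\<lambda>x. \<phi> n x - u x)) \<longlonglongrightarrow> 0 \<and>
     (\<lambda>n. L2_norm \<Omega> (\<lambda>x. cgrad (\<phi> n) x - wgrad \<Omega> u x)) \<longlonglongrightarrow> 0}"

definition H1_0_vec :: "(real^3) set \<Rightarrow> vfield set" where
  "H1_0_vec \<Omega> = {u. \<forall>i. (\<lambda>x. u x $ i) \<in> H1_0 \<Omega>}"

definition H_curl :: "(real^3) set \<Rightarrow> vfield set" where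
  "H_curl \<Omega> = {B \<in> L2 \<Omega>. \<exists>c. has_wcurl \<Omega> B c}"

definition H_div :: "(real^3) set \<Rightarrow> vfield set" where
  "H_div \<Omega> = {B \<in> L2 \<Omega>. \<exists>d. has_wdiv \<Omega> B d}"

text \<open>On a Lipschitz domain the tangential and normal traces are the functionals on the traces of
  \<open>H\<^sup>1\<close> functions given by Green's formula; vanishing trace means that this functional is zero.\<close>

definition tangential_trace :: "(real^3) set \<Rightarrow> vfield \<Rightarrow> vfield \<Rightarrow> real" where
  "tangential_trace \<Omega> B \<Phi> = L2_inner \<Omega> (wcurl \<Omega> B) \<Phi> - L2_inner \<Omega> B (wcurl \<Omega> \<Phi>)"

definition normal_trace :: "(real^3) set \<Rightarrow> vfield \<Rightarrow> sfield \<Rightarrow> real" where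
  "normal_trace \<Omega> B \<phi> = L2_inner \<Omega> (wdiv \<Omega> B) \<phi> + L2_inner \<Omega> B (wgrad \<Omega> \<phi>)"

definition H_curl_0 :: "(real^3) set \<Rightarrow> vfield set" where
  "H_curl_0 \<Omega> = {B \<in> H_curl \<Omega>. \<forall>\<Phi>\<in>H1_vec \<Omega>. tangential_trace \<Omega> B \<Phi> = 0}"

definition H_div_0 :: "(real^3) set \<Rightarrow> vfield set" where
  "H_div_0 \<Omega> = {B \<in> H_div \<Omega>. \<forall>\<phi>\<in>H1 \<Omega>. normal_trace \<Omega> B \<phi> = 0}"


section \<open>Discrete spaces\<close>

text \<open>Exactness of
  \<open>Hg \<rightarrow> Hc \<rightarrow> Hd \<rightarrow> Lh \<rightarrow> 0\<close> at the last three spaces, modulo equality almost everywhere.\<close>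

definition exact_de_Rham ::
    "(real^3) set \<Rightarrow> sfield set \<Rightarrow> vfield set \<Rightarrow> vfield set \<Rightarrow> sfield set \<Rightarrow> bool" where
  "exact_de_Rham \<Omega> Hg Hc Hd Lh \<longleftrightarrow>
     (\<forall>\<phi>\<in>Hg. \<exists>k\<in>Hc. ae_eq \<Omega> (wgrad \<Omega> \<phi>) k) \<and>
     (\<forall>k\<in>Hc. \<exists>B\<in>Hd. ae_eq \<Omega> (wcurl \<Omega> k) B) \<and>
     (\<forall>B\<in>Hd. \<exists>q\<in>Lh. ae_eq \<Omega> (wdiv \<Omega> B) q) \<and>
     (\<forall>k\<in>Hc. ae_eq \<Omega> (wcurl \<Omega> k) 0 \<longleftrightarrow> (\<exists>\<phi>\<in>Hg. ae_eq \<Omega> (wgrad \<Omega> \<phi>) k)) \<and>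
     (\<forall>B\<in>Hd. ae_eq \<Omega> (wdiv \<Omega> B) 0 \<longleftrightarrow> (\<exists>k\<in>Hc. ae_eq \<Omega> (wcurl \<Omega> k) B)) \<and>
     (\<forall>q\<in>Lh. \<exists>B\<in>Hd. ae_eq \<Omega> (wdiv \<Omega> B) q)"

text \<open>The supremum is over the unit ball rather than over quotients, so that the index set is
  nonempty even if \<open>V\<close> is trivial.\<close>

definition inf_sup_stable :: "(real^3) set \<Rightarrow> vfield set \<Rightarrow> sfield set \<Rightarrow> bool" where
  "inf_sup_stable \<Omega> V Q \<longleftrightarrow>
     (\<exists>\<beta>>0. \<forall>q\<in>Q. \<beta> * L2_norm \<Omega> q \<le>
        (SUP v\<in>{v \<in> V. L2_norm \<Omega> (wjac \<Omega> v) \<le> 1}. L2_inner \<Omega> (wdiv \<Omega> v) q))"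

definition dcurl :: "(real^3) set \<Rightarrow> vfield set \<Rightarrow> vfield \<Rightarrow> vfield" where
  "dcurl \<Omega> Hc B =
     (SOME j. j \<in> Hc \<and> (\<forall>k\<in>Hc. L2_inner \<Omega> j k = L2_inner \<Omega> B (wcurl \<Omega> k)))"

definition W_space :: "vfield set \<Rightarrow> vfield set \<Rightarrow> (vfield * vfield) set" where
  "W_space V Hd = {(u, B). u \<in> V \<and> B \<in> Hd}"

fun X_norm :: "(real^3) set \<Rightarrow> vfield set \<Rightarrow> vfield * vfield \<Rightarrow> real" where
  "X_norm \<Omega> Hc (u, B) =
     sqrt ((L2_norm \<Omega> (wjac \<Omega> u))\<^sup>2 + (L2_norm \<Omega> (wdiv \<Omega> B))\<^sup>2 + (L2_norm \<Omega> (dcurl \<Omega> Hc B))\<^sup>2)"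

definition dual_space :: "'v::real_vector set \<Rightarrow> ('v \<Rightarrow> real) \<Rightarrow> ('v \<Rightarrow> real) set" where
  "dual_space W N =
     {l. (\<forall>x\<in>W. \<forall>y\<in>W. l (x + y) = l x + l y) \<and> (\<forall>c. \<forall>x\<in>W. l (c *\<^sub>R x) = c * l x) \<and>
         (\<exists>M. \<forall>x\<in>W. \<bar>l x\<bar> \<le> M * N x)}"

definition dual_norm :: "'v set \<Rightarrow> ('v \<Rightarrow> real) \<Rightarrow> ('v \<Rightarrow> real) \<Rightarrow> real" where
  "dual_norm W N l = (SUP x\<in>{x \<in> W. N x \<le> 1}. \<bar>l x\<bar>)"


section \<open>The linearised Hall MHD forms\<close>

fun a_form ::
    "(real^3) set \<Rightarrow> vfield set \<Rightarrow> real \<Rightarrow> real \<Rightarrow> real \<Rightarrow> real \<Rightarrow> vfield \<Rightarrow> vfield \<Rightarrow>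
     vfield * vfield \<Rightarrow> vfield * vfield \<Rightarrow> real" where
  "a_form \<Omega> Hc Rey Rem S RH um Bm (u, B) (v, C) =
     inverse Rey * L2_inner \<Omega> (wjac \<Omega> u) (wjac \<Omega> v)
     + L2_inner \<Omega> (\<lambda>x. wjac \<Omega> u x *v um x) v
     - S * L2_inner \<Omega> (\<lambda>x. cross3 (dcurl \<Omega> Hc B x) (Bm x)) v
     + L2_inner \<Omega> (wdiv \<Omega> B) (wdiv \<Omega> C)
     + inverse Rem * L2_inner \<Omega> (dcurl \<Omega> Hc B) (dcurl \<Omega> Hc C)
     - L2_inner \<Omega> (\<lambda>x. cross3 (u x) (Bm x)) (dcurl \<Omega> Hc C)
     + RH * L2_inner \<Omega> (\<lambda>x. cross3 (dcurl \<Omega> Hc B x) (Bm x)) (dcurl \<Omega> Hc C)"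

fun b_form :: "(real^3) set \<Rightarrow> vfield * vfield \<Rightarrow> sfield \<Rightarrow> real" where
  "b_form \<Omega> (u, B) q = L2_inner \<Omega> (wdiv \<Omega> u) q"

definition is_solution ::
    "(real^3) set \<Rightarrow> vfield set \<Rightarrow> vfield set \<Rightarrow> vfield set \<Rightarrow> sfield set \<Rightarrow>
     real \<Rightarrow> real \<Rightarrow> real \<Rightarrow> real \<Rightarrow> vfield \<Rightarrow> vfield \<Rightarrow>
     (vfield * vfield \<Rightarrow> real) \<Rightarrow> (sfield \<Rightarrow> real) \<Rightarrow> vfield * vfield \<Rightarrow> sfield \<Rightarrow> bool" where
  "is_solution \<Omega> V Hc Hd Q Rey Rem S RH um Bm l g x p \<longleftrightarrow>
     x \<in> W_space V Hd \<and> p \<in> Q \<and>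
     (\<forall>y\<in>W_space V Hd. \<forall>q\<in>Q.
        a_form \<Omega> Hc Rey Rem S RH um Bm x y + b_form \<Omega> y p = l y \<and> b_form \<Omega> x q = g q)"

end

theory Submission
  imports Defs
begin

text \<open>
  Up to equality almost everywhere all spaces are finite-dimensional, and the mixed problem is one
  square linear system for the form
  \<open>A ((x, p), (y, q)) = a(x, y) + b(y, p) + b(x, q)\<close> on \<open>W\<^sub>h \<times> Q\<^sub>h\<close>.  Well-posedness is therefore
  nondegeneracy of \<open>A\<close>, which is an energy identity (\<open>saddle_energy\<close>).

  Test \<open>((u, B), p)\<close> with \<open>((u, S B), - p)\<close> and write \<open>j\<close> for the weak curl of \<open>B\<close>.  The two pressure
  terms cancel.  The Lorentz force and the electromotive force cancel, since
  \<open>(u \<times> B\<^sup>-) \<cdot> j = - (j \<times> B\<^sup>-) \<cdot> u\<close> and the weight \<open>S\<close> makes their coefficients agree; the Hall term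
  vanishes because \<open>j \<times> B\<^sup>-\<close> is orthogonal to \<open>j\<close>; the convection term vanishes because \<open>u\<^sup>-\<close> is
  divergence free.  What remains is
  \<open>Re\<^sup>-\<^sup>1 \<parallel>\<nabla>u\<parallel>\<^sup>2 + S \<parallel>\<nabla> \<cdot> B\<parallel>\<^sup>2 + S Re\<^sub>m\<^sup>-\<^sup>1 \<parallel>j\<parallel>\<^sup>2\<close>.  If it is zero, then \<open>u = 0\<close> by the Poincare inequality
  (\<open>H1_0_vec_Poincare\<close>), and \<open>B = 0\<close> by exactness: \<open>B\<close> is a curl \<open>\<nabla> \<times> k\<close>, whence
  \<open>\<parallel>B\<parallel>\<^sup>2 = (B, \<nabla> \<times> k) = (j, k) = 0\<close> (\<open>divergence_and_curl_zero\<close>).  The inf-sup condition then removes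
  the pressure.  As \<open>((u, B), p) \<mapsto> ((u, S B), - p)\<close> is invertible, the same identity shows that both
  kernels of \<open>A\<close> are trivial.

  The analytic part is to see that the convection term is a bilinear form at all, and that it is
  skew.  The shape functions need not be bounded, so \<open>(u\<^sup>- \<cdot> \<nabla>)u \<cdot> v\<close> is integrable only because
  \<open>H\<^sup>1\<^sub>0\<close> embeds into \<open>L\<^sup>4\<close>.  This is Ladyzhenskaya's inequality, proved for test functions by slicing
  \<open>\<real>\<^sup>3\<close> (\<open>test_function_L4\<close>) and carried over to limits (\<open>H1_limit_L4\<close>).  Skewness holds for a test
  function \<open>\<phi>\<close> in place of \<open>u\<close>, by the definition of the weak divergence applied to \<open>\<phi>\<^sup>2\<close>, and the
  \<open>L\<^sup>4\<close> bound lets one pass to the limit (\<open>convection_scalar_zero\<close>).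

  Weak derivatives are chosen representatives, so the differential operators are linear only up to
  null sets.  This rests on their uniqueness, which is the fundamental lemma of the calculus of
  variations (\<open>fundamental_lemma\<close>); the notion \<open>ae_linear\<close> records it, and \<open>L\<^sup>2\<close> products of two such
  operators are bilinear forms.

  Solvability and the stability bound are obtained together from a maximal biorthogonal system
  \<open>e\<^sub>i, w\<^sub>i\<close> (\<open>biorthogonal_complete\<close>): it satisfies
  \<open>A(y, z) = \<Sum>\<^sub>i A(y, w\<^sub>i) A(e\<^sub>i, z)\<close>, so \<open>\<Sum>\<^sub>i L(w\<^sub>i) e\<^sub>i\<close> solves \<open>A(z, \<cdot>) = L\<close> and
  \<open>\<Sum>\<^sub>i \<parallel>w\<^sub>i\<parallel> \<parallel>e\<^sub>i\<parallel>\<close> is a stability constant.  The same device, applied to the inner product of the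
  discrete curl space, yields the weak curl.
\<close>

section \<open>Nondegenerate bilinear forms on spaces of finite dimension modulo null vectors\<close>

text \<open>The elements of \<open>N\<close> are the vectors to be regarded as zero when they stand in the first argument.\<close>

definition bilinear_on ::
    "'z::real_vector set \<Rightarrow> 'z set \<Rightarrow> ('z \<Rightarrow> 'z \<Rightarrow> real) \<Rightarrow> bool" where
  "bilinear_on Z N A \<longleftrightarrow>
     (\<forall>x\<in>Z. \<forall>y\<in>Z. \<forall>z\<in>Z. A (x + y) z = A x z + A y z \<and> A z (x + y) = A z x + A z y) \<and>
     (\<forall>c. \<forall>x\<in>Z. \<forall>y\<in>Z. A (c *\<^sub>R x) y = c * A x y \<and> A x (c *\<^sub>R y) = c * A x y) \<and>
     (\<forall>x\<in>Z \<inter> N. \<forall>y\<in>Z. A x y = 0)"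

lemma bilinear_onD:
  assumes "bilinear_on Z N A" "x \<in> Z" "y \<in> Z" "z \<in> Z"
  shows "A (x + y) z = A x z + A y z" "A z (x + y) = A z x + A z y"
    "A (c *\<^sub>R x) y = c * A x y" "A x (c *\<^sub>R y) = c * A x y"
    "x \<in> N \<Longrightarrow> A x y = 0"
  using assms unfolding bilinear_on_def by auto

lemma bilinear_on_add:
  assumes "bilinear_on Z N A" "bilinear_on Z N B"
  shows "bilinear_on Z N (\<lambda>x y. A x y + B x y)"
  using assms unfolding bilinear_on_def by (simp add: algebra_simps)

lemma bilinear_on_scale:
  assumes "bilinear_on Z N A"
  shows "bilinear_on Z N (\<lambda>x y. c * A x y)"
  using assms unfolding bilinear_on_def by (simp add: algebra_simps)

lemma bilinear_on_diff:
  assumes "bilinear_on Z N A" "bilinear_on Z N B"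
  shows "bilinear_on Z N (\<lambda>x y. A x y - B x y)"
  using assms unfolding bilinear_on_def by (simp add: algebra_simps)

lemma additive_on_sum:
  fixes g :: "'z::real_vector \<Rightarrow> real"
  assumes Z: "subspace Z"
    and add: "\<And>x y. x \<in> Z \<Longrightarrow> y \<in> Z \<Longrightarrow> g (x + y) = g x + g y"
    and scale: "\<And>c x. x \<in> Z \<Longrightarrow> g (c *\<^sub>R x) = c * g x"
    and I: "finite I" "\<And>i. i \<in> I \<Longrightarrow> e i \<in> Z"
  shows "g (\<Sum>i\<in>I. c i *\<^sub>R e i) = (\<Sum>i\<in>I. c i * g (e i))"
  using I
proof (induction I rule: finite_induct)
  case empty
  show ?case using scale[of 0 0] subspace_0[OF Z] by simp
next
  case (insert i I)
  then have "(\<Sum>i\<in>I. c i *\<^sub>R e i) \<in> Z" "c i *\<^sub>R e i \<in> Z"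
    using Z by (auto intro!: subspace_sum subspace_scale)
  then show ?case using insert add scale by simp
qed

lemma bilinear_on_sum:
  assumes A: "bilinear_on Z N A" and Z: "subspace Z" and y: "y \<in> Z"
    and I: "finite I" "\<And>i. i \<in> I \<Longrightarrow> e i \<in> Z"
  shows "A (\<Sum>i\<in>I. c i *\<^sub>R e i) y = (\<Sum>i\<in>I. c i * A (e i) y)"
    and "A y (\<Sum>i\<in>I. c i *\<^sub>R e i) = (\<Sum>i\<in>I. c i * A y (e i))"
  using additive_on_sum[OF Z, of "\<lambda>x. A x y" I e c] additive_on_sum[OF Z, of "\<lambda>x. A y x" I e c]
    bilinear_onD[OF A] y I by auto

lemma bilinear_on_minus:
  assumes A: "bilinear_on Z N A" and Z: "subspace Z" and "x \<in> Z" "y \<in> Z" "z \<in> Z"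
  shows "A (x - y) z = A x z - A y z" "A z (x - y) = A z x - A z y"
proof -
  have m: "(-1) *\<^sub>R y \<in> Z" using Z \<open>y \<in> Z\<close> by (rule subspace_scale)
  show "A (x - y) z = A x z - A y z"
    using bilinear_onD(1)[OF A \<open>x \<in> Z\<close> m \<open>z \<in> Z\<close>] bilinear_onD(3)[OF A \<open>y \<in> Z\<close> \<open>z \<in> Z\<close> \<open>z \<in> Z\<close>, of "-1"]
    by simp
  show "A z (x - y) = A z x - A z y"
    using bilinear_onD(2)[OF A \<open>x \<in> Z\<close> m \<open>z \<in> Z\<close>] bilinear_onD(4)[OF A \<open>z \<in> Z\<close> \<open>y \<in> Z\<close> \<open>z \<in> Z\<close>, of "-1"]
    by simp
qed

definition biorthogonal ::
    "'z::real_vector set \<Rightarrow> ('z \<Rightarrow> 'z \<Rightarrow> real) \<Rightarrow> nat \<Rightarrow> (nat \<Rightarrow> 'z) \<Rightarrow> (nat \<Rightarrow> 'z) \<Rightarrow> bool" where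
  "biorthogonal Z A n e w \<longleftrightarrow>
     (\<forall>i<n. e i \<in> Z \<and> w i \<in> Z) \<and> (\<forall>i<n. \<forall>j<n. A (e i) (w j) = of_bool (i = j))"

text \<open>The map \<open>\<rho>\<close> sends \<open>Z\<close> into a finite-dimensional space and loses only null vectors, which is how
  "finite-dimensional modulo null vectors" is expressed without forming a quotient.  The images of the
  \<open>e\<^sub>i\<close> under \<open>\<rho>\<close> are independent, because pairing a relation between them with \<open>w\<^sub>j\<close> isolates its \<open>j\<close>-th
  coefficient.\<close>

lemma biorthogonal_bound:
  fixes \<rho> :: "'z::real_vector \<Rightarrow> 'y::real_vector"
  assumes Z: "subspace Z" and A: "bilinear_on Z N A"
    and \<rho>: "linear \<rho>" "\<And>z. z \<in> Z \<Longrightarrow> \<rho> z = 0 \<Longrightarrow> z \<in> N"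
    and F: "finite F" "\<rho> ` Z \<subseteq> span F"
    and bi: "biorthogonal Z A n e w"
  shows "n \<le> card F"
proof -
  have eZ: "e i \<in> Z" "w i \<in> Z" if "i < n" for i using bi that by (auto simp: biorthogonal_def)
  have zero: "c j = 0" if "(\<Sum>i<n. c i *\<^sub>R \<rho> (e i)) = 0" "j < n" for c j
  proof -
    have s: "(\<Sum>i<n. c i *\<^sub>R e i) \<in> Z" using eZ Z by (auto intro!: subspace_sum subspace_scale)
    have "\<rho> (\<Sum>i<n. c i *\<^sub>R e i) = 0"
      using that by (simp add: linear_sum[OF \<rho>(1)] linear_scale[OF \<rho>(1)])
    then have "A (\<Sum>i<n. c i *\<^sub>R e i) (w j) = 0"
      using \<rho>(2)[OF s] bilinear_onD(5)[OF A s] eZ that by blast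
    then have "(\<Sum>i<n. c i * A (e i) (w j)) = 0"
      using bilinear_on_sum(1)[OF A Z, of "w j" "{..<n}" e c] eZ that by simp
    also have "(\<Sum>i<n. c i * A (e i) (w j)) = (\<Sum>i<n. if i = j then c i else 0)"
      using bi that by (intro sum.cong) (auto simp: biorthogonal_def)
    finally show ?thesis using that by simp
  qed
  have inj: "inj_on (\<lambda>i. \<rho> (e i)) {..<n}"
  proof (rule inj_onI, rule ccontr)
    fix i j assume ij: "i \<in> {..<n}" "j \<in> {..<n}" "\<rho> (e i) = \<rho> (e j)" "i \<noteq> j"
    let ?c = "\<lambda>k. of_bool (k = i) - of_bool (k = j) :: real"
    have "(\<Sum>k<n. ?c k *\<^sub>R \<rho> (e k)) =
        (\<Sum>k<n. if k = i then \<rho> (e k) else 0) - (\<Sum>k<n. if k = j then \<rho> (e k) else 0)"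
      unfolding sum_subtractf[symmetric] by (intro sum.cong) auto
    also have "\<dots> = 0" using ij by simp
    finally have "?c i = 0" using zero[of ?c i] ij by blast
    then show False using ij by simp
  qed
  have ind: "independent ((\<lambda>i. \<rho> (e i)) ` {..<n})"
  proof (rule independent_if_scalars_zero)
    show "finite ((\<lambda>i. \<rho> (e i)) ` {..<n})" by simp
    fix f x assume s: "(\<Sum>x\<in>(\<lambda>i. \<rho> (e i)) ` {..<n}. f x *\<^sub>R x) = 0" and x: "x \<in> (\<lambda>i. \<rho> (e i)) ` {..<n}"
    then obtain j where j: "j < n" "x = \<rho> (e j)" by auto
    have "(\<Sum>i<n. f (\<rho> (e i)) *\<^sub>R \<rho> (e i)) = 0" using s by (simp add: sum.reindex[OF inj])
    from zero[OF this j(1)] show "f x = 0" using j by simp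
  qed
  have "(\<lambda>i. \<rho> (e i)) ` {..<n} \<subseteq> span F" using F eZ by auto
  from independent_span_bound[OF F(1) ind this] show ?thesis
    using card_image[OF inj] by simp
qed

text \<open>A biorthogonal system of maximal size splits the form.  If it did not, subtracting from some \<open>y\<close> and \<open>z\<close>
  their components along the system would leave remainders \<open>r\<close> and \<open>s\<close> that pair to zero with the system
  and satisfy \<open>A r s \<noteq> 0\<close>; after scaling they would enlarge the system.\<close>

lemma biorthogonal_complete:
  fixes \<rho> :: "'z::real_vector \<Rightarrow> 'y::real_vector"
  assumes Z: "subspace Z" and A: "bilinear_on Z N A"
    and \<rho>: "linear \<rho>" "\<And>z. z \<in> Z \<Longrightarrow> \<rho> z = 0 \<Longrightarrow> z \<in> N"
    and F: "finite F" "\<rho> ` Z \<subseteq> span F"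
  obtains n e w where "biorthogonal Z A n e w"
    "\<And>y z. y \<in> Z \<Longrightarrow> z \<in> Z \<Longrightarrow> A y z = (\<Sum>i<n. A y (w i) * A (e i) z)"
proof -
  let ?P = "\<lambda>n. \<exists>e w. biorthogonal Z A n e w"
  have P0: "?P 0" by (simp add: biorthogonal_def)
  have bound: "\<And>n. ?P n \<Longrightarrow> n \<le> card F" using biorthogonal_bound[OF assms] by blast
  define n where "n = (GREATEST n. ?P n)"
  have "?P n" unfolding n_def by (rule GreatestI_nat[of ?P, OF P0]) (use bound in blast)
  then obtain e w where bi: "biorthogonal Z A n e w" by blast
  have not: "\<not> ?P (Suc n)"
    using Greatest_le_nat[of ?P "Suc n" "card F"] bound unfolding n_def[symmetric] by fastforce
  have eZ: "e i \<in> Z" "w i \<in> Z" if "i < n" for i using bi that by (auto simp: biorthogonal_def)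
  have ortho: "A (e i) (w j) = of_bool (i = j)" if "i < n" "j < n" for i j
    using bi that by (auto simp: biorthogonal_def)
  have main: "A y z = (\<Sum>i<n. A y (w i) * A (e i) z)" if y: "y \<in> Z" and z: "z \<in> Z" for y z
  proof (rule ccontr)
    assume neq: "A y z \<noteq> (\<Sum>i<n. A y (w i) * A (e i) z)"
    define r where "r = y - (\<Sum>i<n. A y (w i) *\<^sub>R e i)"
    define s where "s = z - (\<Sum>i<n. A (e i) z *\<^sub>R w i)"
    have sums: "(\<Sum>i<n. A y (w i) *\<^sub>R e i) \<in> Z" "(\<Sum>i<n. A (e i) z *\<^sub>R w i) \<in> Z"
      using eZ Z by (auto intro!: subspace_sum subspace_scale)
    have rs: "r \<in> Z" "s \<in> Z" using sums y z Z by (auto simp: r_def s_def intro!: subspace_diff)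
    have rx: "A r x = A y x - (\<Sum>i<n. A y (w i) * A (e i) x)" if "x \<in> Z" for x
      unfolding r_def using bilinear_on_minus(1)[OF A Z y sums(1) that]
        bilinear_on_sum(1)[OF A Z that, of "{..<n}" e] eZ by simp
    have rw: "A r (w j) = 0" if "j < n" for j
    proof -
      have "(\<Sum>i<n. A y (w i) * A (e i) (w j)) = (\<Sum>i<n. if i = j then A y (w i) else 0)"
        using ortho that by (intro sum.cong) auto
      then show ?thesis using rx[of "w j"] eZ that by simp
    qed
    have es: "A (e j) s = 0" if "j < n" for j
    proof -
      have "A (e j) s = A (e j) z - (\<Sum>i<n. A (e i) z * A (e j) (w i))"
        unfolding s_def using bilinear_on_minus(2)[OF A Z z sums(2), of "e j"]
          bilinear_on_sum(2)[OF A Z, of "e j" "{..<n}" w] eZ that by simp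
      also have "(\<Sum>i<n. A (e i) z * A (e j) (w i)) = (\<Sum>i<n. if i = j then A (e i) z else 0)"
        using ortho that by (intro sum.cong) auto
      finally show ?thesis using that by simp
    qed
    have "A r s = A r z - (\<Sum>i<n. A (e i) z * A r (w i))"
      unfolding s_def using bilinear_on_minus(2)[OF A Z z sums(2) rs(1)]
          bilinear_on_sum(2)[OF A Z rs(1), of "{..<n}" w] eZ by simp
    also have "\<dots> = A r z" using rw by simp
    finally have Ars: "A r s \<noteq> 0" using rx[OF z] neq by simp
    define e' where "e' = (\<lambda>i. if i = n then (1 / A r s) *\<^sub>R r else e i)"
    define w' where "w' = (\<lambda>i. if i = n then s else w i)"
    have "biorthogonal Z A (Suc n) e' w'"
      unfolding biorthogonal_def e'_def w'_def
      using eZ rs ortho Z Ars es rw bilinear_onD(3)[OF A rs(1) _ rs(1), of _ "1 / A r s"]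
      by (auto simp: less_Suc_eq intro!: subspace_scale)
    with not show False by blast
  qed
  show ?thesis by (rule that[OF bi main])
qed

text \<open>The remainder of any \<open>z\<close> after removing its components \<open>A (e\<^sub>i) z\<close> along the \<open>w\<^sub>i\<close> lies in the right kernel
  of the form, where a solvable right-hand side \<open>L\<close> must vanish.  So \<open>L\<close> is determined by its values on
  the \<open>w\<^sub>i\<close>.\<close>

lemma biorthogonal_solve:
  assumes Z: "subspace Z" and A: "bilinear_on Z N A" and bi: "biorthogonal Z A n e w"
    and complete: "\<And>y z. y \<in> Z \<Longrightarrow> z \<in> Z \<Longrightarrow> A y z = (\<Sum>i<n. A y (w i) * A (e i) z)"
    and L: "\<And>x y. x \<in> Z \<Longrightarrow> y \<in> Z \<Longrightarrow> L (x + y) = L x + L y" "\<And>c x. x \<in> Z \<Longrightarrow> L (c *\<^sub>R x) = c * L x"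
      "\<And>r. r \<in> Z \<Longrightarrow> (\<And>y. y \<in> Z \<Longrightarrow> A y r = 0) \<Longrightarrow> L r = 0"
    and z: "z \<in> Z"
  shows "(\<Sum>i<n. L (w i) *\<^sub>R e i) \<in> Z" "A (\<Sum>i<n. L (w i) *\<^sub>R e i) z = L z"
proof -
  have eZ: "e i \<in> Z" "w i \<in> Z" if "i < n" for i using bi that by (auto simp: biorthogonal_def)
  show "(\<Sum>i<n. L (w i) *\<^sub>R e i) \<in> Z" using eZ Z by (auto intro!: subspace_sum subspace_scale)
  let ?s = "\<Sum>i<n. A (e i) z *\<^sub>R w i"
  have s: "?s \<in> Z" using eZ Z by (auto intro!: subspace_sum subspace_scale)
  have "L (z - ?s) = 0"
  proof (rule L(3))
    show "z - ?s \<in> Z" using s z Z by (auto intro: subspace_diff)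
    fix y assume y: "y \<in> Z"
    show "A y (z - ?s) = 0"
      using bilinear_on_minus(2)[OF A Z z s y] bilinear_on_sum(2)[OF A Z y, of "{..<n}" w] eZ complete[OF y z]
      by (simp add: mult.commute)
  qed
  moreover have "L z = L (z - ?s) + L ?s"
    using L(1)[of "z - ?s" ?s] s z Z by (auto intro: subspace_diff)
  moreover have "L ?s = (\<Sum>i<n. A (e i) z * L (w i))"
    using additive_on_sum[OF Z, of L "{..<n}" w] L eZ by auto
  ultimately show "A (\<Sum>i<n. L (w i) *\<^sub>R e i) z = L z"
    using bilinear_on_sum(1)[OF A Z z, of "{..<n}" e] eZ by (simp add: mult.commute)
qed

section \<open>The space of square integrable functions\<close>

lemma ae_eq_refl [simp]: "ae_eq \<Omega> f f"
  by (simp add: ae_eq_def)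

lemma ae_eq_sym: "ae_eq \<Omega> f g \<Longrightarrow> ae_eq \<Omega> g f"
  unfolding ae_eq_def by (auto elim: eventually_mono)

lemma L2_D:
  assumes "f \<in> L2 \<Omega>"
  shows "f \<in> borel_measurable (lebesgue_on \<Omega>)"
    and "integrable (lebesgue_on \<Omega>) (\<lambda>x. (norm (f x))\<^sup>2)"
  using assms by (auto simp: L2_def)

lemma L2_I:
  assumes "f \<in> borel_measurable (lebesgue_on \<Omega>)" "integrable (lebesgue_on \<Omega>) g"
    "AE x in lebesgue_on \<Omega>. (norm (f x))\<^sup>2 \<le> g x"
  shows "f \<in> L2 \<Omega>"
proof -
  have "AE x in lebesgue_on \<Omega>. norm ((norm (f x))\<^sup>2) \<le> norm (g x)"
    using assms(3) by eventually_elim auto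
  moreover have "(\<lambda>x. (norm (f x))\<^sup>2) \<in> borel_measurable (lebesgue_on \<Omega>)"
    using assms(1) by simp
  ultimately have "integrable (lebesgue_on \<Omega>) (\<lambda>x. (norm (f x))\<^sup>2)"
    by (intro Bochner_Integration.integrable_bound[OF assms(2)])
  then show ?thesis using assms(1) by (simp add: L2_def)
qed

text \<open>Used for multiplication by bounded coefficients, in particular for cross products with \<open>B\<^sup>-\<close>.\<close>

lemma L2_bounded_mult:
  assumes f: "f \<in> L2 \<Omega>" and g: "g \<in> borel_measurable (lebesgue_on \<Omega>)"
    and "AE x in lebesgue_on \<Omega>. norm (g x) \<le> M * norm (f x)"
  shows "g \<in> L2 \<Omega>"
proof (rule L2_I[OF g])
  show "integrable (lebesgue_on \<Omega>) (\<lambda>x. M\<^sup>2 * (norm (f x))\<^sup>2)" using L2_D[OF f] by simp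
  show "AE x in lebesgue_on \<Omega>. (norm (g x))\<^sup>2 \<le> M\<^sup>2 * (norm (f x))\<^sup>2"
    using assms(3)
  proof eventually_elim
    case (elim x)
    then have "(norm (g x))\<^sup>2 \<le> (M * norm (f x))\<^sup>2" by (intro power_mono) auto
    then show ?case by (simp add: power_mult_distrib)
  qed
qed

lemma L2_zero: "(\<lambda>_. 0) \<in> L2 \<Omega>"
  by (simp add: L2_def)

lemma L2_scale:
  assumes "f \<in> L2 \<Omega>"
  shows "(\<lambda>x. c *\<^sub>R f x) \<in> L2 \<Omega>"
  using L2_D[OF assms] by (intro L2_bounded_mult[OF assms, where M="\<bar>c\<bar>"]) auto

lemma L2_scale_real: "f \<in> L2 \<Omega> \<Longrightarrow> (\<lambda>x. c * f x :: real) \<in> L2 \<Omega>"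
  using L2_scale[of f \<Omega> c] by simp

lemma L2_add:
  assumes f: "f \<in> L2 \<Omega>" and g: "g \<in> L2 \<Omega>"
  shows "(\<lambda>x. f x + g x) \<in> L2 \<Omega>"
proof (rule L2_I)
  show "(\<lambda>x. f x + g x) \<in> borel_measurable (lebesgue_on \<Omega>)"
    using L2_D[OF f] L2_D[OF g] by (intro borel_measurable_add)
  show "integrable (lebesgue_on \<Omega>) (\<lambda>x. 2 * (norm (f x))\<^sup>2 + 2 * (norm (g x))\<^sup>2)"
    using L2_D[OF f] L2_D[OF g] by simp
  have "(norm (f x + g x))\<^sup>2 \<le> 2 * (norm (f x))\<^sup>2 + 2 * (norm (g x))\<^sup>2" for x
  proof -
    have "(norm (f x + g x))\<^sup>2 \<le> (norm (f x) + norm (g x))\<^sup>2"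
      by (intro power_mono norm_triangle_ineq) auto
    also have "\<dots> \<le> 2 * (norm (f x))\<^sup>2 + 2 * (norm (g x))\<^sup>2"
      using sum_squares_bound[of "norm (f x)" "norm (g x)"] by (simp add: power2_sum)
    finally show ?thesis .
  qed
  then show "AE x in lebesgue_on \<Omega>. (norm (f x + g x))\<^sup>2 \<le> 2 * (norm (f x))\<^sup>2 + 2 * (norm (g x))\<^sup>2"
    by simp
qed

lemma L2_diff:
  assumes "f \<in> L2 \<Omega>" "g \<in> L2 \<Omega>"
  shows "(\<lambda>x. f x - g x) \<in> L2 \<Omega>"
  using L2_add[OF assms(1) L2_scale[OF assms(2), of "-1"]] by simp

lemma L2_integrable_inner:
  assumes f: "f \<in> L2 \<Omega>" and g: "g \<in> L2 \<Omega>"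
  shows "integrable (lebesgue_on \<Omega>) (\<lambda>x. f x \<bullet> g x)"
proof (rule Bochner_Integration.integrable_bound)
  show "integrable (lebesgue_on \<Omega>) (\<lambda>x. (norm (f x))\<^sup>2 + (norm (g x))\<^sup>2)"
    using L2_D[OF f] L2_D[OF g] by simp
  show "(\<lambda>x. f x \<bullet> g x) \<in> borel_measurable (lebesgue_on \<Omega>)"
    using L2_D[OF f] L2_D[OF g] by (intro borel_measurable_inner)
  have "\<bar>f x \<bullet> g x\<bar> \<le> (norm (f x))\<^sup>2 + (norm (g x))\<^sup>2" for x
    using Cauchy_Schwarz_ineq2[of "f x" "g x"] sum_squares_bound[of "norm (f x)" "norm (g x)"]
      mult_nonneg_nonneg[of "norm (f x)" "norm (g x)"] by simp
  then show "AE x in lebesgue_on \<Omega>. norm (f x \<bullet> g x) \<le> norm ((norm (f x))\<^sup>2 + (norm (g x))\<^sup>2)"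
    by (auto simp: abs_of_nonneg)
qed

lemma L2_vec_nth:
  fixes f :: "real^3 \<Rightarrow> 'b::euclidean_space^'n"
  assumes f: "f \<in> L2 \<Omega>"
  shows "(\<lambda>x. f x $ i) \<in> L2 \<Omega>"
proof (rule L2_bounded_mult[OF f, where M=1])
  show "(\<lambda>x. f x $ i) \<in> borel_measurable (lebesgue_on \<Omega>)"
    using measurable_compose[OF L2_D(1)[OF f]
        borel_measurable_continuous_onI[of "\<lambda>y. y $ i"]] by (simp add: continuous_on_component)
  show "AE x in lebesgue_on \<Omega>. norm (f x $ i) \<le> 1 * norm (f x)"
    by (simp add: Finite_Cartesian_Product.norm_nth_le)
qed

lemma borel_measurable_vec_lambda:
  fixes f :: "'a \<Rightarrow> 'b::euclidean_space^'n"
  assumes "\<And>i. (\<lambda>x. f x $ i) \<in> borel_measurable M"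
  shows "f \<in> borel_measurable M"
proof (subst borel_measurable_euclidean_space, rule ballI)
  fix b :: "'b^'n" assume "b \<in> Basis"
  then obtain i u where b: "b = axis i u" by (auto simp: Basis_vec_def)
  show "(\<lambda>x. f x \<bullet> b) \<in> borel_measurable M"
    unfolding b inner_axis by (rule borel_measurable_inner[OF assms borel_measurable_const])
qed

lemma L2_vec_lambda:
  fixes f :: "real^3 \<Rightarrow> 'b::euclidean_space^'n"
  assumes f: "\<And>i. (\<lambda>x. f x $ i) \<in> L2 \<Omega>"
  shows "f \<in> L2 \<Omega>"
proof (rule L2_I)
  show "f \<in> borel_measurable (lebesgue_on \<Omega>)"
    using L2_D(1)[OF f] by (rule borel_measurable_vec_lambda)
  show "integrable (lebesgue_on \<Omega>) (\<lambda>x. \<Sum>i\<in>UNIV. (norm (f x $ i))\<^sup>2)"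
    using L2_D(2)[OF f] by simp
  show "AE x in lebesgue_on \<Omega>. (norm (f x))\<^sup>2 \<le> (\<Sum>i\<in>UNIV. (norm (f x $ i))\<^sup>2)"
    unfolding norm_vec_def L2_set_def by (subst real_sqrt_pow2) (auto intro: sum_nonneg)
qed

lemma L2_inner_commute: "L2_inner \<Omega> f g = L2_inner \<Omega> g f"
  by (simp add: L2_inner_def inner_commute)

lemma L2_inner_add:
  assumes "f \<in> L2 \<Omega>" "g \<in> L2 \<Omega>" "h \<in> L2 \<Omega>"
  shows "L2_inner \<Omega> (\<lambda>x. f x + g x) h = L2_inner \<Omega> f h + L2_inner \<Omega> g h"
  unfolding L2_inner_def inner_add_left using L2_integrable_inner assms
  by (intro Bochner_Integration.integral_add) auto

lemma L2_inner_diff: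
  assumes "f \<in> L2 \<Omega>" "g \<in> L2 \<Omega>" "h \<in> L2 \<Omega>"
  shows "L2_inner \<Omega> (\<lambda>x. f x - g x) h = L2_inner \<Omega> f h - L2_inner \<Omega> g h"
  unfolding L2_inner_def inner_diff_left using L2_integrable_inner assms
  by (intro Bochner_Integration.integral_diff) auto

lemma L2_inner_scale: "L2_inner \<Omega> (\<lambda>x. c *\<^sub>R f x) h = c * L2_inner \<Omega> f h"
  by (simp add: L2_inner_def)

lemma L2_inner_cong_ae:
  assumes "f \<in> borel_measurable (lebesgue_on \<Omega>)" "f' \<in> borel_measurable (lebesgue_on \<Omega>)"
    "g \<in> borel_measurable (lebesgue_on \<Omega>)" "g' \<in> borel_measurable (lebesgue_on \<Omega>)"
    and "ae_eq \<Omega> f f'" "ae_eq \<Omega> g g'"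
  shows "L2_inner \<Omega> f g = L2_inner \<Omega> f' g'"
  unfolding L2_inner_def
proof (rule integral_cong_AE)
  show "AE x in lebesgue_on \<Omega>. f x \<bullet> g x = f' x \<bullet> g' x"
    using assms(5,6) unfolding ae_eq_def by eventually_elim auto
qed (use assms in \<open>auto intro!: borel_measurable_inner\<close>)

lemma L2_inner_cong:
  assumes "f \<in> L2 \<Omega>" "f' \<in> L2 \<Omega>" "g \<in> L2 \<Omega>" "g' \<in> L2 \<Omega>" "ae_eq \<Omega> f f'" "ae_eq \<Omega> g g'"
  shows "L2_inner \<Omega> f g = L2_inner \<Omega> f' g'"
  using assms by (intro L2_inner_cong_ae L2_D)

lemma L2_inner_self_nonneg: "0 \<le> L2_inner \<Omega> f f"
  unfolding L2_inner_def by (intro Bochner_Integration.integral_nonneg) auto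

lemma L2_norm_nonneg [simp]: "0 \<le> L2_norm \<Omega> f"
  by (simp add: L2_norm_def L2_inner_self_nonneg)

lemma L2_norm_power2: "(L2_norm \<Omega> f)\<^sup>2 = L2_inner \<Omega> f f"
  by (simp add: L2_norm_def L2_inner_self_nonneg)

lemma L2_norm_scale: "L2_norm \<Omega> (\<lambda>x. c *\<^sub>R f x) = \<bar>c\<bar> * L2_norm \<Omega> f"
proof -
  have "L2_inner \<Omega> (\<lambda>x. c *\<^sub>R f x) (\<lambda>x. c *\<^sub>R f x) = c\<^sup>2 * L2_inner \<Omega> f f"
    by (simp add: L2_inner_def power2_eq_square mult.assoc)
  then show ?thesis by (simp add: L2_norm_def real_sqrt_mult)
qed

lemma L2_norm_cong:
  assumes "f \<in> L2 \<Omega>" "f' \<in> L2 \<Omega>" "ae_eq \<Omega> f f'"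
  shows "L2_norm \<Omega> f = L2_norm \<Omega> f'"
  unfolding L2_norm_def using L2_inner_cong[of f \<Omega> f' f f'] assms by simp

lemma L2_norm_zero_iff:
  assumes "f \<in> L2 \<Omega>"
  shows "L2_norm \<Omega> f = 0 \<longleftrightarrow> ae_eq \<Omega> f (\<lambda>_. 0)"
proof -
  have "L2_norm \<Omega> f = 0 \<longleftrightarrow> L2_inner \<Omega> f f = 0" by (simp add: L2_norm_def)
  also have "\<dots> \<longleftrightarrow> (AE x in lebesgue_on \<Omega>. f x \<bullet> f x = 0)"
    unfolding L2_inner_def using L2_integrable_inner[OF assms assms]
    by (intro integral_nonneg_eq_0_iff_AE) auto
  finally show ?thesis by (simp add: ae_eq_def)
qed

lemma L2_inner_zero_left: "ae_eq \<Omega> f (\<lambda>_. 0) \<Longrightarrow> L2_inner \<Omega> f g = 0"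
  unfolding L2_inner_def ae_eq_def
  by (rule integral_eq_zero_AE) (auto elim: eventually_mono)

lemma L2_inner_zero_right: "ae_eq \<Omega> g (\<lambda>_. 0) \<Longrightarrow> L2_inner \<Omega> f g = 0"
  using L2_inner_zero_left[of \<Omega> g f] by (simp add: L2_inner_commute)

lemma L2_Cauchy_Schwarz:
  assumes f: "f \<in> L2 \<Omega>" and g: "g \<in> L2 \<Omega>"
  shows "\<bar>L2_inner \<Omega> f g\<bar> \<le> L2_norm \<Omega> f * L2_norm \<Omega> g"
proof (cases "L2_norm \<Omega> g = 0")
  case True
  then have "L2_inner \<Omega> g f = 0" using L2_inner_zero_left L2_norm_zero_iff[OF g] by blast
  then show ?thesis by (simp add: L2_inner_commute)
next
  case False
  define G where "G = L2_inner \<Omega> g g"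
  \<comment> \<open>The coefficient of the projection of f onto g.\<close>
  define c where "c = L2_inner \<Omega> f g / G"
  have G: "G > 0" using False L2_inner_self_nonneg[of \<Omega> g] by (auto simp: L2_norm_def G_def)
  have cg: "(\<lambda>x. c *\<^sub>R g x) \<in> L2 \<Omega>" by (rule L2_scale[OF g])
  have fc: "(\<lambda>x. f x - c *\<^sub>R g x) \<in> L2 \<Omega>" by (rule L2_diff[OF f cg])
  have r: "L2_inner \<Omega> h (\<lambda>x. f x - c *\<^sub>R g x) = L2_inner \<Omega> f h - c * L2_inner \<Omega> g h" if "h \<in> L2 \<Omega>" for h
    using L2_inner_diff[OF f cg that] L2_inner_commute[of \<Omega> h "\<lambda>x. f x - c *\<^sub>R g x"]
    by (simp add: L2_inner_scale)
  have "0 \<le> L2_inner \<Omega> (\<lambda>x. f x - c *\<^sub>R g x) (\<lambda>x. f x - c *\<^sub>R g x)" by (rule L2_inner_self_nonneg)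
  also have "\<dots> = L2_inner \<Omega> f f - 2 * c * L2_inner \<Omega> f g + c\<^sup>2 * G"
    unfolding r[OF fc] L2_inner_commute[of \<Omega> f "\<lambda>x. f x - c *\<^sub>R g x"]
      L2_inner_commute[of \<Omega> g "\<lambda>x. f x - c *\<^sub>R g x"]
    unfolding r[OF f] r[OF g] L2_inner_diff[OF f cg f] L2_inner_diff[OF f cg g] L2_inner_scale
      L2_inner_commute[of \<Omega> g f] G_def
    by (simp add: algebra_simps power2_eq_square)
  also have "\<dots> = L2_inner \<Omega> f f - (L2_inner \<Omega> f g)\<^sup>2 / G"
    using G by (simp add: c_def field_simps power2_eq_square)
  finally have "(L2_inner \<Omega> f g)\<^sup>2 \<le> L2_inner \<Omega> f f * G" using G by (simp add: field_simps)
  then have "(L2_inner \<Omega> f g)\<^sup>2 \<le> (L2_norm \<Omega> f * L2_norm \<Omega> g)\<^sup>2"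
    by (simp add: power_mult_distrib L2_norm_power2 G_def)
  then show ?thesis by (metis abs_le_square_iff abs_of_nonneg L2_norm_nonneg mult_nonneg_nonneg)
qed

lemma L2_norm_triangle:
  assumes f: "f \<in> L2 \<Omega>" and g: "g \<in> L2 \<Omega>"
  shows "L2_norm \<Omega> (\<lambda>x. f x + g x) \<le> L2_norm \<Omega> f + L2_norm \<Omega> g"
proof (rule power2_le_imp_le)
  note fg = L2_add[OF f g]
  have "(L2_norm \<Omega> (\<lambda>x. f x + g x))\<^sup>2 = L2_inner \<Omega> f f + 2 * L2_inner \<Omega> f g + L2_inner \<Omega> g g"
    using L2_inner_add[OF f g fg] L2_inner_add[OF f g f] L2_inner_add[OF f g g]
      L2_inner_commute[of \<Omega> "\<lambda>x. f x + g x" f] L2_inner_commute[of \<Omega> "\<lambda>x. f x + g x" g]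
      L2_inner_commute[of \<Omega> g f]
    by (simp add: L2_norm_power2)
  also have "\<dots> \<le> (L2_norm \<Omega> f + L2_norm \<Omega> g)\<^sup>2"
    using L2_Cauchy_Schwarz[OF f g] by (simp add: power2_sum L2_norm_power2)
  finally show "(L2_norm \<Omega> (\<lambda>x. f x + g x))\<^sup>2 \<le> (L2_norm \<Omega> f + L2_norm \<Omega> g)\<^sup>2" .
qed simp

lemma L2_norm_diff_triangle:
  assumes f: "f \<in> L2 \<Omega>" and g: "g \<in> L2 \<Omega>"
  shows "\<bar>L2_norm \<Omega> f - L2_norm \<Omega> g\<bar> \<le> L2_norm \<Omega> (\<lambda>x. f x - g x)"
    and "L2_norm \<Omega> (\<lambda>x. f x - g x) \<le> L2_norm \<Omega> f + L2_norm \<Omega> g"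
proof -
  have gf: "L2_norm \<Omega> (\<lambda>x. g x - f x) = L2_norm \<Omega> (\<lambda>x. f x - g x)"
    using L2_norm_scale[of \<Omega> "-1" "\<lambda>x. f x - g x"] by simp
  show "\<bar>L2_norm \<Omega> f - L2_norm \<Omega> g\<bar> \<le> L2_norm \<Omega> (\<lambda>x. f x - g x)"
    using L2_norm_triangle[OF L2_diff[OF f g] g] L2_norm_triangle[OF L2_diff[OF g f] f] gf by simp
  show "L2_norm \<Omega> (\<lambda>x. f x - g x) \<le> L2_norm \<Omega> f + L2_norm \<Omega> g"
    using L2_norm_triangle[OF f L2_scale[OF g, of "-1"]] L2_norm_scale[of \<Omega> "-1" g] by simp
qed

lemma L2_norm_tendsto:
  assumes f: "\<And>n. f n \<in> L2 \<Omega>" and g: "g \<in> L2 \<Omega>"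
    and lim: "(\<lambda>n. L2_norm \<Omega> (\<lambda>x. f n x - g x)) \<longlonglongrightarrow> 0"
  shows "(\<lambda>n. L2_norm \<Omega> (f n)) \<longlonglongrightarrow> L2_norm \<Omega> g"
proof -
  have "(\<lambda>n. L2_norm \<Omega> (f n) - L2_norm \<Omega> g) \<longlonglongrightarrow> 0"
    by (rule Lim_null_comparison[OF _ lim]) (use L2_norm_diff_triangle(1)[OF f g] in simp)
  then show ?thesis by (rule LIM_zero_cancel)
qed

lemma L2_inner_tendsto:
  assumes f: "\<And>n. f n \<in> L2 \<Omega>" "f' \<in> L2 \<Omega>" and g: "\<And>n. g n \<in> L2 \<Omega>" "g' \<in> L2 \<Omega>"
    and limf: "(\<lambda>n. L2_norm \<Omega> (\<lambda>x. f n x - f' x)) \<longlonglongrightarrow> 0"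
    and limg: "(\<lambda>n. L2_norm \<Omega> (\<lambda>x. g n x - g' x)) \<longlonglongrightarrow> 0"
  shows "(\<lambda>n. L2_inner \<Omega> (f n) (g n)) \<longlonglongrightarrow> L2_inner \<Omega> f' g'"
proof -
  have "\<bar>L2_inner \<Omega> (f n) (g n) - L2_inner \<Omega> f' g'\<bar> \<le>
      L2_norm \<Omega> (\<lambda>x. f n x - f' x) * L2_norm \<Omega> (g n) + L2_norm \<Omega> f' * L2_norm \<Omega> (\<lambda>x. g n x - g' x)" for n
  proof -
    have "L2_inner \<Omega> (f n) (g n) - L2_inner \<Omega> f' g' =
        L2_inner \<Omega> (\<lambda>x. f n x - f' x) (g n) + L2_inner \<Omega> f' (\<lambda>x. g n x - g' x)"
      using L2_inner_diff[OF f(1)[of n] f(2) g(1)[of n]] L2_inner_diff[OF g(1)[of n] g(2) f(2)]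
      unfolding L2_inner_commute[of \<Omega> f'] by linarith
    then show ?thesis
      using L2_Cauchy_Schwarz[OF L2_diff[OF f(1)[of n] f(2)] g(1)[of n]]
        L2_Cauchy_Schwarz[OF f(2) L2_diff[OF g(1)[of n] g(2)]] by linarith
  qed
  moreover have "(\<lambda>n. L2_norm \<Omega> (\<lambda>x. f n x - f' x) * L2_norm \<Omega> (g n) +
      L2_norm \<Omega> f' * L2_norm \<Omega> (\<lambda>x. g n x - g' x)) \<longlonglongrightarrow> 0 * L2_norm \<Omega> g' + L2_norm \<Omega> f' * 0"
    by (intro tendsto_intros limf limg L2_norm_tendsto[OF g limg])
  ultimately have "(\<lambda>n. L2_inner \<Omega> (f n) (g n) - L2_inner \<Omega> f' g') \<longlonglongrightarrow> 0"
    by (intro Lim_null_comparison[of "\<lambda>n. L2_inner \<Omega> (f n) (g n) - L2_inner \<Omega> f' g'"]) auto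
  then show ?thesis by (rule LIM_zero_cancel)
qed

section \<open>Test functions\<close>

lemma pderiv3_eq:
  assumes "(f has_derivative D) (at x)"
  shows "pderiv3 i f x = D (axis i 1)"
  using frechet_derivative_at[OF assms] by (simp add: pderiv3_def)

lemma pderiv3_add:
  assumes "f differentiable (at x)" "g differentiable (at x)"
  shows "pderiv3 i (\<lambda>x. f x + g x) x = pderiv3 i f x + pderiv3 i g x"
proof -
  obtain D E where "(f has_derivative D) (at x)" "(g has_derivative E) (at x)"
    using assms by (auto simp: differentiable_def)
  then show ?thesis
    using pderiv3_eq[OF has_derivative_add, of f D x g E i] by (simp add: pderiv3_eq)
qed

lemma pderiv3_mult:
  assumes "f differentiable (at x)" "g differentiable (at x)"
  shows "pderiv3 i (\<lambda>x. f x * g x) x = f x * pderiv3 i g x + pderiv3 i f x * g x"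
proof -
  obtain D E where "(f has_derivative D) (at x)" "(g has_derivative E) (at x)"
    using assms by (auto simp: differentiable_def)
  then show ?thesis
    using pderiv3_eq[OF has_derivative_mult, of f D x g E i] by (simp add: pderiv3_eq)
qed

lemma C_k_Suc_D:
  assumes "C_k (Suc k) f"
  shows "f differentiable (at x)" "C_k k (pderiv3 i f)" "C_k k f"
proof -
  show "f differentiable (at x)" "C_k k (pderiv3 i f)" using assms by auto
  show "C_k k f" using assms
  proof (induction k arbitrary: f)
    case 0
    then have "f differentiable (at x)" for x by auto
    then show ?case
      by (auto intro!: differentiable_imp_continuous_on simp: differentiable_on_def)
  next
    case (Suc k)
    then have "C_k (Suc k) (pderiv3 i f)" for i by auto
    then have "C_k k (pderiv3 i f)" for i by (rule Suc.IH)
    then show ?case using Suc.prems by auto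
  qed
qed

lemma C_k_const: "C_k k (\<lambda>_. c)"
proof (induction k arbitrary: c)
  case (Suc k)
  have "pderiv3 i (\<lambda>_. c) = (\<lambda>_. 0)" for i
    by (rule ext) (simp add: pderiv3_eq[OF has_derivative_const])
  then show ?case using Suc by simp
qed simp

lemma C_k_add: "C_k k f \<Longrightarrow> C_k k g \<Longrightarrow> C_k k (\<lambda>x. f x + g x)"
proof (induction k arbitrary: f g)
  case (Suc k)
  have "pderiv3 i (\<lambda>x. f x + g x) = (\<lambda>x. pderiv3 i f x + pderiv3 i g x)" for i
    using Suc.prems by (intro ext pderiv3_add) auto
  then show ?case using Suc by auto
qed (auto intro: continuous_on_add)

lemma C_k_mult: "C_k k f \<Longrightarrow> C_k k g \<Longrightarrow> C_k k (\<lambda>x. f x * g x)"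
proof (induction k arbitrary: f g)
  case (Suc k)
  have "pderiv3 i (\<lambda>x. f x * g x) = (\<lambda>x. f x * pderiv3 i g x + pderiv3 i f x * g x)" for i
    using Suc.prems by (intro ext pderiv3_mult) auto
  moreover have "C_k k (\<lambda>x. f x * pderiv3 i g x + pderiv3 i f x * g x)" for i
    using Suc.prems C_k_Suc_D(3) by (intro C_k_add Suc.IH) auto
  ultimately show ?case using Suc.prems by auto
qed (auto intro: continuous_on_mult)

lemma C_k_diff: "C_k k f \<Longrightarrow> C_k k g \<Longrightarrow> C_k k (\<lambda>x. f x - g x)"
  using C_k_add[of k f "\<lambda>x. (-1) * g x"] C_k_mult[OF C_k_const[of k "-1"], of g] by simp

lemma C_k_power: "C_k k f \<Longrightarrow> C_k k (\<lambda>x. f x ^ n)"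
  by (induction n) (auto intro: C_k_mult C_k_const)

text \<open>With \<open>k = 0\<close> this is the standard smooth function that is flat at the origin.  Dividing by powers of
  \<open>t\<close> gives a family that is closed under differentiation up to linear combinations
  (\<open>exp_flat_deriv\<close>), so all derivatives are treated at once.\<close>

definition exp_flat :: "nat \<Rightarrow> real \<Rightarrow> real" where
  "exp_flat k t = (if t > 0 then exp (- 1 / t) / t ^ k else 0)"

lemma exp_flat_tendsto_0: "(exp_flat k \<longlongrightarrow> 0) (at 0)"
proof (rule filterlim_split_at)
  have "((\<lambda>t. inverse t ^ k / exp (inverse t)) \<longlongrightarrow> (0::real)) (at_right 0)"
    by (rule filterlim_compose[OF tendsto_power_div_exp_0 filterlim_inverse_at_top_right])
  moreover have "\<forall>\<^sub>F t in at_right 0. inverse t ^ k / exp (inverse t) = exp_flat k t"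
    by (rule eventually_at_right_less[THEN eventually_mono])
       (simp add: exp_flat_def exp_minus field_simps)
  ultimately show "(exp_flat k \<longlongrightarrow> 0) (at_right 0)" by (rule Lim_transform_eventually)
  have "\<forall>\<^sub>F t in at_left 0. 0 = exp_flat k t"
    using eventually_at_left_real[of "-1" 0] by (auto elim!: eventually_mono simp: exp_flat_def)
  then show "(exp_flat k \<longlongrightarrow> 0) (at_left 0)"
    by (rule Lim_transform_eventually[OF tendsto_const])
qed

lemma exp_flat_deriv:
  "(exp_flat k has_real_derivative exp_flat (k + 2) t - k * exp_flat (k + 1) t) (at t)"
proof -
  consider "t > 0" | "t < 0" | "t = 0" by linarith
  then show ?thesis
  proof cases
    case 1
    have "((\<lambda>t. exp (- 1 / t) / t ^ k) has_real_derivative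
        exp (- 1 / t) / t ^ (k + 2) - k * (exp (- 1 / t) / t ^ (k + 1))) (at t)"
      using 1 by (auto intro!: derivative_eq_intros) (cases k; auto simp: field_simps power2_eq_square)
    then show ?thesis
      using 1 by (subst DERIV_cong_ev[OF refl eventually_mono[OF eventually_nhds_in_open[of "{0<..}"]] refl])
        (auto simp: exp_flat_def)
  next
    case 2
    have "((\<lambda>_. 0) has_real_derivative 0) (at t)" by simp
    then have "(exp_flat k has_real_derivative 0) (at t)"
      using 2 by (subst DERIV_cong_ev[OF refl eventually_mono[OF eventually_nhds_in_open[of "{..<0}"]] refl])
        (auto simp: exp_flat_def)
    then show ?thesis using 2 by (simp add: exp_flat_def)
  next
    case 3
    have "exp_flat (k + 1) = (\<lambda>y. (exp_flat k y - exp_flat k 0) / (y - 0))"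
      by (rule ext) (simp add: exp_flat_def)
    then have "((\<lambda>y. (exp_flat k y - exp_flat k 0) / (y - 0)) \<longlongrightarrow> 0) (at 0)"
      using exp_flat_tendsto_0[of "k + 1"] by (simp only:)
    then show ?thesis using 3 by (simp add: has_field_derivative_iff exp_flat_def)
  qed
qed

lemma C_k_exp_flat: "C_k m (\<lambda>x. exp_flat k (a * x $ i + b))"
proof (induction m arbitrary: k)
  case 0
  have "isCont (exp_flat k) t" for t using exp_flat_deriv DERIV_isCont by blast
  then have "continuous_on UNIV (exp_flat k)" by (simp add: continuous_at_imp_continuous_on)
  then show ?case
    unfolding C_k.simps by (rule continuous_on_compose2) (auto intro!: continuous_intros)
next
  case (Suc m)
  let ?d = "\<lambda>x::real^3. exp_flat (k + 2) (a * x $ i + b) - k * exp_flat (k + 1) (a * x $ i + b)"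
  have "((\<lambda>x::real^3. a * x $ i + b) has_derivative (\<lambda>h. a * h $ i)) (at x)" for x
    by (auto intro!: derivative_eq_intros bounded_linear_imp_has_derivative)
  from has_derivative_compose[OF this exp_flat_deriv[unfolded has_field_derivative_def]]
  have D: "((\<lambda>x. exp_flat k (a * x $ i + b)) has_derivative (\<lambda>h. ?d x * (a * h $ i))) (at x)" for x
    by simp
  have "pderiv3 j (\<lambda>x. exp_flat k (a * x $ i + b)) = (\<lambda>x. ?d x * (a * axis j 1 $ i))" for j
    by (rule ext) (rule pderiv3_eq[OF D])
  moreover have "C_k m (\<lambda>x. ?d x * c)" for c
    by (intro C_k_mult C_k_diff C_k_const Suc)
  ultimately show ?case using D by (auto simp: differentiable_def)
qed

lemma test_functionsI:
  assumes "\<And>k. C_k k \<phi>" "compact K" "K \<subseteq> \<Omega>" "\<And>x. x \<notin> K \<Longrightarrow> \<phi> x = 0"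
  shows "\<phi> \<in> test_functions \<Omega>"
  using assms by (auto simp: test_functions_def)

lemma test_functionsE:
  assumes "\<phi> \<in> test_functions \<Omega>"
  obtains K where "\<And>k. C_k k \<phi>" "compact K" "K \<subseteq> \<Omega>" "\<And>x. x \<notin> K \<Longrightarrow> \<phi> x = 0"
  using assms by (auto simp: test_functions_def)

lemma test_function_differentiable:
  assumes "\<phi> \<in> test_functions \<Omega>"
  shows "\<phi> differentiable (at x)" "continuous_on UNIV \<phi>"
proof -
  have "C_k k \<phi>" for k using assms by (auto simp: test_functions_def)
  from this[of 0] this[of "Suc 0"] show "\<phi> differentiable (at x)" "continuous_on UNIV \<phi>"
    by (auto dest: C_k_Suc_D(1))
qed

lemma test_function_mult:
  assumes "\<phi> \<in> test_functions \<Omega>" "\<psi> \<in> test_functions \<Omega>"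
  shows "(\<lambda>x. \<phi> x * \<psi> x) \<in> test_functions \<Omega>"
  using assms by (auto elim!: test_functionsE intro!: test_functionsI C_k_mult)

lemma test_function_scale:
  assumes "\<phi> \<in> test_functions \<Omega>"
  shows "(\<lambda>x. c * \<phi> x) \<in> test_functions \<Omega>"
  using assms by (auto elim!: test_functionsE intro!: test_functionsI C_k_mult C_k_const)

lemma test_function_add:
  assumes "\<phi> \<in> test_functions \<Omega>" "\<psi> \<in> test_functions \<Omega>"
  shows "(\<lambda>x. \<phi> x + \<psi> x) \<in> test_functions \<Omega>"
  using assms
proof (elim test_functionsE)
  fix K L assume "\<And>k. C_k k \<phi>" "compact K" "K \<subseteq> \<Omega>" "\<And>x. x \<notin> K \<Longrightarrow> \<phi> x = 0"
    "\<And>k. C_k k \<psi>" "compact L" "L \<subseteq> \<Omega>" "\<And>x. x \<notin> L \<Longrightarrow> \<psi> x = 0"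
  then show ?thesis by (intro test_functionsI[of _ "K \<union> L"] C_k_add) auto
qed

lemma test_function_pderiv3:
  assumes "\<phi> \<in> test_functions \<Omega>"
  shows "pderiv3 i \<phi> \<in> test_functions \<Omega>"
  using assms
proof (elim test_functionsE)
  fix K assume K: "\<And>k. C_k k \<phi>" "compact K" "K \<subseteq> \<Omega>" "\<And>x. x \<notin> K \<Longrightarrow> \<phi> x = 0"
  have "pderiv3 i \<phi> x = 0" if "x \<notin> K" for x
  proof -
    have "(\<phi> has_derivative (\<lambda>_. 0)) (at x)"
      by (rule has_derivative_transform_within_open[of "\<lambda>_. 0" _ _ _ "- K"])
         (use K that in \<open>auto intro!: derivative_eq_intros intro: compact_imp_closed\<close>)
    then show ?thesis by (simp add: pderiv3_eq)
  qed
  then show ?thesis using K C_k_Suc_D(2)[of _ \<phi> i] by (intro test_functionsI[of _ K]) auto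
qed

lemma test_function_bounded:
  assumes "\<phi> \<in> test_functions \<Omega>"
  obtains M where "\<And>x. \<bar>\<phi> x\<bar> \<le> M"
  using assms
proof (elim test_functionsE)
  fix K assume K: "\<And>k. C_k k \<phi>" "compact K" "K \<subseteq> \<Omega>" "\<And>x. x \<notin> K \<Longrightarrow> \<phi> x = 0"
  have "continuous_on K \<phi>" using K(1)[of 0] by (auto intro: continuous_on_subset)
  then have "bounded (\<phi> ` K)" using K(2) compact_continuous_image compact_imp_bounded by blast
  then obtain M where "\<And>x. x \<in> K \<Longrightarrow> \<bar>\<phi> x\<bar> \<le> M" by (auto simp: bounded_iff)
  then have "\<bar>\<phi> x\<bar> \<le> max M 0" for x using K(4)[of x] by (cases "x \<in> K") force+
  then show thesis by (rule that)
qed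

definition box_bump :: "real^3 \<Rightarrow> real^3 \<Rightarrow> sfield" where
  "box_bump a b x = (\<Prod>i\<in>UNIV. exp_flat 0 (x $ i - a $ i) * exp_flat 0 (b $ i - x $ i))"

lemma C_k_prod:
  assumes "finite I" "\<And>i. i \<in> I \<Longrightarrow> C_k k (f i)"
  shows "C_k k (\<lambda>x. \<Prod>i\<in>I. f i x)"
  using assms by (induction I rule: finite_induct) (auto intro: C_k_const C_k_mult)

lemma C_k_box_bump: "C_k k (box_bump a b)"
proof -
  have "C_k k (\<lambda>x. \<Prod>i\<in>UNIV. exp_flat 0 (1 * x $ i + (- a $ i)) * exp_flat 0 ((-1) * x $ i + b $ i))"
    by (intro C_k_prod C_k_mult C_k_exp_flat) auto
  moreover have "box_bump a b = (\<lambda>x. \<Prod>i\<in>UNIV. exp_flat 0 (1 * x $ i + (- a $ i)) * exp_flat 0 ((-1) * x $ i + b $ i))"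
    by (rule ext) (simp add: box_bump_def)
  ultimately show ?thesis by simp
qed

lemma box_bump_range: "0 \<le> box_bump a b x" "box_bump a b x \<le> 1"
proof -
  have e: "0 \<le> exp_flat 0 t" "exp_flat 0 t \<le> 1" for t by (auto simp: exp_flat_def)
  then show "0 \<le> box_bump a b x" unfolding box_bump_def by (intro prod_nonneg) auto
  show "box_bump a b x \<le> 1" unfolding box_bump_def using e by (intro prod_le_1) (auto intro: mult_le_one)
qed

lemma box_bump_pos_iff: "box_bump a b x > 0 \<longleftrightarrow> x \<in> box a b"
proof -
  have p: "exp_flat 0 t > 0 \<longleftrightarrow> t > 0" "exp_flat 0 t = 0 \<longleftrightarrow> t \<le> 0" for t
    by (auto simp: exp_flat_def)
  have "box_bump a b x \<noteq> 0 \<longleftrightarrow> (\<forall>i. x $ i - a $ i > 0 \<and> b $ i - x $ i > 0)"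
    unfolding box_bump_def by (auto simp: p not_le)
  then show ?thesis using box_bump_range(1)[of a b x] by (auto simp: mem_box_cart)
qed

text \<open>Indicator functions of boxes inside \<open>\<Omega>\<close> are bounded pointwise limits of test functions.  The bump
  \<open>\<psi>\<close> has values in \<open>[0, 1]\<close>, so the powers \<open>(1 - \<psi>)\<^sup>n\<close> tend to \<open>0\<close> exactly where \<open>\<psi>\<close> is positive, and
  \<open>1 - (1 - \<psi>)\<^sup>n\<close> is a polynomial in \<open>\<psi>\<close> without constant term, hence smooth with the same support.\<close>

lemma box_indicator_limit:
  assumes "cbox a b \<subseteq> \<Omega>"
  shows "(\<lambda>x. 1 - (1 - box_bump a b x) ^ n) \<in> test_functions \<Omega>"
    and "\<bar>1 - (1 - box_bump a b x) ^ n\<bar> \<le> 1"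
    and "(\<lambda>n. 1 - (1 - box_bump a b x) ^ n) \<longlonglongrightarrow> indicator (box a b) x"
proof -
  have z: "box_bump a b x = 0" if "x \<notin> box a b" for x
    using box_bump_pos_iff[of a b x] box_bump_range(1)[of a b x] that by auto
  show "(\<lambda>x. 1 - (1 - box_bump a b x) ^ n) \<in> test_functions \<Omega>"
  proof (intro test_functionsI[of _ "cbox a b"] C_k_diff C_k_power C_k_const C_k_box_bump)
    fix x assume "x \<notin> cbox a b"
    then have "box_bump a b x = 0" using z box_subset_cbox[of a b] by blast
    then show "1 - (1 - box_bump a b x) ^ n = 0" by simp
  qed (use assms in auto)
  have "0 \<le> (1 - box_bump a b x) ^ n" "(1 - box_bump a b x) ^ n \<le> 1"
    using box_bump_range[of a b x] by (auto intro: power_le_one)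
  then show "\<bar>1 - (1 - box_bump a b x) ^ n\<bar> \<le> 1" by simp
  show "(\<lambda>n. 1 - (1 - box_bump a b x) ^ n) \<longlonglongrightarrow> indicator (box a b) x"
  proof (cases "x \<in> box a b")
    case True
    then have "0 \<le> 1 - box_bump a b x" "1 - box_bump a b x < 1"
      using box_bump_range[of a b x] box_bump_pos_iff[of a b x] by auto
    then have "(\<lambda>n. (1 - box_bump a b x) ^ n) \<longlonglongrightarrow> 0" by (intro LIMSEQ_realpow_zero)
    from tendsto_diff[OF tendsto_const this, of 1] show ?thesis using True by simp
  qed (simp add: z)
qed

section \<open>Uniqueness of weak derivatives\<close>

text \<open>The Borel sets over which \<open>f\<close> integrates to zero form a Dynkin system, and the boxes generating the
  Borel sets are stable under intersection.  A Lebesgue set differs from a Borel set by a null set.\<close>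

lemma box_integrals_zero_imp_AE_zero:
  fixes f :: "'a::euclidean_space \<Rightarrow> real"
  assumes f: "integrable lebesgue f"
    and box: "\<And>a b. (\<integral>x. indicator (box a b) x * f x \<partial>lebesgue) = 0"
    and UN: "(\<integral>x. f x \<partial>lebesgue) = 0"
  shows "AE x in lebesgue. f x = 0"
proof (rule density_unique_real[OF f])
  have borel: "(\<integral>x. indicator A x * f x \<partial>lebesgue) = 0" if "A \<in> sets borel" for A
  proof -
    let ?G = "range (\<lambda>(a, b). box a b :: 'a set)"
    have G: "A \<in> sigma_sets UNIV ?G" using that by (simp add: borel_eq_box)
    have st: "Int_stable ?G" by (auto simp: Int_stable_def box_Int_box)
    have meas: "B \<in> sets lebesgue" if "B \<in> sigma_sets UNIV ?G" for B
    proof -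
      have "B \<in> sets borel" using that by (simp add: borel_eq_box)
      then show ?thesis by simp
    qed
    have int: "set_integrable lebesgue B f" if "B \<in> sigma_sets UNIV ?G" for B
      unfolding set_integrable_def using integrable_mult_indicator[OF meas[OF that] f] .
    have "?G \<subseteq> Pow UNIV" by simp
    with st show ?thesis using G
    proof (induction rule: sigma_sets_induct_disjoint)
      case (basic B)
      then show ?case using box by auto
    next
      case (compl B)
      have "(\<integral>x. indicator (UNIV - B) x * f x \<partial>lebesgue) =
          (\<integral>x. f x - indicator B x * f x \<partial>lebesgue)"
        by (intro Bochner_Integration.integral_cong) (auto simp: indicator_def)
      also have "\<dots> = 0"
        using f int[OF compl(1)] compl(2) UN
        by (subst Bochner_Integration.integral_diff) (auto simp: set_integrable_def)
      finally show ?case .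
    next
      case (union B)
      have UB: "(\<Union>i. B i) \<in> sigma_sets UNIV ?G" using union(2) by (intro sigma_sets.Union) auto
      have "(LINT x:(\<Union>i. B i)|lebesgue. f x) = (\<Sum>i. (LINT x:(B i)|lebesgue. f x))"
      proof (intro lebesgue_integral_countable_add int[OF UB])
        show "B i \<in> sets lebesgue" for i using union(2) meas by blast
      qed (use union(1) in \<open>auto simp: disjoint_family_on_def\<close>)
      then show ?case using union(3) by (simp add: set_lebesgue_integral_def)
    qed simp_all
  qed
  show "integrable lebesgue (\<lambda>_. 0)" by simp
  fix A :: "'a set" assume "A \<in> sets lebesgue"
  then obtain S N N' where A: "A = S \<union> N" "N \<subseteq> N'" "N' \<in> null_sets lborel" "S \<in> sets lborel"
    by (rule sets_completionE)
  have "AE x in lebesgue. x \<notin> N'" using A(3) by (intro AE_completion AE_not_in)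
  then have "AE x in lebesgue. indicator A x * f x = indicator S x * f x"
    by eventually_elim (use A in \<open>auto simp: indicator_def\<close>)
  moreover have "(\<lambda>x. indicator A x * f x) \<in> borel_measurable lebesgue"
      "(\<lambda>x. indicator S x * f x) \<in> borel_measurable lebesgue"
    using f \<open>A \<in> sets lebesgue\<close> A(4) by (auto intro!: borel_measurable_times borel_measurable_indicator)
  ultimately have "(\<integral>x. indicator A x * f x \<partial>lebesgue) = (\<integral>x. indicator S x * f x \<partial>lebesgue)"
    by (intro integral_cong_AE)
  then show "set_lebesgue_integral lebesgue A f = set_lebesgue_integral lebesgue A (\<lambda>_. 0)"
    using borel[of S] A(4) by (simp add: set_lebesgue_integral_def)
qed

locale bounded_open_domain =
  fixes \<Omega> :: "(real^3) set"
  assumes open_domain: "open \<Omega>" and bounded_domain: "bounded \<Omega>"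
begin

lemma domain_lmeasurable: "\<Omega> \<in> lmeasurable"
  using lmeasurable_open[OF bounded_domain open_domain] .

lemma domain_sets [simp, measurable]: "\<Omega> \<in> sets lebesgue"
  using domain_lmeasurable by (rule fmeasurableD)

lemma L2_bounded:
  fixes f :: "real^3 \<Rightarrow> 'b::euclidean_space"
  assumes "f \<in> borel_measurable (lebesgue_on \<Omega>)" "\<And>x. norm (f x) \<le> M"
  shows "f \<in> L2 \<Omega>"
proof (rule L2_I[OF assms(1)])
  interpret finite_measure "lebesgue_on \<Omega>" by (rule finite_measure_lebesgue_on[OF domain_lmeasurable])
  show "integrable (lebesgue_on \<Omega>) (\<lambda>x. M\<^sup>2)" by simp
  show "AE x in lebesgue_on \<Omega>. (norm (f x))\<^sup>2 \<le> M\<^sup>2"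
    using assms(2) by (simp add: power_mono)
qed

lemma L2_integrable:
  fixes f :: sfield
  assumes "f \<in> L2 \<Omega>"
  shows "integrable (lebesgue_on \<Omega>) f"
  using L2_integrable_inner[OF assms L2_bounded[of "\<lambda>_. 1" 1]] by simp

lemma continuous_borel_measurable_lebesgue_on:
  fixes f :: "real^3 \<Rightarrow> 'b::euclidean_space"
  assumes "continuous_on UNIV f"
  shows "f \<in> borel_measurable (lebesgue_on \<Omega>)"
  using assms by (intro continuous_imp_measurable_on_sets_lebesgue) (auto intro: continuous_on_subset)

lemma test_function_L2:
  assumes "\<phi> \<in> test_functions \<Omega>"
  shows "\<phi> \<in> L2 \<Omega>"
proof -
  obtain M where "\<And>x. \<bar>\<phi> x\<bar> \<le> M" using test_function_bounded[OF assms] by blast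
  then show ?thesis
    by (intro L2_bounded continuous_borel_measurable_lebesgue_on test_function_differentiable(2)[OF assms]) auto
qed

lemma test_function_cgrad_L2:
  assumes "\<phi> \<in> test_functions \<Omega>"
  shows "cgrad \<phi> \<in> L2 \<Omega>"
  by (rule L2_vec_lambda) (simp add: cgrad_def test_function_L2 test_function_pderiv3 assms)

text \<open>By dominated convergence a function orthogonal to all test functions has zero integral over every box
  whose closure lies in \<open>\<Omega>\<close>.  The intersection of such a box with an arbitrary box is again of this
  kind, so the function vanishes almost everywhere in it, and countably many closed boxes exhaust \<open>\<Omega>\<close>.\<close>

lemma fundamental_lemma:
  assumes g: "g \<in> L2 \<Omega>" and zero: "\<And>\<phi>. \<phi> \<in> test_functions \<Omega> \<Longrightarrow> L2_inner \<Omega> g \<phi> = 0"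
  shows "ae_eq \<Omega> g (\<lambda>_. 0)"
proof -
  define G where "G x = indicator \<Omega> x * g x" for x
  have G: "integrable lebesgue G"
    using L2_integrable[OF g] unfolding G_def by (simp add: integrable_restrict_space)
  have inner: "L2_inner \<Omega> g \<phi> = (\<integral>x. G x * \<phi> x \<partial>lebesgue)" for \<phi>
    by (simp add: L2_inner_def G_def integral_restrict_space mult.assoc)
  have box_zero: "(\<integral>x. indicator (box a b) x * G x \<partial>lebesgue) = 0" if "cbox a b \<subseteq> \<Omega>" for a b
  proof -
    let ?\<phi> = "\<lambda>n x. 1 - (1 - box_bump a b x) ^ n"
    have "(\<lambda>n. \<integral>x. G x * ?\<phi> n x \<partial>lebesgue) \<longlonglongrightarrow> (\<integral>x. G x * indicator (box a b) x \<partial>lebesgue)"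
    proof (rule integral_dominated_convergence[where w="\<lambda>x. \<bar>G x\<bar>"])
      show "(\<lambda>x. G x * indicator (box a b) x) \<in> borel_measurable lebesgue"
        using G by (intro borel_measurable_times borel_measurable_indicator) auto
      have "continuous_on UNIV (?\<phi> n)" for n
        using C_k_diff[OF C_k_const C_k_power[OF C_k_diff[OF C_k_const C_k_box_bump]], of 0 1 1 a b n]
        by simp
      then have "?\<phi> n \<in> borel_measurable lebesgue" for n
        by (intro measurable_completion) (auto dest: borel_measurable_continuous_onI)
      then show "(\<lambda>x. G x * ?\<phi> n x) \<in> borel_measurable lebesgue" for n
        using G by (intro borel_measurable_times) auto
      show "AE x in lebesgue. (\<lambda>n. G x * ?\<phi> n x) \<longlonglongrightarrow> G x * indicator (box a b) x"
        by (intro AE_I2 tendsto_mult tendsto_const box_indicator_limit(3)[OF that])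
      show "AE x in lebesgue. norm (G x * ?\<phi> n x) \<le> \<bar>G x\<bar>" for n
        using box_indicator_limit(2)[OF that] by (intro AE_I2) (auto simp: abs_mult intro!: mult_left_le)
    qed (use G in auto)
    moreover have "(\<integral>x. G x * ?\<phi> n x \<partial>lebesgue) = 0" for n
      using zero[OF box_indicator_limit(1)[OF that]] inner by simp
    ultimately show ?thesis by (simp add: LIMSEQ_const_iff mult.commute)
  qed
  have cb: "AE x in lebesgue. x \<in> cbox a b \<longrightarrow> G x = 0" if ab: "cbox a b \<subseteq> \<Omega>" for a b
  proof -
    have "AE x in lebesgue. indicator (box a b) x * G x = 0"
    proof (rule box_integrals_zero_imp_AE_zero)
      show "integrable lebesgue (\<lambda>x. indicator (box a b) x * G x)"
        using integrable_mult_indicator[OF _ G, of "box a b"] by simp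
      show "(\<integral>x. indicator (box a b) x * G x \<partial>lebesgue) = 0" by (rule box_zero[OF ab])
      fix c d :: "real^3"
      obtain p q where pq: "box c d \<inter> box a b = box p q" using box_Int_box by blast
      have "(\<integral>x. indicator (box p q) x * G x \<partial>lebesgue) = 0"
      proof (cases "box p q = {}")
        case False
        then have "cbox p q = closure (box p q)" by (simp add: closure_box)
        also have "\<dots> \<subseteq> cbox a b" using pq box_subset_cbox[of a b]
          by (intro closure_minimal) auto
        finally show ?thesis using ab by (intro box_zero) auto
      qed simp
      then show "(\<integral>x. indicator (box c d) x * (indicator (box a b) x * G x) \<partial>lebesgue) = 0"
        unfolding mult.assoc[symmetric] indicator_inter_arith[symmetric] pq .
    qed
    moreover have "AE x in lebesgue. x \<notin> cbox a b - box a b"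
      using negligible_frontier_interval[of a b] by (intro AE_not_in) (simp add: negligible_iff_null_sets)
    ultimately show ?thesis by eventually_elim (auto simp: indicator_def)
  qed
  obtain D where D: "countable D" "D \<subseteq> Pow \<Omega>" "\<And>X. X \<in> D \<Longrightarrow> \<exists>a b. X = cbox a b" "\<Union>D = \<Omega>"
    using open_countable_Union_open_cbox[OF open_domain] by blast
  have "AE x in lebesgue. \<forall>X\<in>D. x \<in> X \<longrightarrow> G x = 0"
    using cb D(2,3) by (subst AE_ball_countable[OF D(1)]) (metis PowD subsetD)
  then have "AE x in lebesgue. x \<in> \<Omega> \<longrightarrow> g x = 0"
    by eventually_elim (use D(4) in \<open>auto simp: G_def indicator_def\<close>)
  then show ?thesis unfolding ae_eq_def by (subst AE_restrict_space_iff) auto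
qed

end

section \<open>Operators that are linear almost everywhere\<close>

text \<open>Linearity of operators that are given by a choice of representatives.  The set \<open>N\<close> collects the
  arguments that count as zero.\<close>

definition ae_linear ::
    "(real^3) set \<Rightarrow> 'z::real_vector set \<Rightarrow> 'z set \<Rightarrow>
     ('z \<Rightarrow> real^3 \<Rightarrow> 'b::euclidean_space) \<Rightarrow> bool" where
  "ae_linear \<Omega> Z N D \<longleftrightarrow>
     (\<forall>z\<in>Z. D z \<in> L2 \<Omega>) \<and>
     (\<forall>y\<in>Z. \<forall>z\<in>Z. ae_eq \<Omega> (D (y + z)) (\<lambda>x. D y x + D z x)) \<and>
     (\<forall>c. \<forall>z\<in>Z. ae_eq \<Omega> (D (c *\<^sub>R z)) (\<lambda>x. c *\<^sub>R D z x)) \<and>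
     (\<forall>z\<in>Z \<inter> N. ae_eq \<Omega> (D z) (\<lambda>_. 0))"

lemma ae_linearD:
  assumes "ae_linear \<Omega> Z N D" "y \<in> Z" "z \<in> Z"
  shows "D z \<in> L2 \<Omega>" "ae_eq \<Omega> (D (y + z)) (\<lambda>x. D y x + D z x)"
    "ae_eq \<Omega> (D (c *\<^sub>R z)) (\<lambda>x. c *\<^sub>R D z x)" "z \<in> N \<Longrightarrow> ae_eq \<Omega> (D z) (\<lambda>_. 0)"
  using assms by (auto simp: ae_linear_def)

definition ae_zero :: "(real^3) set \<Rightarrow> (real^3 \<Rightarrow> 'b::zero) set" where
  "ae_zero \<Omega> = {f. ae_eq \<Omega> f (\<lambda>_. 0)}"

lemma zero_in_ae_zero [simp]: "(0 :: real^3 \<Rightarrow> 'b::zero) \<in> ae_zero \<Omega>"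
  by (simp add: ae_zero_def ae_eq_def)

lemma ae_linear_id:
  assumes "Z \<subseteq> L2 \<Omega>"
  shows "ae_linear \<Omega> Z (ae_zero \<Omega>) (\<lambda>z. z)"
  using assms by (auto simp: ae_linear_def ae_zero_def plus_fun_def scaleR_fun_def)

lemma ae_linear_comp:
  assumes D: "ae_linear \<Omega> Y M D" and h: "linear h" "\<And>z. z \<in> Z \<Longrightarrow> h z \<in> Y" "\<And>z. z \<in> N \<Longrightarrow> h z \<in> M"
  shows "ae_linear \<Omega> Z N (\<lambda>z. D (h z))"
  using assms by (simp add: ae_linear_def linear_add linear_scale)

text \<open>Applied to cross products with \<open>B\<^sup>-\<close> and to the tensor product with \<open>u\<^sup>-\<close>, which enter the form
  as coefficients.\<close>

lemma ae_linear_pointwise: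
  assumes D: "ae_linear \<Omega> Z N D"
    and L: "\<And>x. linear (L x)" and in_L2: "\<And>z. z \<in> Z \<Longrightarrow> (\<lambda>x. L x (D z x)) \<in> L2 \<Omega>"
  shows "ae_linear \<Omega> Z N (\<lambda>z x. L x (D z x))"
  unfolding ae_linear_def
proof (intro conjI ballI allI)
  fix y z c assume "y \<in> Z" "z \<in> Z"
  note * = ae_linearD[OF D this]
  show "ae_eq \<Omega> (\<lambda>x. L x (D (y + z) x)) (\<lambda>x. L x (D y x) + L x (D z x))"
    using *(2) unfolding ae_eq_def by eventually_elim (simp add: linear_add[OF L])
  show "ae_eq \<Omega> (\<lambda>x. L x (D (c *\<^sub>R z) x)) (\<lambda>x. c *\<^sub>R L x (D z x))"
    using *(3)[of c] unfolding ae_eq_def by eventually_elim (simp add: linear_scale[OF L])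
next
  fix z assume z: "z \<in> Z \<inter> N"
  then show "ae_eq \<Omega> (\<lambda>x. L x (D z x)) (\<lambda>_. 0)"
    using ae_linearD(4)[OF D, of z z] unfolding ae_eq_def
    by (auto elim!: eventually_mono simp: linear_0[OF L])
qed (use in_L2 in auto)

lemma ae_linear_vec_lambda:
  fixes D :: "'z::real_vector \<Rightarrow> real^3 \<Rightarrow> 'b::euclidean_space^'n"
  assumes D: "\<And>i. ae_linear \<Omega> Z N (\<lambda>z x. D z x $ i)"
  shows "ae_linear \<Omega> Z N D"
  unfolding ae_linear_def
proof (intro conjI ballI allI)
  fix y z c assume yz: "y \<in> Z" "z \<in> Z"
  note * = ae_linearD[OF D this]
  show "D z \<in> L2 \<Omega>" using *(1) by (rule L2_vec_lambda)
  have "AE x in lebesgue_on \<Omega>. \<forall>i. D (y + z) x $ i = D y x $ i + D z x $ i"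
    using *(2) by (intro AE_all_countable[THEN iffD2] allI) (simp add: ae_eq_def)
  then show "ae_eq \<Omega> (D (y + z)) (\<lambda>x. D y x + D z x)"
    by (simp add: ae_eq_def vec_eq_iff)
  have "AE x in lebesgue_on \<Omega>. \<forall>i. D (c *\<^sub>R z) x $ i = c *\<^sub>R D z x $ i"
    using *(3) by (intro AE_all_countable[THEN iffD2] allI) (simp add: ae_eq_def)
  then show "ae_eq \<Omega> (D (c *\<^sub>R z)) (\<lambda>x. c *\<^sub>R D z x)"
    by (simp add: ae_eq_def vec_eq_iff)
next
  fix z assume "z \<in> Z \<inter> N"
  then have "AE x in lebesgue_on \<Omega>. \<forall>i. D z x $ i = 0"
    using ae_linearD(4)[OF D, of z z] by (intro AE_all_countable[THEN iffD2] allI) (simp add: ae_eq_def)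
  then show "ae_eq \<Omega> (D z) (\<lambda>_. 0)" by (simp add: ae_eq_def vec_eq_iff)
qed

lemma ae_linear_bilinear_on:
  assumes D: "ae_linear \<Omega> Z N D" and E: "ae_linear \<Omega> Z N' E" and Z: "subspace Z"
  shows "bilinear_on Z N (\<lambda>y z. L2_inner \<Omega> (D y) (E z))"
  unfolding bilinear_on_def
proof (intro conjI ballI allI)
  fix x y z c assume xyz: "x \<in> Z" "y \<in> Z" "z \<in> Z"
  have Zs: "x + y \<in> Z" "c *\<^sub>R x \<in> Z" "c *\<^sub>R y \<in> Z" using xyz Z by (auto intro: subspace_add subspace_scale)
  note in_D = ae_linearD(1)[OF D] and in_E = ae_linearD(1)[OF E]
  have "L2_inner \<Omega> (D (x + y)) (E z) = L2_inner \<Omega> (\<lambda>t. D x t + D y t) (E z)"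
    using xyz Zs in_D in_E by (intro L2_inner_cong ae_linearD(2)[OF D] L2_add) auto
  also have "\<dots> = L2_inner \<Omega> (D x) (E z) + L2_inner \<Omega> (D y) (E z)"
    using xyz in_D in_E by (intro L2_inner_add) auto
  finally show "L2_inner \<Omega> (D (x + y)) (E z) = L2_inner \<Omega> (D x) (E z) + L2_inner \<Omega> (D y) (E z)" .
  have "L2_inner \<Omega> (E (x + y)) (D z) = L2_inner \<Omega> (\<lambda>t. E x t + E y t) (D z)"
    using xyz Zs in_D in_E by (intro L2_inner_cong ae_linearD(2)[OF E] L2_add) auto
  also have "\<dots> = L2_inner \<Omega> (E x) (D z) + L2_inner \<Omega> (E y) (D z)"
    using xyz in_D in_E by (intro L2_inner_add) auto
  finally show "L2_inner \<Omega> (D z) (E (x + y)) = L2_inner \<Omega> (D z) (E x) + L2_inner \<Omega> (D z) (E y)"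
    by (simp add: L2_inner_commute[of \<Omega> "D z"])
  have "L2_inner \<Omega> (D (c *\<^sub>R x)) (E y) = L2_inner \<Omega> (\<lambda>t. c *\<^sub>R D x t) (E y)"
    using xyz Zs in_D in_E by (intro L2_inner_cong ae_linearD(3)[OF D] L2_scale) auto
  then show "L2_inner \<Omega> (D (c *\<^sub>R x)) (E y) = c * L2_inner \<Omega> (D x) (E y)"
    by (simp add: L2_inner_scale)
  have "L2_inner \<Omega> (E (c *\<^sub>R y)) (D x) = L2_inner \<Omega> (\<lambda>t. c *\<^sub>R E y t) (D x)"
    using xyz Zs in_D in_E by (intro L2_inner_cong ae_linearD(3)[OF E] L2_scale) auto
  then show "L2_inner \<Omega> (D x) (E (c *\<^sub>R y)) = c * L2_inner \<Omega> (D x) (E y)"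
    by (simp add: L2_inner_scale L2_inner_commute[of \<Omega> "D x"])
next
  fix x y assume "x \<in> Z \<inter> N" "y \<in> Z"
  then show "L2_inner \<Omega> (D x) (E y) = 0"
    using ae_linearD(4)[OF D] by (intro L2_inner_zero_left) auto
qed

lemma ae_linear_norm:
  assumes D: "ae_linear \<Omega> Z N D" and Z: "subspace Z" and "y \<in> Z" "z \<in> Z"
  shows "L2_norm \<Omega> (D (y + z)) \<le> L2_norm \<Omega> (D y) + L2_norm \<Omega> (D z)"
    and "L2_norm \<Omega> (D (c *\<^sub>R z)) = \<bar>c\<bar> * L2_norm \<Omega> (D z)"
proof -
  note * = ae_linearD[OF D \<open>y \<in> Z\<close> \<open>z \<in> Z\<close>] and in_D = ae_linearD(1)[OF D]
  have Zs: "y + z \<in> Z" "c *\<^sub>R z \<in> Z" using assms by (auto intro: subspace_add subspace_scale)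
  have "L2_norm \<Omega> (D (y + z)) = L2_norm \<Omega> (\<lambda>x. D y x + D z x)"
    using * in_D assms Zs by (intro L2_norm_cong L2_add) auto
  also have "\<dots> \<le> L2_norm \<Omega> (D y) + L2_norm \<Omega> (D z)" using in_D assms by (intro L2_norm_triangle) auto
  finally show "L2_norm \<Omega> (D (y + z)) \<le> L2_norm \<Omega> (D y) + L2_norm \<Omega> (D z)" .
  have "L2_norm \<Omega> (D (c *\<^sub>R z)) = L2_norm \<Omega> (\<lambda>x. c *\<^sub>R D z x)"
    using *(3)[of c] in_D assms Zs by (intro L2_norm_cong L2_scale) auto
  then show "L2_norm \<Omega> (D (c *\<^sub>R z)) = \<bar>c\<bar> * L2_norm \<Omega> (D z)" by (simp add: L2_norm_scale)
qed

lemma ae_linear_inner_scale: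
  assumes D: "ae_linear \<Omega> Z' N D" and Z': "subspace Z'" and z: "z \<in> Z'" and f: "f \<in> L2 \<Omega>"
  shows "L2_inner \<Omega> f (D (c *\<^sub>R z)) = c * L2_inner \<Omega> f (D z)"
proof -
  have "L2_inner \<Omega> (D (c *\<^sub>R z)) f = L2_inner \<Omega> (\<lambda>x. c *\<^sub>R D z x) f"
    using z f ae_linearD(1)[OF D z] ae_linearD(1)[OF D _ subspace_scale[OF Z' z]]
    by (intro L2_inner_cong ae_linearD(3)[OF D z z] L2_scale) auto
  then show ?thesis by (simp add: L2_inner_scale L2_inner_commute[of \<Omega> f])
qed

text \<open>The common shape of the weak gradient, divergence and curl and of the discrete weak curl: the value
  \<open>g\<close> at \<open>u\<close> is sought in \<open>G\<close>, and tested against \<open>\<beta> t\<close> it reproduces \<open>u\<close> tested against \<open>\<alpha> t\<close>.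
  For the weak gradient, for instance, \<open>t\<close> is a direction with a test function, \<open>\<alpha> t\<close> is its partial
  derivative, and \<open>\<beta> t\<close> is minus the test function along that direction.\<close>

definition weakly_represents ::
    "(real^3) set \<Rightarrow> (real^3 \<Rightarrow> 'b::euclidean_space) set \<Rightarrow> 't set \<Rightarrow>
     ('t \<Rightarrow> real^3 \<Rightarrow> 'a::euclidean_space) \<Rightarrow> ('t \<Rightarrow> real^3 \<Rightarrow> 'b) \<Rightarrow>
     (real^3 \<Rightarrow> 'a) \<Rightarrow> (real^3 \<Rightarrow> 'b) \<Rightarrow> bool" where
  "weakly_represents \<Omega> G T \<alpha> \<beta> u g \<longleftrightarrow>
     g \<in> G \<and> (\<forall>t\<in>T. L2_inner \<Omega> u (\<alpha> t) = L2_inner \<Omega> g (\<beta> t))"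

text \<open>If the test vectors \<open>\<beta> t\<close> separate the points of \<open>G\<close>, then \<open>D u\<close> is unique up to a null set; the sum
  of representatives represents the sum, which forces linearity.\<close>

lemma ae_linear_weak_operator:
  assumes G: "G \<subseteq> L2 \<Omega>" "\<And>g h. g \<in> G \<Longrightarrow> h \<in> G \<Longrightarrow> (\<lambda>x. g x + h x) \<in> G"
      "\<And>c g. g \<in> G \<Longrightarrow> (\<lambda>x. c *\<^sub>R g x) \<in> G"
    and T: "\<And>t. t \<in> T \<Longrightarrow> \<alpha> t \<in> L2 \<Omega>" "\<And>t. t \<in> T \<Longrightarrow> \<beta> t \<in> L2 \<Omega>"
    and total: "\<And>g. g \<in> G \<Longrightarrow> (\<And>t. t \<in> T \<Longrightarrow> L2_inner \<Omega> g (\<beta> t) = 0) \<Longrightarrow> ae_eq \<Omega> g (\<lambda>_. 0)"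
    and Z: "subspace Z" "Z \<subseteq> L2 \<Omega>"
    and D: "\<And>u. u \<in> Z \<Longrightarrow> weakly_represents \<Omega> G T \<alpha> \<beta> u (D u)"
  shows "ae_linear \<Omega> Z (ae_zero \<Omega>) D"
proof -
  have DG: "D u \<in> G" "D u \<in> L2 \<Omega>" if "u \<in> Z" for u
    using D[OF that] G(1) by (auto simp: weakly_represents_def)
  have Dt: "L2_inner \<Omega> (D u) (\<beta> t) = L2_inner \<Omega> u (\<alpha> t)" if "u \<in> Z" "t \<in> T" for u t
    using D[OF that(1)] that(2) by (auto simp: weakly_represents_def)
  have unique: "ae_eq \<Omega> g h" if "g \<in> G" "h \<in> G" "\<And>t. t \<in> T \<Longrightarrow> L2_inner \<Omega> g (\<beta> t) = L2_inner \<Omega> h (\<beta> t)" for g h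
  proof -
    have "(\<lambda>x. g x + (-1) *\<^sub>R h x) \<in> G" using that G by blast
    then have m: "(\<lambda>x. g x - h x) \<in> G" by simp
    have "L2_inner \<Omega> (\<lambda>x. g x - h x) (\<beta> t) = 0" if "t \<in> T" for t
      using that \<open>g \<in> G\<close> \<open>h \<in> G\<close> G(1) T(2)[OF that] \<open>\<And>t. t \<in> T \<Longrightarrow> L2_inner \<Omega> g (\<beta> t) = L2_inner \<Omega> h (\<beta> t)\<close>
      by (subst L2_inner_diff) auto
    from total[OF m this] show ?thesis by (simp add: ae_eq_def)
  qed
  show ?thesis
    unfolding ae_linear_def
  proof (intro conjI ballI allI)
    fix y z c assume yz: "y \<in> Z" "z \<in> Z"
    then have Zs: "y + z \<in> Z" "c *\<^sub>R z \<in> Z" using Z(1) by (auto intro: subspace_add subspace_scale)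
    have yzL: "y \<in> L2 \<Omega>" "z \<in> L2 \<Omega>" using yz Z(2) by auto
    show "D z \<in> L2 \<Omega>" using DG yz by blast
    show "ae_eq \<Omega> (D (y + z)) (\<lambda>x. D y x + D z x)"
    proof (rule unique)
      fix t assume t: "t \<in> T"
      have "L2_inner \<Omega> (D (y + z)) (\<beta> t) = L2_inner \<Omega> y (\<alpha> t) + L2_inner \<Omega> z (\<alpha> t)"
        using Dt[OF Zs(1) t] L2_inner_add[OF yzL T(1)[OF t]] by (simp add: plus_fun_def)
      also have "\<dots> = L2_inner \<Omega> (\<lambda>x. D y x + D z x) (\<beta> t)"
        using Dt[OF _ t] L2_inner_add[OF DG(2) DG(2) T(2)[OF t]] yz by simp
      finally show "L2_inner \<Omega> (D (y + z)) (\<beta> t) = L2_inner \<Omega> (\<lambda>x. D y x + D z x) (\<beta> t)" .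
    qed (use DG Zs yz G in auto)
    show "ae_eq \<Omega> (D (c *\<^sub>R z)) (\<lambda>x. c *\<^sub>R D z x)"
    proof (rule unique)
      fix t assume t: "t \<in> T"
      show "L2_inner \<Omega> (D (c *\<^sub>R z)) (\<beta> t) = L2_inner \<Omega> (\<lambda>x. c *\<^sub>R D z x) (\<beta> t)"
        using Dt[OF Zs(2) t] Dt[OF yz(2) t] by (simp add: scaleR_fun_def L2_inner_scale)
    qed (use DG Zs yz G in auto)
  next
    fix z assume z: "z \<in> Z \<inter> ae_zero \<Omega>"
    show "ae_eq \<Omega> (D z) (\<lambda>_. 0)"
      using z DG Dt L2_inner_zero_left[of \<Omega> z] by (intro total) (auto simp: ae_zero_def)
  qed
qed

section \<open>Linearity of the weak differential operators\<close>

context bounded_open_domain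
begin

lemma ccurl_L2:
  assumes "\<Phi> \<in> test_fields \<Omega>"
  shows "ccurl \<Phi> \<in> L2 \<Omega>"
proof (rule L2_vec_lambda)
  have t: "pderiv3 j (\<lambda>y. \<Phi> y $ i) \<in> L2 \<Omega>" for i j
    using assms by (auto simp: test_fields_def intro: test_function_L2 test_function_pderiv3)
  fix i :: 3
  show "(\<lambda>x. ccurl \<Phi> x $ i) \<in> L2 \<Omega>"
    using exhaust_3[of i] t by (auto simp: ccurl_def vector_3 intro!: L2_diff)
qed

lemma test_function_axis_L2:
  assumes "\<phi> \<in> test_functions \<Omega>"
  shows "(\<lambda>x. axis i (\<phi> x) :: real^3) \<in> L2 \<Omega>"
proof (rule L2_vec_lambda)
  show "(\<lambda>x. (axis i (\<phi> x) :: real^3) $ j) \<in> L2 \<Omega>" for j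
    using test_function_L2[OF assms] L2_zero by (cases "i = j") (auto simp: axis_def)
qed

lemma ae_linear_wgrad:
  assumes Z: "subspace Z" "Z \<subseteq> H1 \<Omega>"
  shows "ae_linear \<Omega> Z (ae_zero \<Omega>) (wgrad \<Omega>)"
proof (rule ae_linear_weak_operator)
  let ?T = "UNIV \<times> test_functions \<Omega>"
  let ?\<alpha> = "\<lambda>(i, \<phi>). pderiv3 i \<phi>" and ?\<beta> = "\<lambda>(i, \<phi>). (\<lambda>x. axis i (- \<phi> x) :: real^3)"
  have inner: "L2_inner \<Omega> g (?\<beta> (i, \<phi>)) = - L2_inner \<Omega> (\<lambda>x. g x $ i) \<phi>" for i \<phi> g
    by (simp add: L2_inner_def inner_axis)
  fix u assume "u \<in> Z"
  then have "\<exists>g. has_wgrad \<Omega> u g" using Z by (auto simp: H1_def)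
  then have "has_wgrad \<Omega> u (wgrad \<Omega> u)" unfolding wgrad_def by (rule someI_ex)
  then show "weakly_represents \<Omega> (L2 \<Omega>) ?T ?\<alpha> ?\<beta> u (wgrad \<Omega> u)"
    using inner by (auto simp: has_wgrad_def weakly_represents_def)
next
  let ?\<beta> = "\<lambda>(i, \<phi>). (\<lambda>x. axis i (- \<phi> x) :: real^3)"
  fix g :: vfield assume g: "g \<in> L2 \<Omega>"
    and zero: "\<And>t. t \<in> UNIV \<times> test_functions \<Omega> \<Longrightarrow> L2_inner \<Omega> g (?\<beta> t) = 0"
  have "ae_eq \<Omega> (\<lambda>x. g x $ i) (\<lambda>_. 0)" for i
  proof (rule fundamental_lemma[OF L2_vec_nth[OF g]])
    fix \<phi> assume "\<phi> \<in> test_functions \<Omega>"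
    then show "L2_inner \<Omega> (\<lambda>x. g x $ i) \<phi> = 0"
      using zero[of "(i, \<phi>)"] by (simp add: L2_inner_def inner_axis)
  qed
  then have "AE x in lebesgue_on \<Omega>. \<forall>i. g x $ i = 0"
    by (intro AE_all_countable[THEN iffD2] allI) (simp add: ae_eq_def)
  then show "ae_eq \<Omega> g (\<lambda>_. 0)" by (simp add: ae_eq_def vec_eq_iff)
next
  fix t :: "3 \<times> sfield" assume t: "t \<in> UNIV \<times> test_functions \<Omega>"
  then show "(case t of (i, \<phi>) \<Rightarrow> pderiv3 i \<phi>) \<in> L2 \<Omega>"
    by (auto intro: test_function_L2 test_function_pderiv3)
  show "(case t of (i, \<phi>) \<Rightarrow> (\<lambda>x. axis i (- \<phi> x) :: real^3)) \<in> L2 \<Omega>"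
    using t test_function_axis_L2[OF test_function_scale[of _ \<Omega> "-1"]] by auto
qed (use Z in \<open>auto intro: L2_add L2_scale simp: H1_def\<close>)

lemma ae_linear_wdiv:
  assumes Z: "subspace Z" "Z \<subseteq> H_div \<Omega>"
  shows "ae_linear \<Omega> Z (ae_zero \<Omega>) (wdiv \<Omega>)"
proof (rule ae_linear_weak_operator)
  fix u assume "u \<in> Z"
  then have "\<exists>g. has_wdiv \<Omega> u g" using Z by (auto simp: H_div_def)
  then have "has_wdiv \<Omega> u (wdiv \<Omega> u)" unfolding wdiv_def by (rule someI_ex)
  then show "weakly_represents \<Omega> (L2 \<Omega>) (test_functions \<Omega>) cgrad (\<lambda>\<phi> x. - \<phi> x) u (wdiv \<Omega> u)"
    by (auto simp: has_wdiv_def weakly_represents_def L2_inner_def)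
next
  fix g assume "g \<in> L2 \<Omega>" "\<And>t. t \<in> test_functions \<Omega> \<Longrightarrow> L2_inner \<Omega> g (\<lambda>x. - t x) = 0"
  then show "ae_eq \<Omega> g (\<lambda>_. 0)" by (intro fundamental_lemma) (auto simp: L2_inner_def)
next
  fix t assume "t \<in> test_functions \<Omega>"
  then show "(\<lambda>x. - t x) \<in> L2 \<Omega>" using L2_scale[OF test_function_L2, of t "-1"] by simp
qed (use Z in \<open>auto intro: L2_add L2_scale_real simp: H_div_def test_function_cgrad_L2\<close>)

lemma test_field_axis:
  assumes "\<phi> \<in> test_functions \<Omega>"
  shows "(\<lambda>x. axis i (\<phi> x)) \<in> test_fields \<Omega>"
proof -
  have "(\<lambda>x. (axis i (\<phi> x) :: real^3) $ j) \<in> test_functions \<Omega>" for j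
    using assms test_function_scale[OF assms, of 0] by (cases "i = j") (auto simp: axis_def)
  then show ?thesis by (simp add: test_fields_def)
qed

lemma ae_linear_wcurl:
  assumes Z: "subspace Z" "Z \<subseteq> H_curl \<Omega>"
  shows "ae_linear \<Omega> Z (ae_zero \<Omega>) (wcurl \<Omega>)"
proof (rule ae_linear_weak_operator)
  fix u assume "u \<in> Z"
  then have "\<exists>g. has_wcurl \<Omega> u g" using Z by (auto simp: H_curl_def)
  then have "has_wcurl \<Omega> u (wcurl \<Omega> u)" unfolding wcurl_def by (rule someI_ex)
  then show "weakly_represents \<Omega> (L2 \<Omega>) (test_fields \<Omega>) ccurl (\<lambda>\<Phi>. \<Phi>) u (wcurl \<Omega> u)"
    by (auto simp: has_wcurl_def weakly_represents_def)
next
  fix g :: vfield assume g: "g \<in> L2 \<Omega>" and zero: "\<And>t. t \<in> test_fields \<Omega> \<Longrightarrow> L2_inner \<Omega> g t = 0"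
  have "ae_eq \<Omega> (\<lambda>x. g x $ i) (\<lambda>_. 0)" for i
  proof (rule fundamental_lemma[OF L2_vec_nth[OF g]])
    fix \<phi> assume "\<phi> \<in> test_functions \<Omega>"
    then show "L2_inner \<Omega> (\<lambda>x. g x $ i) \<phi> = 0"
      using zero[OF test_field_axis, of \<phi> i] by (simp add: L2_inner_def inner_axis)
  qed
  then have "AE x in lebesgue_on \<Omega>. \<forall>i. g x $ i = 0"
    by (intro AE_all_countable[THEN iffD2] allI) (simp add: ae_eq_def)
  then show "ae_eq \<Omega> g (\<lambda>_. 0)" by (simp add: ae_eq_def vec_eq_iff)
next
  fix t assume "t \<in> test_fields \<Omega>"
  then show "t \<in> L2 \<Omega>" using test_function_L2 by (intro L2_vec_lambda) (auto simp: test_fields_def)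
qed (use Z in \<open>auto intro: L2_add L2_scale simp: H_curl_def ccurl_L2\<close>)

lemma component_linear: "linear (\<lambda>u::vfield. \<lambda>x. u x $ i)"
  by (rule linearI) (auto simp: plus_fun_def scaleR_fun_def)

lemma ae_linear_wjac:
  assumes Z: "subspace Z" "Z \<subseteq> H1_vec \<Omega>"
  shows "ae_linear \<Omega> Z (ae_zero \<Omega>) (wjac \<Omega>)"
proof (rule ae_linear_vec_lambda)
  fix i :: 3
  let ?c = "\<lambda>u::vfield. \<lambda>x. u x $ i"
  have sub: "subspace (?c ` Z)" "?c ` Z \<subseteq> H1 \<Omega>"
    using Z linear_subspace_image[OF component_linear] by (auto simp: H1_vec_def)
  have "ae_linear \<Omega> Z (ae_zero \<Omega>) (\<lambda>z. wgrad \<Omega> (?c z))"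
    by (rule ae_linear_comp[OF ae_linear_wgrad[OF sub] component_linear])
       (auto simp: ae_zero_def ae_eq_def elim: eventually_mono)
  then show "ae_linear \<Omega> Z (ae_zero \<Omega>) (\<lambda>z x. wjac \<Omega> z x $ i)" by (simp add: wjac_def)
qed

lemma H1_vec_wgrad:
  assumes "u \<in> H1_vec \<Omega>"
  shows "(\<lambda>x. u x $ i) \<in> L2 \<Omega>" "has_wgrad \<Omega> (\<lambda>x. u x $ i) (\<lambda>x. wjac \<Omega> u x $ i)"
proof -
  have u: "(\<lambda>x. u x $ i) \<in> H1 \<Omega>" using assms by (simp add: H1_vec_def)
  then show "(\<lambda>x. u x $ i) \<in> L2 \<Omega>" by (simp add: H1_def)
  have "\<exists>g. has_wgrad \<Omega> (\<lambda>x. u x $ i) g" using u by (simp add: H1_def)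
  then have "has_wgrad \<Omega> (\<lambda>x. u x $ i) (wgrad \<Omega> (\<lambda>x. u x $ i))" unfolding wgrad_def by (rule someI_ex)
  then show "has_wgrad \<Omega> (\<lambda>x. u x $ i) (\<lambda>x. wjac \<Omega> u x $ i)" by (simp add: wjac_def)
qed

lemma H1_vec_L2: "u \<in> H1_vec \<Omega> \<Longrightarrow> u \<in> L2 \<Omega>"
  using H1_vec_wgrad(1) by (rule L2_vec_lambda)

lemma wjac_L2: "u \<in> H1_vec \<Omega> \<Longrightarrow> wjac \<Omega> u \<in> L2 \<Omega>"
  using H1_vec_wgrad(2) by (intro L2_vec_lambda) (auto simp: has_wgrad_def intro: L2_vec_nth)

text \<open>Sum the defining identities of the component gradients over the coordinate directions.  This
  makes the divergence of the velocity space meaningful.\<close>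

lemma H1_vec_has_wdiv:
  assumes u: "u \<in> H1_vec \<Omega>"
  shows "has_wdiv \<Omega> u (\<lambda>x. \<Sum>i\<in>UNIV. wjac \<Omega> u x $ i $ i)"
  unfolding has_wdiv_def
proof (intro conjI ballI)
  have J: "(\<lambda>x. wjac \<Omega> u x $ i $ i) \<in> L2 \<Omega>" for i
    using wjac_L2[OF u] by (intro L2_vec_nth)
  show "(\<lambda>x. \<Sum>i\<in>UNIV. wjac \<Omega> u x $ i $ i) \<in> L2 \<Omega>"
    using J by (simp add: sum_3 L2_add)
  fix \<phi> assume \<phi>: "\<phi> \<in> test_functions \<Omega>"
  note t = test_function_L2[OF \<phi>] test_function_L2[OF test_function_pderiv3[OF \<phi>]]
  have "L2_inner \<Omega> u (cgrad \<phi>) = (\<Sum>i\<in>UNIV. L2_inner \<Omega> (\<lambda>x. u x $ i) (pderiv3 i \<phi>))"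
    unfolding L2_inner_def inner_vec_def
    by (subst Bochner_Integration.integral_sum)
       (auto simp: cgrad_def intro!: L2_integrable_inner[of _ \<Omega> "pderiv3 _ \<phi>", simplified] H1_vec_wgrad(1)[OF u] t)
  also have "\<dots> = (\<Sum>i\<in>UNIV. - L2_inner \<Omega> (\<lambda>x. wjac \<Omega> u x $ i $ i) \<phi>)"
    using H1_vec_wgrad(2)[OF u] \<phi> by (intro sum.cong) (auto simp: has_wgrad_def)
  also have "\<dots> = - L2_inner \<Omega> (\<lambda>x. \<Sum>i\<in>UNIV. wjac \<Omega> u x $ i $ i) \<phi>"
    using J t(1) by (simp add: sum_3 L2_inner_add L2_add)
  finally show "L2_inner \<Omega> u (cgrad \<phi>) = - L2_inner \<Omega> (\<lambda>x. \<Sum>i\<in>UNIV. wjac \<Omega> u x $ i $ i) \<phi>" .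
qed

lemma H1_vec_subset_H_div: "H1_vec \<Omega> \<subseteq> H_div \<Omega>"
  using H1_vec_has_wdiv H1_vec_L2 by (auto simp: H_div_def)

lemma wdiv_has_wdiv: "u \<in> H_div \<Omega> \<Longrightarrow> has_wdiv \<Omega> u (wdiv \<Omega> u)"
  unfolding wdiv_def by (rule someI_ex[of "has_wdiv \<Omega> u"]) (simp add: H_div_def)

end

section \<open>Sobolev inequalities\<close>

definition point3 :: "real \<Rightarrow> real \<Rightarrow> real \<Rightarrow> real^3" where
  "point3 x y z = x *\<^sub>R axis 1 1 + y *\<^sub>R axis 2 1 + z *\<^sub>R axis 3 1"

lemma point3_nth [simp]: "point3 x y z $ 1 = x" "point3 x y z $ 2 = y" "point3 x y z $ 3 = z"
  by (simp_all add: point3_def axis_def)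

lemma point3_measurable [measurable]:
  assumes [measurable]: "f \<in> borel_measurable M" "g \<in> borel_measurable M" "h \<in> borel_measurable M"
  shows "(\<lambda>w. point3 (f w) (g w) (h w)) \<in> borel_measurable M"
  unfolding point3_def by measurable

text \<open>The coordinates are grouped as a plane and a line, \<open>(\<real> \<times> \<real>) \<times> \<real>\<close>, because the argument below slices
  space into horizontal planes.\<close>

lemma lborel_eq_distr_point3:
  "(lborel :: (real^3) measure) =
     distr lborel borel (\<lambda>w :: (real \<times> real) \<times> real. point3 (fst (fst w)) (snd (fst w)) (snd w))"
    (is "_ = distr _ _ ?h")
proof (rule lborel_eqI)
  have h [measurable]: "?h \<in> borel_measurable borel"
    unfolding point3_def
    by (intro borel_measurable_continuous_onI continuous_intros)
  fix l u :: "real^3" assume lu: "\<And>b. b \<in> Basis \<Longrightarrow> l \<bullet> b \<le> u \<bullet> b"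
  have lui: "l $ i \<le> u $ i" for i
    using lu[of "axis i 1"] by (simp add: axis_in_Basis_iff inner_axis)
  have vim: "?h -` box l u = ({l $ 1<..<u $ 1} \<times> {l $ 2<..<u $ 2}) \<times> {l $ 3<..<u $ 3}"
    by (auto simp: mem_box_cart forall_3)
  have "emeasure (distr lborel borel ?h) (box l u) = emeasure lborel (?h -` box l u)"
    by (subst emeasure_distr) auto
  also have "\<dots> = ennreal (u $ 1 - l $ 1) * ennreal (u $ 2 - l $ 2) * ennreal (u $ 3 - l $ 3)"
    unfolding vim lborel_prod[symmetric] using lui
    by (simp add: lborel.emeasure_pair_measure_Times)
  also have "\<dots> = ennreal ((u $ 1 - l $ 1) * (u $ 2 - l $ 2) * (u $ 3 - l $ 3))"
    using lui by (simp add: ennreal_mult')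
  also have "(u $ 1 - l $ 1) * (u $ 2 - l $ 2) * (u $ 3 - l $ 3) = (\<Prod>i\<in>UNIV. u $ i - l $ i)"
    unfolding UNIV_3 by (simp add: mult.assoc)
  also have "\<dots> = (\<Prod>b\<in>Basis. (u - l) \<bullet> b)"
    by (simp add: Basis_vec_def inner_axis axis_eq_axis UNION_singleton_eq_range prod.reindex inj_on_def)
  finally show "emeasure (distr lborel borel ?h) (box l u) = (\<Prod>b\<in>Basis. (u - l) \<bullet> b)" .
qed simp

lemma nn_integral_point3:
  fixes F :: "real^3 \<Rightarrow> ennreal"
  assumes [measurable]: "F \<in> borel_measurable borel"
  shows "(\<integral>\<^sup>+v. F v \<partial>lborel) =
      (\<integral>\<^sup>+z. (\<integral>\<^sup>+p. F (point3 (fst p) (snd p) z) \<partial>(lborel :: (real \<times> real) measure)) \<partial>lborel)"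
    and "(\<integral>\<^sup>+v. F v \<partial>lborel) =
      (\<integral>\<^sup>+p. (\<integral>\<^sup>+z. F (point3 (fst p) (snd p) z) \<partial>lborel) \<partial>(lborel :: (real \<times> real) measure))"
proof -
  let ?h = "\<lambda>w :: (real \<times> real) \<times> real. point3 (fst (fst w)) (snd (fst w)) (snd w)"
  have h: "?h \<in> borel_measurable (borel :: ((real \<times> real) \<times> real) measure)"
    unfolding point3_def by (intro borel_measurable_continuous_onI continuous_intros)
  then have h' [measurable]: "?h \<in> borel_measurable (lborel \<Otimes>\<^sub>M lborel)"
    by (simp add: lborel_prod)
  have eq: "(\<integral>\<^sup>+v. F v \<partial>lborel) = (\<integral>\<^sup>+w. F (?h w) \<partial>(lborel \<Otimes>\<^sub>M lborel))"
    unfolding lborel_prod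
    by (subst lborel_eq_distr_point3, subst nn_integral_distr) (use h in auto)
  have m: "(\<lambda>w. F (?h w)) \<in> borel_measurable (lborel \<Otimes>\<^sub>M lborel)" by measurable
  show "(\<integral>\<^sup>+v. F v \<partial>lborel) =
      (\<integral>\<^sup>+z. (\<integral>\<^sup>+p. F (point3 (fst p) (snd p) z) \<partial>(lborel :: (real \<times> real) measure)) \<partial>lborel)"
    unfolding eq lborel_pair.nn_integral_snd[OF m, symmetric] by simp
  show "(\<integral>\<^sup>+v. F v \<partial>lborel) =
      (\<integral>\<^sup>+p. (\<integral>\<^sup>+z. F (point3 (fst p) (snd p) z) \<partial>lborel) \<partial>(lborel :: (real \<times> real) measure))"
    unfolding eq lborel.nn_integral_fst[OF m, symmetric] by simp
qed

lemma nn_integral_plane: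
  fixes F :: "real \<Rightarrow> real \<Rightarrow> ennreal"
  assumes "case_prod F \<in> borel_measurable borel"
  shows "(\<integral>\<^sup>+p. F (fst p) (snd p) \<partial>lborel) = (\<integral>\<^sup>+x. \<integral>\<^sup>+y. F x y \<partial>lborel \<partial>lborel)"
    and "(\<integral>\<^sup>+p. F (fst p) (snd p) \<partial>lborel) = (\<integral>\<^sup>+y. \<integral>\<^sup>+x. F x y \<partial>lborel \<partial>lborel)"
proof -
  have m: "case_prod F \<in> borel_measurable (lborel \<Otimes>\<^sub>M lborel)" using assms by (simp add: lborel_prod)
  show "(\<integral>\<^sup>+p. F (fst p) (snd p) \<partial>lborel) = (\<integral>\<^sup>+x. \<integral>\<^sup>+y. F x y \<partial>lborel \<partial>lborel)"
    using lborel.nn_integral_fst[OF m] by (simp add: lborel_prod case_prod_beta')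
  show "(\<integral>\<^sup>+p. F (fst p) (snd p) \<partial>lborel) = (\<integral>\<^sup>+y. \<integral>\<^sup>+x. F x y \<partial>lborel \<partial>lborel)"
    using lborel_pair.nn_integral_snd[OF m] by (simp add: lborel_prod case_prod_beta')
qed

lemma bounded_support_le_nn_integral_deriv:
  fixes f f' :: "real \<Rightarrow> real"
  assumes deriv: "\<And>s. (f has_real_derivative f' s) (at s)" and cont: "continuous_on UNIV f'"
    and supp: "\<And>s. R < \<bar>s\<bar> \<Longrightarrow> f s = 0"
  shows "ennreal \<bar>f t\<bar> \<le> (\<integral>\<^sup>+s. ennreal \<bar>f' s\<bar> \<partial>lborel)"
proof -
  \<comment> \<open>A starting point to the left of t and outside the support.\<close>
  let ?a = "- (\<bar>R\<bar> + \<bar>t\<bar> + 1)"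
  have isc: "isCont f' s" for s using cont by (simp add: continuous_on_eq_continuous_at)
  have has: "has_bochner_integral lborel (\<lambda>s. f' s * indicator {?a..t} s) (f t - f ?a)"
    by (intro has_bochner_integral_FTC_Icc_real deriv isc) auto
  have "f ?a = 0" by (rule supp) linarith
  then have "f t = (\<integral>s. f' s * indicator {?a..t} s \<partial>lborel)"
    using has_bochner_integral_integral_eq[OF has] by simp
  then have "ennreal \<bar>f t\<bar> \<le> (\<integral>\<^sup>+s. norm (f' s * indicator {?a..t} s) \<partial>lborel)"
    using integral_norm_bound_ennreal[OF integrable.intros[OF has]] by simp
  also have "\<dots> \<le> (\<integral>\<^sup>+s. ennreal \<bar>f' s\<bar> \<partial>lborel)"
    by (intro nn_integral_mono) (auto simp: indicator_def)
  finally show ?thesis .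
qed

lemma point3_line:
  "point3 x y z = point3 0 y z + x *\<^sub>R axis 1 1"
  "point3 x y z = point3 x 0 z + y *\<^sub>R axis 2 1"
  "point3 x y z = point3 x y 0 + z *\<^sub>R axis 3 1"
  by (simp_all add: point3_def)

lemma norm_cgrad_ge: "\<bar>pderiv3 i \<phi> x\<bar> \<le> norm (cgrad \<phi> x)"
  using component_le_norm_cart[of "cgrad \<phi> x" i] by (simp add: cgrad_def)

text \<open>The factor \<open>2\<close> comes from differentiating a square: the integrand on the left is
  \<open>\<bar>\<partial>(f\<^sup>2)\<bar>\<close> when \<open>h\<close> is a partial derivative of \<open>f\<close>, and \<open>g\<close> is then the norm of the gradient.\<close>

lemma Cauchy_Schwarz_twice:
  assumes [measurable]: "f \<in> borel_measurable M" "g \<in> borel_measurable M"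
    and h: "\<And>x. \<bar>h x\<bar> \<le> g x"
  shows "(\<integral>\<^sup>+x. ennreal (2 * \<bar>f x * h x\<bar>) \<partial>M)\<^sup>2 \<le>
     4 * (\<integral>\<^sup>+x. ennreal ((f x)\<^sup>2) \<partial>M) * (\<integral>\<^sup>+x. ennreal ((g x)\<^sup>2) \<partial>M)"
proof -
  have g: "0 \<le> g x" for x using h[of x] by simp
  have "2 * \<bar>f x * h x\<bar> \<le> 2 * (\<bar>f x\<bar> * g x)" for x
    using mult_left_mono[OF h[of x], of "\<bar>f x\<bar>"] by (simp add: abs_mult)
  then have "(\<integral>\<^sup>+x. ennreal (2 * \<bar>f x * h x\<bar>) \<partial>M) \<le> (\<integral>\<^sup>+x. ennreal (2 * (\<bar>f x\<bar> * g x)) \<partial>M)"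
    by (intro nn_integral_mono ennreal_leI)
  also have "\<dots> = (\<integral>\<^sup>+x. 2 * (ennreal \<bar>f x\<bar> * ennreal (g x)) \<partial>M)"
    using g by (simp add: ennreal_mult)
  also have "\<dots> = 2 * (\<integral>\<^sup>+x. ennreal \<bar>f x\<bar> * ennreal (g x) \<partial>M)"
    by (rule nn_integral_cmult) measurable
  finally have "(\<integral>\<^sup>+x. ennreal (2 * \<bar>f x * h x\<bar>) \<partial>M)\<^sup>2 \<le>
      (2 * (\<integral>\<^sup>+x. ennreal \<bar>f x\<bar> * ennreal (g x) \<partial>M))\<^sup>2"
    by (intro power_mono) auto
  also have "\<dots> = 4 * (\<integral>\<^sup>+x. ennreal \<bar>f x\<bar> * ennreal (g x) \<partial>M)\<^sup>2"
    by (simp add: power_mult_distrib)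
  also have "\<dots> \<le> 4 * ((\<integral>\<^sup>+x. (ennreal \<bar>f x\<bar>)\<^sup>2 \<partial>M) * (\<integral>\<^sup>+x. (ennreal (g x))\<^sup>2 \<partial>M))"
    by (intro mult_left_mono Cauchy_Schwarz_nn_integral) auto
  also have "\<dots> = 4 * (\<integral>\<^sup>+x. ennreal ((f x)\<^sup>2) \<partial>M) * (\<integral>\<^sup>+x. ennreal ((g x)\<^sup>2) \<partial>M)"
    using g by (simp add: ennreal_power mult.assoc)
  finally show ?thesis .
qed

context bounded_open_domain
begin

lemma test_function_bounded_support:
  obtains R where "R > 0" "\<And>\<phi> x. \<phi> \<in> test_functions \<Omega> \<Longrightarrow> norm x \<ge> R \<Longrightarrow> \<phi> x = 0"
proof -
  obtain R where R: "R > 0" "\<And>x. x \<in> \<Omega> \<Longrightarrow> norm x < R"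
    using bounded_domain bounded_pos_less by blast
  have "\<phi> x = 0" if "\<phi> \<in> test_functions \<Omega>" "norm x \<ge> R" for \<phi> x
    using that R(2)[of x] by (elim test_functionsE) (meson not_le subsetD)
  with R(1) show thesis by (rule that)
qed

text \<open>The fundamental theorem of calculus along a coordinate line, applied to \<open>\<phi>\<^sup>2\<close>, which vanishes far
  away.\<close>

lemma test_function_square_le_line_integral:
  assumes \<phi>: "\<phi> \<in> test_functions \<Omega>"
  shows "ennreal ((\<phi> (p + t *\<^sub>R axis i 1))\<^sup>2) \<le>
     (\<integral>\<^sup>+s. ennreal (2 * \<bar>\<phi> (p + s *\<^sub>R axis i 1) * pderiv3 i \<phi> (p + s *\<^sub>R axis i 1)\<bar>) \<partial>lborel)"
proof -
  let ?l = "\<lambda>s. p + s *\<^sub>R axis i 1"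
  let ?f' = "\<lambda>s. 2 * (\<phi> (?l s) * pderiv3 i \<phi> (?l s))"
  obtain R where R: "\<And>\<phi> x. \<phi> \<in> test_functions \<Omega> \<Longrightarrow> norm x \<ge> R \<Longrightarrow> \<phi> x = 0"
    using test_function_bounded_support by blast
  have d: "((\<lambda>s. \<phi> (?l s)) has_real_derivative pderiv3 i \<phi> (?l s)) (at s)" for s
  proof -
    obtain D where D: "(\<phi> has_derivative D) (at (?l s))"
      using test_function_differentiable(1)[OF \<phi>] by (auto simp: differentiable_def)
    have "(?l has_derivative (\<lambda>h. h *\<^sub>R axis i 1)) (at s)" by (auto intro!: derivative_eq_intros)
    from has_derivative_compose[OF this D]
    have "((\<lambda>s. \<phi> (?l s)) has_derivative (\<lambda>h. h * D (axis i 1))) (at s)"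
      using linear_scale[OF has_derivative_linear[OF D]] by simp
    then show ?thesis using pderiv3_eq[OF D]
      by (simp add: has_field_derivative_def mult_commute_abs)
  qed
  have "ennreal \<bar>(\<phi> (?l t))\<^sup>2\<bar> \<le> (\<integral>\<^sup>+s. ennreal \<bar>?f' s\<bar> \<partial>lborel)"
  proof (rule bounded_support_le_nn_integral_deriv[where f="\<lambda>s. (\<phi> (?l s))\<^sup>2" and t=t])
    show "((\<lambda>s. (\<phi> (?l s))\<^sup>2) has_real_derivative ?f' s) (at s)" for s
      by (auto intro!: derivative_eq_intros d)
    show "continuous_on UNIV ?f'"
      by (intro continuous_intros continuous_on_compose2[OF test_function_differentiable(2)[OF \<phi>]]
          continuous_on_compose2[OF test_function_differentiable(2)[OF test_function_pderiv3[OF \<phi>]]]) auto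
    fix s assume s: "R + norm p < \<bar>s\<bar>"
    have "norm (s *\<^sub>R axis i 1 :: real^3) \<le> norm (?l s) + norm p"
      using norm_triangle_ineq4[of "?l s" p] by simp
    then have "norm (?l s) \<ge> R" using s by simp
    then show "(\<phi> (?l s))\<^sup>2 = 0" using R[OF \<phi>] by simp
  qed
  then show ?thesis by (simp add: abs_mult)
qed

lemma test_function_borel [measurable]:
  assumes "\<phi> \<in> test_functions \<Omega>"
  shows "\<phi> \<in> borel_measurable borel" "pderiv3 i \<phi> \<in> borel_measurable borel"
    "(\<lambda>x. norm (cgrad \<phi> x)) \<in> borel_measurable borel"
proof -
  show a: "\<phi> \<in> borel_measurable borel" "pderiv3 i \<phi> \<in> borel_measurable borel" for i
    using assms test_function_pderiv3 by (auto intro!: borel_measurable_continuous_onI test_function_differentiable)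
  have "cgrad \<phi> \<in> borel_measurable borel"
    by (rule borel_measurable_vec_lambda) (simp add: cgrad_def a)
  then show "(\<lambda>x. norm (cgrad \<phi> x)) \<in> borel_measurable borel" by simp
qed

text \<open>Ladyzhenskaya's inequality in squared form.  On a horizontal plane bound one factor of
  \<open>\<phi>\<^sup>4 = \<phi>\<^sup>2 \<phi>\<^sup>2\<close> by the integral of \<open>2 \<bar>\<phi> \<partial>\<^sub>1\<phi>\<bar>\<close> over the first coordinate line and the
  other by the integral of \<open>2 \<bar>\<phi> \<partial>\<^sub>2\<phi>\<bar>\<close> over the second.  The bounds depend on complementary variables, so the integral of their product over the plane factorises, and
  Cauchy-Schwarz gives at most \<open>4 m d\<close>, where \<open>m\<close> and \<open>d\<close> are the integrals of \<open>\<phi>\<^sup>2\<close> and \<open>\<bar>\<nabla>\<phi>\<bar>\<^sup>2\<close> over the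
  plane.  The same line bound in the third direction controls \<open>m\<close> uniformly in the height by the
  integral of \<open>2 \<bar>\<phi> \<partial>\<^sub>3\<phi>\<bar>\<close>, and integrating \<open>d\<close> over the heights gives \<open>\<parallel>\<nabla>\<phi>\<parallel>\<^sup>2\<close>.\<close>

lemma test_function_L4:
  assumes \<phi>: "\<phi> \<in> test_functions \<Omega>"
  shows "(\<integral>\<^sup>+x. ennreal ((\<phi> x)^4) \<partial>lborel)\<^sup>2 \<le>
     64 * (\<integral>\<^sup>+x. ennreal ((\<phi> x)\<^sup>2) \<partial>lborel) * (\<integral>\<^sup>+x. ennreal ((norm (cgrad \<phi> x))\<^sup>2) \<partial>lborel) ^ 3"
proof -
  note [measurable] = test_function_borel[OF \<phi>]
  define P where "P i v = ennreal (2 * \<bar>\<phi> v * pderiv3 i \<phi> v\<bar>)" for i v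
  have [measurable]: "P i \<in> borel_measurable borel" for i unfolding P_def by measurable
  define q where "q v = ennreal ((\<phi> v)\<^sup>2)" for v
  define d where "d v = ennreal ((norm (cgrad \<phi> v))\<^sup>2)" for v
  have [measurable]: "q \<in> borel_measurable borel" "d \<in> borel_measurable borel"
    unfolding q_def d_def by measurable
  let ?I = "\<lambda>F :: real^3 \<Rightarrow> ennreal. \<integral>\<^sup>+v. F v \<partial>lborel"
  let ?J = "\<lambda>(F :: real^3 \<Rightarrow> ennreal) z. \<integral>\<^sup>+p. F (point3 (fst p) (snd p) z) \<partial>(lborel :: (real \<times> real) measure)"
  have line: "q (point3 x y z) \<le> (\<integral>\<^sup>+t. P 1 (point3 t y z) \<partial>lborel)"
    "q (point3 x y z) \<le> (\<integral>\<^sup>+t. P 2 (point3 x t z) \<partial>lborel)"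
    "q (point3 x y z) \<le> (\<integral>\<^sup>+t. P 3 (point3 x y t) \<partial>lborel)" for x y z
    using test_function_square_le_line_integral[OF \<phi>, of "point3 0 y z" x 1]
      test_function_square_le_line_integral[OF \<phi>, of "point3 x 0 z" y 2]
      test_function_square_le_line_integral[OF \<phi>, of "point3 x y 0" z 3]
    unfolding q_def P_def point3_line[symmetric] by simp_all
  have plane: "?J (\<lambda>v. q v * q v) z \<le> 4 * ?J q z * ?J d z" for z
  proof -
    let ?A = "\<lambda>x. \<integral>\<^sup>+t. P 2 (point3 x t z) \<partial>lborel" and ?B = "\<lambda>y. \<integral>\<^sup>+t. P 1 (point3 t y z) \<partial>lborel"
    have mA [measurable]: "?A \<in> borel_measurable borel" and mB [measurable]: "?B \<in> borel_measurable borel"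
      by measurable
    have "?J (\<lambda>v. q v * q v) z \<le> (\<integral>\<^sup>+p. ?A (fst p) * ?B (snd p) \<partial>lborel)"
      by (intro nn_integral_mono mult_mono line) auto
    also have "\<dots> = (\<integral>\<^sup>+x. \<integral>\<^sup>+y. ?A x * ?B y \<partial>lborel \<partial>lborel)"
      by (rule nn_integral_plane(1)) (simp add: borel_prod[symmetric])
    also have "\<dots> = (\<integral>\<^sup>+x. ?A x * (\<integral>\<^sup>+y. ?B y \<partial>lborel) \<partial>lborel)"
      by (intro nn_integral_cong nn_integral_cmult) simp
    also have "\<dots> = (\<integral>\<^sup>+x. ?A x \<partial>lborel) * (\<integral>\<^sup>+y. ?B y \<partial>lborel)"
      by (rule nn_integral_multc) simp
    also have "(\<integral>\<^sup>+x. ?A x \<partial>lborel) = ?J (P 2) z"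
      by (rule nn_integral_plane(1)[symmetric]) (simp add: borel_prod[symmetric])
    also have "(\<integral>\<^sup>+y. ?B y \<partial>lborel) = ?J (P 1) z"
      by (rule nn_integral_plane(2)[symmetric]) (simp add: borel_prod[symmetric])
    \<comment> \<open>Square roots are avoided: both factors have squares below the same bound.\<close>
    also have "?J (P 2) z * ?J (P 1) z \<le> (max (?J (P 2) z) (?J (P 1) z))\<^sup>2"
      unfolding power2_eq_square by (intro mult_mono) auto
    also have "\<dots> \<le> 4 * ?J q z * ?J d z"
    proof -
      have "(?J (P i) z)\<^sup>2 \<le> 4 * ?J q z * ?J d z" for i
        unfolding P_def q_def d_def
        by (rule Cauchy_Schwarz_twice) (simp_all add: borel_prod[symmetric] norm_cgrad_ge)
      then show ?thesis by (simp add: max_def)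
    qed
    finally show ?thesis .
  qed
  have slice: "?J q z \<le> ?I (P 3)" for z
    unfolding nn_integral_point3(2)[of "P 3", simplified] by (intro nn_integral_mono line)
  have "?I (\<lambda>v. q v * q v) = (\<integral>\<^sup>+z. ?J (\<lambda>v. q v * q v) z \<partial>lborel)"
    by (rule nn_integral_point3(1)) simp
  also have "\<dots> \<le> (\<integral>\<^sup>+z. 4 * ?I (P 3) * ?J d z \<partial>lborel)"
    by (intro nn_integral_mono order_trans[OF plane] mult_mono mult_left_mono slice) auto
  also have "\<dots> = 4 * ?I (P 3) * (\<integral>\<^sup>+z. ?J d z \<partial>lborel)"
    by (rule nn_integral_cmult) (simp add: lborel_prod[symmetric])
  also have "(\<integral>\<^sup>+z. ?J d z \<partial>lborel) = ?I d"
    by (rule nn_integral_point3(1)[symmetric]) simp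
  finally have "(?I (\<lambda>v. q v * q v))\<^sup>2 \<le> (4 * ?I (P 3) * ?I d)\<^sup>2"
    by (intro power_mono) auto
  also have "\<dots> = 16 * (?I (P 3))\<^sup>2 * (?I d)\<^sup>2" by (simp add: power_mult_distrib)
  also have "\<dots> \<le> 16 * (4 * ?I q * ?I d) * (?I d)\<^sup>2"
    unfolding P_def q_def d_def
    by (intro mult_right_mono mult_left_mono Cauchy_Schwarz_twice) (auto intro: norm_cgrad_ge)
  also have "\<dots> = 64 * ?I q * ?I d ^ 3" by (simp add: power3_eq_cube power2_eq_square mult_ac)
  finally show ?thesis
    unfolding q_def d_def by (simp add: ennreal_mult[symmetric] power4_eq_xxxx power2_eq_square mult.assoc)
qed

text \<open>Integrate the line bound for \<open>\<phi>\<^sup>2\<close> in the third direction over the slab \<open>\<bar>z\<bar> \<le> R\<close> that contains the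
  support.  The inequality is kept unreduced, with a factor \<open>\<parallel>\<phi>\<parallel>\<^sup>2\<close> on both sides, to avoid
  cancelling in the extended reals.\<close>

lemma test_function_Poincare:
  obtains R where "R > 0" "\<And>\<phi>. \<phi> \<in> test_functions \<Omega> \<Longrightarrow>
    (\<integral>\<^sup>+x. ennreal ((\<phi> x)\<^sup>2) \<partial>lborel)\<^sup>2 \<le>
     ennreal R * (\<integral>\<^sup>+x. ennreal ((\<phi> x)\<^sup>2) \<partial>lborel) * (\<integral>\<^sup>+x. ennreal ((norm (cgrad \<phi> x))\<^sup>2) \<partial>lborel)"
proof -
  obtain R where R: "R > 0" "\<And>\<phi> x. \<phi> \<in> test_functions \<Omega> \<Longrightarrow> norm x \<ge> R \<Longrightarrow> \<phi> x = 0"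
    using test_function_bounded_support by blast
  have "(\<integral>\<^sup>+x. ennreal ((\<phi> x)\<^sup>2) \<partial>lborel)\<^sup>2 \<le>
     ennreal (16 * R\<^sup>2) * (\<integral>\<^sup>+x. ennreal ((\<phi> x)\<^sup>2) \<partial>lborel) * (\<integral>\<^sup>+x. ennreal ((norm (cgrad \<phi> x))\<^sup>2) \<partial>lborel)"
    if \<phi>: "\<phi> \<in> test_functions \<Omega>" for \<phi>
  proof -
    note [measurable] = test_function_borel[OF \<phi>]
    define P where "P v = ennreal (2 * \<bar>\<phi> v * pderiv3 3 \<phi> v\<bar>)" for v
    have [measurable]: "P \<in> borel_measurable borel" unfolding P_def by measurable
    define q where "q v = ennreal ((\<phi> v)\<^sup>2)" for v
    define d where "d v = ennreal ((norm (cgrad \<phi> v))\<^sup>2)" for v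
    have [measurable]: "q \<in> borel_measurable borel" "d \<in> borel_measurable borel"
      unfolding q_def d_def by measurable
    let ?I = "\<lambda>F :: real^3 \<Rightarrow> ennreal. \<integral>\<^sup>+v. F v \<partial>lborel"
    have line: "q (point3 x y z) \<le> (\<integral>\<^sup>+t. P (point3 x y t) \<partial>lborel)" for x y z
      using test_function_square_le_line_integral[OF \<phi>, of "point3 x y 0" z 3]
      unfolding q_def P_def point3_line(3)[symmetric] by simp
    have ind: "q (point3 x y z) \<le> (\<integral>\<^sup>+t. P (point3 x y t) \<partial>lborel) * indicator {-R..R} z" for x y z
    proof (cases "z \<in> {-R..R}")
      case False
      then have "R \<le> norm (point3 x y z)" using component_le_norm_cart[of "point3 x y z" 3] by auto
      then show ?thesis using R(2)[OF \<phi>] by (simp add: q_def)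
    qed (use line in simp)
    have "?I q = (\<integral>\<^sup>+p. (\<integral>\<^sup>+z. q (point3 (fst p) (snd p) z) \<partial>lborel) \<partial>(lborel :: (real \<times> real) measure))"
      by (rule nn_integral_point3(2)) simp
    also have "\<dots> \<le> (\<integral>\<^sup>+p. (\<integral>\<^sup>+z. (\<integral>\<^sup>+t. P (point3 (fst p) (snd p) t) \<partial>lborel) * indicator {-R..R} z \<partial>lborel)
        \<partial>(lborel :: (real \<times> real) measure))"
      by (intro nn_integral_mono ind)
    also have "\<dots> = (\<integral>\<^sup>+p. (\<integral>\<^sup>+t. P (point3 (fst p) (snd p) t) \<partial>lborel) * ennreal (2 * R)
        \<partial>(lborel :: (real \<times> real) measure))"
      using R(1) by (intro nn_integral_cong) (simp add: nn_integral_cmult_indicator)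
    also have "\<dots> = (\<integral>\<^sup>+p. (\<integral>\<^sup>+t. P (point3 (fst p) (snd p) t) \<partial>lborel) \<partial>(lborel :: (real \<times> real) measure)) * ennreal (2 * R)"
      by (rule nn_integral_multc) (simp add: borel_prod[symmetric])
    also have "(\<integral>\<^sup>+p. (\<integral>\<^sup>+t. P (point3 (fst p) (snd p) t) \<partial>lborel) \<partial>(lborel :: (real \<times> real) measure)) = ?I P"
      by (rule nn_integral_point3(2)[symmetric]) simp
    finally have "(?I q)\<^sup>2 \<le> (?I P * ennreal (2 * R))\<^sup>2" by (intro power_mono) auto
    also have "\<dots> = ennreal (4 * R\<^sup>2) * (?I P)\<^sup>2"
      using R(1) by (simp add: power_mult_distrib ennreal_power mult.commute)
    also have "\<dots> \<le> ennreal (4 * R\<^sup>2) * (4 * ?I q * ?I d)"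
      unfolding P_def q_def d_def
      by (intro mult_left_mono Cauchy_Schwarz_twice) (auto intro: norm_cgrad_ge)
    also have "\<dots> = (ennreal (4 * R\<^sup>2) * 4) * ?I q * ?I d" by (simp add: mult.assoc)
    also have "ennreal (4 * R\<^sup>2) * 4 = ennreal (16 * R\<^sup>2)"
      using ennreal_mult[of "4 * R\<^sup>2" 4] by simp
    finally show ?thesis unfolding q_def d_def .
  qed
  with R(1) show thesis by (intro that[of "16 * R\<^sup>2"]) auto
qed

lemma nn_integral_domain_eq:
  fixes f :: "real^3 \<Rightarrow> ennreal"
  assumes "\<And>x. x \<notin> \<Omega> \<Longrightarrow> f x = 0"
  shows "(\<integral>\<^sup>+x. f x \<partial>lebesgue_on \<Omega>) = (\<integral>\<^sup>+x. f x \<partial>lborel)"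
proof -
  have "(\<integral>\<^sup>+x. f x \<partial>lebesgue_on \<Omega>) = (\<integral>\<^sup>+x. f x * indicator \<Omega> x \<partial>lebesgue)"
    by (rule nn_integral_restrict_space) simp
  also have "\<dots> = (\<integral>\<^sup>+x. f x \<partial>lebesgue)"
    using assms by (intro nn_integral_cong) (auto simp: indicator_def)
  finally show ?thesis by (simp add: nn_integral_completion)
qed

lemma test_function_outside:
  assumes "\<phi> \<in> test_functions \<Omega>" "x \<notin> \<Omega>"
  shows "\<phi> x = 0" "cgrad \<phi> x = 0"
proof -
  have "\<psi> x = 0" if "\<psi> \<in> test_functions \<Omega>" for \<psi>
    using that assms(2) by (auto elim!: test_functionsE)
  then show "\<phi> x = 0" "cgrad \<phi> x = 0"
    using assms(1) test_function_pderiv3 by (auto simp: cgrad_def vec_eq_iff)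
qed

lemma nn_integral_L2_norm:
  assumes "f \<in> L2 \<Omega>"
  shows "(\<integral>\<^sup>+x. ennreal ((norm (f x))\<^sup>2) \<partial>lebesgue_on \<Omega>) = ennreal ((L2_norm \<Omega> f)\<^sup>2)"
  using nn_integral_eq_integral[OF L2_D(2)[OF assms]]
  by (simp add: L2_norm_power2 L2_inner_def dot_square_norm)

lemma test_function_L2_lborel:
  assumes "\<phi> \<in> test_functions \<Omega>"
  shows "(\<integral>\<^sup>+x. ennreal ((\<phi> x)\<^sup>2) \<partial>lborel) = ennreal ((L2_norm \<Omega> \<phi>)\<^sup>2)"
    and "(\<integral>\<^sup>+x. ennreal ((norm (cgrad \<phi> x))\<^sup>2) \<partial>lborel) = ennreal ((L2_norm \<Omega> (cgrad \<phi>))\<^sup>2)"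
  using nn_integral_L2_norm[OF test_function_L2[OF assms]]
    nn_integral_L2_norm[OF test_function_cgrad_L2[OF assms]]
    nn_integral_domain_eq[of "\<lambda>x. ennreal ((\<phi> x)\<^sup>2)"]
    nn_integral_domain_eq[of "\<lambda>x. ennreal ((norm (cgrad \<phi> x))\<^sup>2)"]
    test_function_outside[OF assms] by auto

lemma test_function_Ladyzhenskaya:
  assumes \<phi>: "\<phi> \<in> test_functions \<Omega>"
  shows "(\<integral>\<^sup>+x. ennreal ((\<phi> x)^4) \<partial>lebesgue_on \<Omega>) \<le> ennreal (8 * L2_norm \<Omega> \<phi> * L2_norm \<Omega> (cgrad \<phi>) ^ 3)"
    (is "?l \<le> ennreal ?r")
proof -
  have "?l = (\<integral>\<^sup>+x. ennreal ((\<phi> x)^4) \<partial>lborel)"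
    using test_function_outside[OF \<phi>] by (intro nn_integral_domain_eq) auto
  then have "?l\<^sup>2 \<le> 64 * ennreal ((L2_norm \<Omega> \<phi>)\<^sup>2) * ennreal ((L2_norm \<Omega> (cgrad \<phi>))\<^sup>2) ^ 3"
    using test_function_L4[OF \<phi>] test_function_L2_lborel[OF \<phi>] by simp
  also have "\<dots> = ennreal (64 * (L2_norm \<Omega> \<phi>)\<^sup>2 * ((L2_norm \<Omega> (cgrad \<phi>))\<^sup>2) ^ 3)"
    by (simp add: ennreal_mult ennreal_power)
  also have "64 * (L2_norm \<Omega> \<phi>)\<^sup>2 * ((L2_norm \<Omega> (cgrad \<phi>))\<^sup>2) ^ 3 = ?r\<^sup>2"
    by (simp add: power_mult_distrib power_mult[symmetric] mult.commute)
  finally have sq: "?l\<^sup>2 \<le> ennreal (?r\<^sup>2)" .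
  then have "?l\<^sup>2 < top" by (rule order_le_less_trans) simp
  then have "?l < top" by (simp add: power_less_top_ennreal)
  then obtain r where r: "?l = ennreal r" "0 \<le> r" by (cases ?l) auto
  then have "ennreal (r\<^sup>2) \<le> ennreal (?r\<^sup>2)" using sq by (simp add: ennreal_power)
  then have "r\<^sup>2 \<le> ?r\<^sup>2" by (simp add: ennreal_le_iff)
  then have "r \<le> ?r" by (rule power2_le_imp_le) simp
  then show ?thesis using r by (simp add: ennreal_leI)
qed

text \<open>The gradient of \<open>u\<close> is a separate argument, so that differences between test functions and their
  limits, whose gradients are partly classical and partly weak, are covered as well.\<close>

definition H1_limit :: "sfield \<Rightarrow> vfield \<Rightarrow> (nat \<Rightarrow> sfield) \<Rightarrow> bool" where
  "H1_limit u g \<phi> \<longleftrightarrow> u \<in> L2 \<Omega> \<and> g \<in> L2 \<Omega> \<and> (\<forall>n. \<phi> n \<in> test_functions \<Omega>) \<and>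
     (\<lambda>n. L2_norm \<Omega> (\<lambda>x. \<phi> n x - u x)) \<longlonglongrightarrow> 0 \<and>
     (\<lambda>n. L2_norm \<Omega> (\<lambda>x. cgrad (\<phi> n) x - g x)) \<longlonglongrightarrow> 0"

lemma H1_0_limit:
  assumes "u \<in> H1_0 \<Omega>"
  obtains \<phi> where "H1_limit u (wgrad \<Omega> u) \<phi>"
proof -
  have "\<exists>g. has_wgrad \<Omega> u g" using assms by (auto simp: H1_0_def H1_def)
  then have "has_wgrad \<Omega> u (wgrad \<Omega> u)" unfolding wgrad_def by (rule someI_ex)
  then have "wgrad \<Omega> u \<in> L2 \<Omega>" by (simp add: has_wgrad_def)
  then show thesis using assms that by (auto simp: H1_0_def H1_def H1_limit_def)
qed

lemma H1_limit_norms: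
  assumes "H1_limit u g \<phi>"
  shows "(\<lambda>n. L2_norm \<Omega> (\<phi> n)) \<longlonglongrightarrow> L2_norm \<Omega> u" "(\<lambda>n. L2_norm \<Omega> (cgrad (\<phi> n))) \<longlonglongrightarrow> L2_norm \<Omega> g"
  using assms by (auto simp: H1_limit_def intro!: L2_norm_tendsto test_function_L2 test_function_cgrad_L2)

lemma cgrad_diff:
  assumes "\<phi> \<in> test_functions \<Omega>" "\<psi> \<in> test_functions \<Omega>"
  shows "(\<lambda>x. \<phi> x - \<psi> x) \<in> test_functions \<Omega>" "cgrad (\<lambda>x. \<phi> x - \<psi> x) = (\<lambda>x. cgrad \<phi> x - cgrad \<psi> x)"
proof -
  have m: "(\<lambda>x. (-1) * \<psi> x) \<in> test_functions \<Omega>" by (rule test_function_scale[OF assms(2)])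
  show "(\<lambda>x. \<phi> x - \<psi> x) \<in> test_functions \<Omega>" using test_function_add[OF assms(1) m] by simp
  show "cgrad (\<lambda>x. \<phi> x - \<psi> x) = (\<lambda>x. cgrad \<phi> x - cgrad \<psi> x)"
  proof (rule ext)
    fix x
    obtain D E where D: "(\<phi> has_derivative D) (at x)" "(\<psi> has_derivative E) (at x)"
      using assms test_function_differentiable(1) by (fastforce simp: differentiable_def)
    then show "cgrad (\<lambda>x. \<phi> x - \<psi> x) x = cgrad \<phi> x - cgrad \<psi> x"
      by (simp add: cgrad_def vec_eq_iff pderiv3_eq[OF has_derivative_diff[OF D]] pderiv3_eq[OF D(1)] pderiv3_eq[OF D(2)])
  qed
qed

text \<open>The error of the \<open>m\<close>-th approximation is itself such a limit, so that the \<open>L\<^sup>4\<close> bound below applies to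
  it and shows that \<open>\<phi>\<^sub>m\<close> tends to \<open>u\<close> in \<open>L\<^sup>4\<close>.\<close>

lemma H1_limit_diff:
  assumes "H1_limit u g \<phi>"
  shows "H1_limit (\<lambda>x. \<phi> m x - u x) (\<lambda>x. cgrad (\<phi> m) x - g x) (\<lambda>n x. \<phi> m x - \<phi> n x)"
proof -
  have t: "\<phi> n \<in> test_functions \<Omega>" for n using assms by (simp add: H1_limit_def)
  have "L2_norm \<Omega> (\<lambda>x. \<phi> m x - \<phi> n x - (\<phi> m x - u x)) = L2_norm \<Omega> (\<lambda>x. \<phi> n x - u x)" for n
    using L2_norm_scale[of \<Omega> "-1" "\<lambda>x. \<phi> n x - u x"] by simp
  moreover have "L2_norm \<Omega> (\<lambda>x. cgrad (\<lambda>x. \<phi> m x - \<phi> n x) x - (cgrad (\<phi> m) x - g x)) =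
      L2_norm \<Omega> (\<lambda>x. cgrad (\<phi> n) x - g x)" for n
    using L2_norm_scale[of \<Omega> "-1" "\<lambda>x. cgrad (\<phi> n) x - g x"] by (simp add: cgrad_diff(2)[OF t t])
  ultimately show ?thesis
    using assms test_function_L2[OF t] test_function_cgrad_L2[OF t] cgrad_diff(1)[OF t t]
    by (simp add: H1_limit_def L2_diff)
qed

lemma H1_limit_Poincare:
  obtains C where "C > 0" "\<And>u g \<phi>. H1_limit u g \<phi> \<Longrightarrow> L2_norm \<Omega> u \<le> C * L2_norm \<Omega> g"
proof -
  obtain R where R: "R > 0" "\<And>\<phi>. \<phi> \<in> test_functions \<Omega> \<Longrightarrow>
    (\<integral>\<^sup>+x. ennreal ((\<phi> x)\<^sup>2) \<partial>lborel)\<^sup>2 \<le>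
     ennreal R * (\<integral>\<^sup>+x. ennreal ((\<phi> x)\<^sup>2) \<partial>lborel) * (\<integral>\<^sup>+x. ennreal ((norm (cgrad \<phi> x))\<^sup>2) \<partial>lborel)"
    using test_function_Poincare by blast
  have test: "L2_norm \<Omega> \<phi> \<le> sqrt R * L2_norm \<Omega> (cgrad \<phi>)" if \<phi>: "\<phi> \<in> test_functions \<Omega>" for \<phi>
  proof (cases "L2_norm \<Omega> \<phi> = 0")
    case False
    then have pos: "(L2_norm \<Omega> \<phi>)\<^sup>2 > 0" by simp
    have "ennreal (((L2_norm \<Omega> \<phi>)\<^sup>2)\<^sup>2) \<le> ennreal (R * (L2_norm \<Omega> \<phi>)\<^sup>2 * (L2_norm \<Omega> (cgrad \<phi>))\<^sup>2)"
      using R(2)[OF \<phi>] R(1) unfolding test_function_L2_lborel[OF \<phi>]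
      by (simp add: ennreal_power ennreal_mult)
    then have "((L2_norm \<Omega> \<phi>)\<^sup>2)\<^sup>2 \<le> R * (L2_norm \<Omega> \<phi>)\<^sup>2 * (L2_norm \<Omega> (cgrad \<phi>))\<^sup>2"
      using R(1) by (subst (asm) ennreal_le_iff) auto
    then have "(L2_norm \<Omega> \<phi>)\<^sup>2 * (L2_norm \<Omega> \<phi>)\<^sup>2 \<le> (L2_norm \<Omega> \<phi>)\<^sup>2 * (R * (L2_norm \<Omega> (cgrad \<phi>))\<^sup>2)"
      by (simp add: power2_eq_square mult_ac)
    then have "(L2_norm \<Omega> \<phi>)\<^sup>2 \<le> R * (L2_norm \<Omega> (cgrad \<phi>))\<^sup>2" using pos by (rule mult_left_le_imp_le)
    also have "\<dots> = (sqrt R * L2_norm \<Omega> (cgrad \<phi>))\<^sup>2" using R(1) by (simp add: power_mult_distrib)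
    finally show ?thesis by (rule power2_le_imp_le) (use R(1) in simp)
  qed (use R(1) in simp)
  have "L2_norm \<Omega> u \<le> sqrt R * L2_norm \<Omega> g" if "H1_limit u g \<phi>" for u g \<phi>
    by (rule LIMSEQ_le[OF H1_limit_norms(1)[OF that] tendsto_mult_left[OF H1_limit_norms(2)[OF that]]])
       (use that test in \<open>auto simp: H1_limit_def\<close>)
  then show thesis using R(1) by (intro that[of "sqrt R"]) auto
qed

text \<open>Along a subsequence the approximations converge almost everywhere; Fatou's lemma carries
  Ladyzhenskaya's inequality to the limit.\<close>

lemma H1_limit_L4:
  assumes lim: "H1_limit u g \<phi>"
  shows "(\<integral>\<^sup>+x. ennreal ((u x)^4) \<partial>lebesgue_on \<Omega>) \<le> ennreal (8 * L2_norm \<Omega> u * L2_norm \<Omega> g ^ 3)"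
proof -
  have u: "u \<in> L2 \<Omega>" and t: "\<phi> n \<in> test_functions \<Omega>" for n using lim by (auto simp: H1_limit_def)
  note \<phi> = test_function_L2[OF t]
  have "\<exists>r. strict_mono r \<and> (AE x in lebesgue_on \<Omega>. (\<lambda>n. (\<phi> (r n) x - u x)\<^sup>2) \<longlonglongrightarrow> 0)"
  proof (rule tendsto_L1_AE_subseq)
    show "integrable (lebesgue_on \<Omega>) (\<lambda>x. (\<phi> n x - u x)\<^sup>2)" for n
      using L2_D(2)[OF L2_diff[OF \<phi> u]] by simp
    have "(\<integral>x. norm ((\<phi> n x - u x)\<^sup>2) \<partial>lebesgue_on \<Omega>) = (L2_norm \<Omega> (\<lambda>x. \<phi> n x - u x))\<^sup>2" for n
      unfolding L2_norm_power2 L2_inner_def by (simp add: power2_eq_square)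
    moreover have "(\<lambda>n. (L2_norm \<Omega> (\<lambda>x. \<phi> n x - u x))\<^sup>2) \<longlonglongrightarrow> 0"
      using lim by (auto simp: H1_limit_def intro!: tendsto_eq_intros)
    ultimately show "(\<lambda>n. \<integral>x. norm ((\<phi> n x - u x)\<^sup>2) \<partial>lebesgue_on \<Omega>) \<longlonglongrightarrow> 0" by simp
  qed
  then obtain r where r: "strict_mono r" "AE x in lebesgue_on \<Omega>. (\<lambda>n. (\<phi> (r n) x - u x)\<^sup>2) \<longlonglongrightarrow> 0"
    by blast
  have ae: "AE x in lebesgue_on \<Omega>. ennreal ((u x)^4) = liminf (\<lambda>n. ennreal ((\<phi> (r n) x)^4))"
    using r(2)
  proof eventually_elim
    case (elim x)
    then have "(\<lambda>n. \<bar>\<phi> (r n) x - u x\<bar>) \<longlonglongrightarrow> 0"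
      using tendsto_real_sqrt[of "\<lambda>n. (\<phi> (r n) x - u x)\<^sup>2" 0] by simp
    then have "(\<lambda>n. \<phi> (r n) x - u x) \<longlonglongrightarrow> 0" by (simp add: tendsto_rabs_zero_iff)
    then have "(\<lambda>n. \<phi> (r n) x) \<longlonglongrightarrow> u x" by (rule LIM_zero_cancel)
    then have "(\<lambda>n. ennreal ((\<phi> (r n) x)^4)) \<longlonglongrightarrow> ennreal ((u x)^4)"
      by (intro tendsto_ennrealI tendsto_power)
    then show ?case by (intro lim_imp_Liminf[symmetric]) auto
  qed
  have "(\<integral>\<^sup>+x. ennreal ((u x)^4) \<partial>lebesgue_on \<Omega>) = (\<integral>\<^sup>+x. liminf (\<lambda>n. ennreal ((\<phi> (r n) x)^4)) \<partial>lebesgue_on \<Omega>)"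
    by (rule nn_integral_cong_AE[OF ae])
  also have "\<dots> \<le> liminf (\<lambda>n. \<integral>\<^sup>+x. ennreal ((\<phi> (r n) x)^4) \<partial>lebesgue_on \<Omega>)"
    using L2_D(1)[OF \<phi>] by (intro nn_integral_liminf) simp
  also have "\<dots> \<le> liminf (\<lambda>n. ennreal (8 * L2_norm \<Omega> (\<phi> (r n)) * L2_norm \<Omega> (cgrad (\<phi> (r n))) ^ 3))"
    using test_function_Ladyzhenskaya[OF t] by (intro Liminf_mono always_eventually) auto
  also have "\<dots> = ennreal (8 * L2_norm \<Omega> u * L2_norm \<Omega> g ^ 3)"
  proof (rule lim_imp_Liminf)
    show "(\<lambda>n. ennreal (8 * L2_norm \<Omega> (\<phi> (r n)) * L2_norm \<Omega> (cgrad (\<phi> (r n))) ^ 3)) \<longlonglongrightarrow>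
        ennreal (8 * L2_norm \<Omega> u * L2_norm \<Omega> g ^ 3)"
      using LIMSEQ_subseq_LIMSEQ[OF H1_limit_norms(1)[OF lim] r(1)]
        LIMSEQ_subseq_LIMSEQ[OF H1_limit_norms(2)[OF lim] r(1)]
      by (intro tendsto_ennrealI tendsto_mult tendsto_power tendsto_const) (auto simp: o_def)
  qed simp
  finally show ?thesis .
qed

lemma H1_limit_square_L2:
  assumes lim: "H1_limit u g \<phi>"
  shows "(\<lambda>x. (u x)\<^sup>2) \<in> L2 \<Omega>"
    and "(L2_norm \<Omega> (\<lambda>x. (u x)\<^sup>2))\<^sup>2 \<le> 8 * L2_norm \<Omega> u * L2_norm \<Omega> g ^ 3"
proof -
  have u: "u \<in> borel_measurable (lebesgue_on \<Omega>)" using lim L2_D(1) by (auto simp: H1_limit_def)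
  then have u2: "(\<lambda>x. (u x)\<^sup>2) \<in> borel_measurable (lebesgue_on \<Omega>)" by simp
  have eq: "(norm ((u x)\<^sup>2))\<^sup>2 = (u x)^4" for x by simp
  have "integrable (lebesgue_on \<Omega>) (\<lambda>x. (u x)^4)"
  proof (rule integrableI_bounded)
    show "(\<lambda>x. (u x)^4) \<in> borel_measurable (lebesgue_on \<Omega>)" using u by simp
    show "(\<integral>\<^sup>+x. ennreal (norm ((u x)^4)) \<partial>lebesgue_on \<Omega>) < \<infinity>"
      using order_le_less_trans[OF H1_limit_L4[OF lim]] by simp
  qed
  with u2 show L: "(\<lambda>x. (u x)\<^sup>2) \<in> L2 \<Omega>" by (simp add: L2_def eq del: norm_power)
  have "ennreal ((L2_norm \<Omega> (\<lambda>x. (u x)\<^sup>2))\<^sup>2) \<le> ennreal (8 * L2_norm \<Omega> u * L2_norm \<Omega> g ^ 3)"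
    unfolding nn_integral_L2_norm[OF L, symmetric] eq by (rule H1_limit_L4[OF lim])
  then show "(L2_norm \<Omega> (\<lambda>x. (u x)\<^sup>2))\<^sup>2 \<le> 8 * L2_norm \<Omega> u * L2_norm \<Omega> g ^ 3"
    by (subst (asm) ennreal_le_iff) auto
qed

lemma L2_mult_square:
  fixes v :: "real^3 \<Rightarrow> 'b::euclidean_space"
  assumes u: "u \<in> borel_measurable (lebesgue_on \<Omega>)" "(\<lambda>x. (u x)\<^sup>2) \<in> L2 \<Omega>"
    and v: "v \<in> borel_measurable (lebesgue_on \<Omega>)" "(\<lambda>x. (norm (v x))\<^sup>2) \<in> L2 \<Omega>"
  shows "(\<lambda>x. u x *\<^sub>R v x) \<in> L2 \<Omega>"
    and "(L2_norm \<Omega> (\<lambda>x. u x *\<^sub>R v x))\<^sup>2 \<le> L2_norm \<Omega> (\<lambda>x. (u x)\<^sup>2) * L2_norm \<Omega> (\<lambda>x. (norm (v x))\<^sup>2)"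
proof -
  have eq: "(norm (u x *\<^sub>R v x))\<^sup>2 = (u x)\<^sup>2 \<bullet> (norm (v x))\<^sup>2" for x
    by (simp add: power_mult_distrib)
  have "integrable (lebesgue_on \<Omega>) (\<lambda>x. (norm (u x *\<^sub>R v x))\<^sup>2)"
    unfolding eq by (rule L2_integrable_inner[OF u(2) v(2)])
  then show "(\<lambda>x. u x *\<^sub>R v x) \<in> L2 \<Omega>"
    using borel_measurable_scaleR[OF u(1) v(1)] by (simp add: L2_def del: norm_scaleR)
  have "(L2_norm \<Omega> (\<lambda>x. u x *\<^sub>R v x))\<^sup>2 = L2_inner \<Omega> (\<lambda>x. (u x)\<^sup>2) (\<lambda>x. (norm (v x))\<^sup>2)"
    by (simp add: L2_norm_power2 L2_inner_def dot_square_norm power_mult_distrib)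
  then show "(L2_norm \<Omega> (\<lambda>x. u x *\<^sub>R v x))\<^sup>2 \<le> L2_norm \<Omega> (\<lambda>x. (u x)\<^sup>2) * L2_norm \<Omega> (\<lambda>x. (norm (v x))\<^sup>2)"
    using L2_Cauchy_Schwarz[OF u(2) v(2)] by simp
qed

lemma H1_0_square_L2:
  assumes "u \<in> H1_0 \<Omega>"
  shows "u \<in> borel_measurable (lebesgue_on \<Omega>)" "(\<lambda>x. (u x)\<^sup>2) \<in> L2 \<Omega>"
proof -
  obtain \<phi> where lim: "H1_limit u (wgrad \<Omega> u) \<phi>" using H1_0_limit[OF assms] .
  show "(\<lambda>x. (u x)\<^sup>2) \<in> L2 \<Omega>" by (rule H1_limit_square_L2(1)[OF lim])
  show "u \<in> borel_measurable (lebesgue_on \<Omega>)" using lim L2_D(1) by (auto simp: H1_limit_def)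
qed

lemma H1_0_vec_subset_H1_vec: "H1_0_vec \<Omega> \<subseteq> H1_vec \<Omega>"
  by (auto simp: H1_0_vec_def H1_vec_def H1_0_def)

lemma H1_0_vec_square_L2:
  assumes u: "u \<in> H1_0_vec \<Omega>"
  shows "u \<in> borel_measurable (lebesgue_on \<Omega>)" "(\<lambda>x. (norm (u x))\<^sup>2) \<in> L2 \<Omega>"
proof -
  have c: "(\<lambda>x. u x $ i) \<in> H1_0 \<Omega>" for i using u by (simp add: H1_0_vec_def)
  show "u \<in> borel_measurable (lebesgue_on \<Omega>)"
    using H1_0_square_L2(1)[OF c] by (rule borel_measurable_vec_lambda)
  have "(\<lambda>x. (norm (u x))\<^sup>2) = (\<lambda>x. (u x $ 1)\<^sup>2 + (u x $ 2)\<^sup>2 + (u x $ 3)\<^sup>2)"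
    unfolding power2_norm_eq_inner inner_vec_def sum_3 by (simp add: power2_eq_square)
  then show "(\<lambda>x. (norm (u x))\<^sup>2) \<in> L2 \<Omega>" using H1_0_square_L2(2)[OF c] by (simp add: L2_add)
qed

end

section \<open>The convection term\<close>

text \<open>The tensor product \<open>a \<otimes> b\<close>.  Moving the transporting field to the other side,
  \<open>(M b) \<cdot> a = M : (a \<otimes> b)\<close>, turns the convection term into an \<open>L\<^sup>2\<close> product of two square integrable
  matrix fields.\<close>

definition outer :: "real^3 \<Rightarrow> real^3 \<Rightarrow> real^3^3" where
  "outer a b = (\<chi> i. a $ i *\<^sub>R b)"

lemma outer_linear: "linear (\<lambda>a. outer a b)"
  by (rule linearI) (auto simp: outer_def vec_eq_iff algebra_simps)

lemma inner_outer: "(M *v b) \<bullet> a = M \<bullet> outer a b"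
  by (simp add: inner_vec_def outer_def matrix_vector_mult_def sum_distrib_right sum_distrib_left mult_ac)

context bounded_open_domain
begin

lemma cgrad_square:
  assumes "\<phi> \<in> test_functions \<Omega>"
  shows "cgrad (\<lambda>x. \<phi> x * \<phi> x) x = (2 * \<phi> x) *\<^sub>R cgrad \<phi> x"
  using test_function_differentiable(1)[OF assms, of x]
  by (simp add: cgrad_def vec_eq_iff pderiv3_mult)

text \<open>For a test function \<open>\<phi>\<close> one has \<open>2 (\<nabla>\<phi>, \<phi> w) = (w, \<nabla>(\<phi>\<^sup>2)) = - (\<nabla> \<cdot> w, \<phi>\<^sup>2) = 0\<close>.  In the limit
  \<open>\<nabla>\<phi>\<^sub>n\<close> converges in \<open>L\<^sup>2\<close>, and so does \<open>\<phi>\<^sub>n w\<close>, because \<open>w\<close> is in \<open>L\<^sup>4\<close> and \<open>\<phi>\<^sub>n\<close> converges in \<open>L\<^sup>4\<close>.\<close>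

lemma convection_scalar_zero:
  assumes w: "w \<in> H1_0_vec \<Omega>" and div: "ae_eq \<Omega> (wdiv \<Omega> w) (\<lambda>_. 0)" and u: "u \<in> H1_0 \<Omega>"
  shows "L2_inner \<Omega> (wgrad \<Omega> u) (\<lambda>x. u x *\<^sub>R w x) = 0"
proof -
  obtain \<phi> where lim: "H1_limit u (wgrad \<Omega> u) \<phi>" using H1_0_limit[OF u] .
  then have t: "\<phi> n \<in> test_functions \<Omega>" and uL: "u \<in> L2 \<Omega>" and gL: "wgrad \<Omega> u \<in> L2 \<Omega>" for n
    by (auto simp: H1_limit_def)
  note w2 = H1_0_vec_square_L2[OF w]
  note d = H1_limit_diff[OF lim]
  have wd: "has_wdiv \<Omega> w (wdiv \<Omega> w)"
    using w H1_0_vec_subset_H1_vec H1_vec_subset_H_div by (intro wdiv_has_wdiv) auto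
  have \<phi>w: "(\<lambda>x. \<phi> n x *\<^sub>R w x) \<in> L2 \<Omega>" for n
  proof (rule L2_mult_square(1)[OF _ _ w2])
    show "\<phi> n \<in> borel_measurable (lebesgue_on \<Omega>)" using L2_D(1)[OF test_function_L2[OF t]] .
    show "(\<lambda>x. (\<phi> n x)\<^sup>2) \<in> L2 \<Omega>"
      using test_function_L2[OF test_function_mult[OF t t]] by (simp add: power2_eq_square)
  qed
  have zero: "L2_inner \<Omega> (cgrad (\<phi> n)) (\<lambda>x. \<phi> n x *\<^sub>R w x) = 0" for n
  proof -
    have "2 * L2_inner \<Omega> (cgrad (\<phi> n)) (\<lambda>x. \<phi> n x *\<^sub>R w x) = L2_inner \<Omega> w (cgrad (\<lambda>x. \<phi> n x * \<phi> n x))"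
      unfolding L2_inner_def integral_mult_right_zero[symmetric]
      by (intro Bochner_Integration.integral_cong) (auto simp: cgrad_square[OF t] inner_commute)
    also have "\<dots> = - L2_inner \<Omega> (wdiv \<Omega> w) (\<lambda>x. \<phi> n x * \<phi> n x)"
      using wd test_function_mult[OF t t] by (simp add: has_wdiv_def)
    also have "\<dots> = 0" using L2_inner_zero_left[OF div] by simp
    finally show ?thesis by simp
  qed
  have "(\<lambda>n. L2_norm \<Omega> (\<lambda>x. \<phi> n x *\<^sub>R w x - u x *\<^sub>R w x)) \<longlonglongrightarrow> 0"
  proof -
    let ?W = "L2_norm \<Omega> (\<lambda>x. (norm (w x))\<^sup>2)"
    let ?e = "\<lambda>n. L2_norm \<Omega> (\<lambda>x. \<phi> n x - u x)" and ?f = "\<lambda>n. L2_norm \<Omega> (\<lambda>x. cgrad (\<phi> n) x - wgrad \<Omega> u x)"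
    have bound: "L2_norm \<Omega> (\<lambda>x. \<phi> n x *\<^sub>R w x - u x *\<^sub>R w x) \<le> sqrt (sqrt (8 * ?e n * ?f n ^ 3) * ?W)" for n
    proof -
      have m: "(\<lambda>x. \<phi> n x - u x) \<in> borel_measurable (lebesgue_on \<Omega>)"
        using L2_D(1)[OF L2_diff[OF test_function_L2[OF t] uL]] .
      have "(L2_norm \<Omega> (\<lambda>x. (\<phi> n x - u x) *\<^sub>R w x))\<^sup>2 \<le> L2_norm \<Omega> (\<lambda>x. (\<phi> n x - u x)\<^sup>2) * ?W"
        by (rule L2_mult_square(2)[OF m H1_limit_square_L2(1)[OF d] w2])
      also have "\<dots> \<le> sqrt (8 * ?e n * ?f n ^ 3) * ?W"
        using H1_limit_square_L2(2)[OF d, of n] by (intro mult_right_mono real_le_rsqrt) auto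
      finally show ?thesis by (intro real_le_rsqrt) (simp add: scaleR_diff_left)
    qed
    have "(\<lambda>n. sqrt (sqrt (8 * ?e n * ?f n ^ 3) * ?W)) \<longlonglongrightarrow> sqrt (sqrt (8 * 0 * 0 ^ 3) * ?W)"
      using lim unfolding H1_limit_def by (intro tendsto_intros) auto
    then have "(\<lambda>n. sqrt (sqrt (8 * ?e n * ?f n ^ 3) * ?W)) \<longlonglongrightarrow> 0" by simp
    then show ?thesis by (rule Lim_null_comparison[rotated]) (use bound in auto)
  qed
  moreover have "(\<lambda>x. u x *\<^sub>R w x) \<in> L2 \<Omega>"
    by (rule L2_mult_square(1)[OF H1_0_square_L2[OF u] w2])
  moreover have "(\<lambda>n. L2_norm \<Omega> (\<lambda>x. cgrad (\<phi> n) x - wgrad \<Omega> u x)) \<longlonglongrightarrow> 0"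
    using lim by (simp add: H1_limit_def)
  ultimately have "(\<lambda>n. L2_inner \<Omega> (cgrad (\<phi> n)) (\<lambda>x. \<phi> n x *\<^sub>R w x)) \<longlonglongrightarrow>
      L2_inner \<Omega> (wgrad \<Omega> u) (\<lambda>x. u x *\<^sub>R w x)"
    by (intro L2_inner_tendsto test_function_cgrad_L2[OF t] gL \<phi>w)
  then show ?thesis by (simp add: zero LIMSEQ_const_iff)
qed

lemma convection_eq: "L2_inner \<Omega> (\<lambda>x. wjac \<Omega> u x *v w x) v = L2_inner \<Omega> (wjac \<Omega> u) (\<lambda>x. outer (v x) (w x))"
  by (simp add: L2_inner_def inner_outer)

lemma outer_L2:
  assumes v: "v \<in> H1_0_vec \<Omega>" and w: "w \<in> H1_0_vec \<Omega>"
  shows "(\<lambda>x. outer (v x) (w x)) \<in> L2 \<Omega>"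
proof (rule L2_vec_lambda)
  fix i
  have "(\<lambda>x. v x $ i) \<in> H1_0 \<Omega>" using v by (simp add: H1_0_vec_def)
  then show "(\<lambda>x. outer (v x) (w x) $ i) \<in> L2 \<Omega>"
    unfolding outer_def vec_lambda_beta
    by (intro L2_mult_square(1) H1_0_square_L2 H1_0_vec_square_L2[OF w])
qed

lemma convection_zero:
  assumes w: "w \<in> H1_0_vec \<Omega>" and div: "ae_eq \<Omega> (wdiv \<Omega> w) (\<lambda>_. 0)" and u: "u \<in> H1_0_vec \<Omega>"
  shows "L2_inner \<Omega> (\<lambda>x. wjac \<Omega> u x *v w x) u = 0"
proof -
  have c: "(\<lambda>x. u x $ i) \<in> H1_0 \<Omega>" for i using u by (simp add: H1_0_vec_def)
  have L: "wgrad \<Omega> (\<lambda>x. u x $ i) \<in> L2 \<Omega>" for i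
    using H1_0_limit[OF c[of i]] by (auto simp: H1_limit_def)
  have M: "(\<lambda>x. u x $ i *\<^sub>R w x) \<in> L2 \<Omega>" for i
    by (intro L2_mult_square(1) H1_0_square_L2[OF c] H1_0_vec_square_L2[OF w])
  have "L2_inner \<Omega> (\<lambda>x. wjac \<Omega> u x *v w x) u =
      (\<Sum>i\<in>UNIV. L2_inner \<Omega> (wgrad \<Omega> (\<lambda>x. u x $ i)) (\<lambda>x. u x $ i *\<^sub>R w x))"
    unfolding convection_eq unfolding L2_inner_def
    by (subst Bochner_Integration.integral_sum[symmetric])
       (auto simp: inner_vec_def[of "_ :: real^3^3"] wjac_def outer_def intro!: L2_integrable_inner[OF L M, simplified])
  also have "\<dots> = 0" using convection_scalar_zero[OF w div c] by simp
  finally show ?thesis .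
qed

lemma H1_0_vec_Poincare:
  assumes u: "u \<in> H1_0_vec \<Omega>" and zero: "L2_norm \<Omega> (wjac \<Omega> u) = 0"
  shows "ae_eq \<Omega> u (\<lambda>_. 0)"
proof -
  obtain C where C: "C > 0" "\<And>u g \<phi>. H1_limit u g \<phi> \<Longrightarrow> L2_norm \<Omega> u \<le> C * L2_norm \<Omega> g"
    using H1_limit_Poincare by blast
  have uH: "u \<in> H1_vec \<Omega>" using u H1_0_vec_subset_H1_vec by auto
  have J: "ae_eq \<Omega> (wjac \<Omega> u) (\<lambda>_. 0)" using zero L2_norm_zero_iff[OF wjac_L2[OF uH]] by simp
  have "ae_eq \<Omega> (\<lambda>x. u x $ i) (\<lambda>_. 0)" for i
  proof -
    have c: "(\<lambda>x. u x $ i) \<in> H1_0 \<Omega>" using u by (simp add: H1_0_vec_def)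
    obtain \<phi> where lim: "H1_limit (\<lambda>x. u x $ i) (wgrad \<Omega> (\<lambda>x. u x $ i)) \<phi>" using H1_0_limit[OF c] .
    then have L: "wgrad \<Omega> (\<lambda>x. u x $ i) \<in> L2 \<Omega>" "(\<lambda>x. u x $ i) \<in> L2 \<Omega>" by (auto simp: H1_limit_def)
    have "ae_eq \<Omega> (wgrad \<Omega> (\<lambda>x. u x $ i)) (\<lambda>_. 0)"
      using J unfolding ae_eq_def wjac_def by eventually_elim (simp add: vec_eq_iff)
    then have "L2_norm \<Omega> (wgrad \<Omega> (\<lambda>x. u x $ i)) = 0" using L2_norm_zero_iff[OF L(1)] by simp
    then have "L2_norm \<Omega> (\<lambda>x. u x $ i) = 0"
      using C(2)[OF lim] L2_norm_nonneg[of \<Omega> "\<lambda>x. u x $ i"] by simp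
    then show ?thesis using L2_norm_zero_iff[OF L(2)] by simp
  qed
  then have "AE x in lebesgue_on \<Omega>. \<forall>i. u x $ i = 0"
    by (intro AE_all_countable[THEN iffD2] allI) (simp add: ae_eq_def)
  then show ?thesis by (simp add: ae_eq_def vec_eq_iff)
qed

end

section \<open>Finite element spaces\<close>

text \<open>Membership in a finite element space constrains a function in the interiors of the cells only.  Their
  union misses just a null set of \<open>\<Omega>\<close>, since the frontier of a convex cell is negligible; restriction to
  it therefore plays the part of the finite-rank map \<open>\<rho>\<close> in \<open>biorthogonal_bound\<close>.\<close>

definition mesh_interior :: "(real^3) set set \<Rightarrow> (real^3) set" where
  "mesh_interior T = (\<Union>K\<in>T. interior K)"

definition restrict_to :: "(real^3) set \<Rightarrow> (real^3 \<Rightarrow> 'b::real_vector) \<Rightarrow> real^3 \<Rightarrow> 'b" where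
  "restrict_to U v x = (if x \<in> U then v x else 0)"

lemma linear_restrict_to: "linear (restrict_to U)"
  by (rule linearI) (auto simp: restrict_to_def plus_fun_def scaleR_fun_def)

lemma AE_mesh_interior:
  assumes "is_mesh \<Omega> T"
  shows "AE x in lebesgue. x \<in> \<Omega> \<longrightarrow> x \<in> mesh_interior T"
proof -
  have T: "finite T" "\<And>K. K \<in> T \<Longrightarrow> polytope K" "\<Union>T = closure \<Omega>"
    using assms by (auto simp: is_mesh_def)
  have "negligible (\<Union>K\<in>T. frontier K)"
    using T by (intro negligible_Union) (auto intro: negligible_convex_frontier polytope_imp_convex)
  then have "AE x in lebesgue. x \<notin> (\<Union>K\<in>T. frontier K)"
    by (intro AE_not_in) (simp add: negligible_iff_null_sets)
  then show ?thesis
  proof eventually_elim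
    case (elim x)
    show ?case
    proof
      assume "x \<in> \<Omega>"
      then have "x \<in> \<Union>T" using T(3) closure_subset by blast
      then obtain K where K: "K \<in> T" "x \<in> K" by blast
      then have "x \<notin> frontier K" using elim by blast
      then have "x \<in> interior K" using K closure_subset[of K] by (auto simp: frontier_def)
      then show "x \<in> mesh_interior T" using K by (auto simp: mesh_interior_def)
    qed
  qed
qed

text \<open>The interiors of distinct cells are disjoint, so the restriction of \<open>v\<close> is the sum of its restrictions
  to single cells, and each of these lies in the span of finitely many cut-off shape functions.\<close>

lemma fe_space_finite_dimensional:
  fixes V :: "(real^3 \<Rightarrow> 'b::euclidean_space) set"
  assumes T: "is_mesh \<Omega> T" and V: "fe_space T V"
  obtains F where "finite F" "restrict_to (mesh_interior T) ` V \<subseteq> span F"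
proof -
  have fin: "finite T" and disj: "\<And>K L. K \<in> T \<Longrightarrow> L \<in> T \<Longrightarrow> K \<noteq> L \<Longrightarrow> interior K \<inter> interior L = {}"
    using T by (auto simp: is_mesh_def)
  obtain F where F: "\<And>K. K \<in> T \<Longrightarrow> finite (F K)"
      "\<And>K v. K \<in> T \<Longrightarrow> v \<in> V \<Longrightarrow> \<exists>p\<in>span (F K). \<forall>x\<in>interior K. v x = p x"
    using V unfolding fe_space_def by metis
  let ?G = "\<Union>K\<in>T. restrict_to (interior K) ` F K"
  have cell: "restrict_to (interior K) v \<in> span ?G" if K: "K \<in> T" and v: "v \<in> V" for K v
  proof -
    obtain p where p: "p \<in> span (F K)" "\<And>x. x \<in> interior K \<Longrightarrow> v x = p x" using F(2)[OF K v] by blast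
    have "restrict_to (interior K) v = restrict_to (interior K) p"
      using p(2) by (auto simp: restrict_to_def)
    also have "\<dots> \<in> span (restrict_to (interior K) ` F K)"
      using p(1) by (simp add: span_linear_image[OF linear_restrict_to])
    also have "\<dots> \<subseteq> span ?G" using K by (intro span_mono) auto
    finally show ?thesis .
  qed
  have sum_fun: "(\<Sum>K\<in>S. g K) x = (\<Sum>K\<in>S. g K x)" for S and g :: "(real^3) set \<Rightarrow> real^3 \<Rightarrow> 'b" and x
    by (induction S rule: infinite_finite_induct) auto
  have "restrict_to (mesh_interior T) v = (\<Sum>K\<in>T. restrict_to (interior K) v)" for v :: "real^3 \<Rightarrow> 'b"
  proof (rule ext)
    fix x
    show "restrict_to (mesh_interior T) v x = (\<Sum>K\<in>T. restrict_to (interior K) v) x"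
    proof (cases "x \<in> mesh_interior T")
      case True
      then obtain K where K: "K \<in> T" "x \<in> interior K" by (auto simp: mesh_interior_def)
      have "(\<Sum>L\<in>T. restrict_to (interior L) v x) = (\<Sum>L\<in>T. if L = K then v x else 0)"
        using K disj by (intro sum.cong) (auto simp: restrict_to_def)
      then show ?thesis using K fin True by (simp add: sum_fun restrict_to_def)
    qed (auto simp: sum_fun restrict_to_def mesh_interior_def intro!: sum.neutral)
  qed
  then have "restrict_to (mesh_interior T) ` V \<subseteq> span ?G"
    using cell by (auto intro: span_sum)
  then show thesis using fin F(1) by (intro that[of ?G]) auto
qed

lemma restrict_to_zero_imp_ae_zero:
  assumes T: "is_mesh \<Omega> T" and \<Omega>: "\<Omega> \<in> sets lebesgue"
    and zero: "restrict_to (mesh_interior T) v = 0"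
  shows "v \<in> ae_zero \<Omega>"
proof -
  have "v x = 0" if "x \<in> mesh_interior T" for x
    using fun_cong[OF zero, of x] that by (simp add: restrict_to_def)
  then have "AE x in lebesgue. x \<in> \<Omega> \<longrightarrow> v x = 0"
    using AE_mesh_interior[OF T] by (auto elim: eventually_mono)
  then show ?thesis unfolding ae_zero_def ae_eq_def using \<Omega> by (simp add: AE_restrict_space_iff)
qed

lemma span_Times_subset:
  "span F \<times> span G \<subseteq> span ((\<lambda>a. (a, 0)) ` F \<union> (\<lambda>b. (0, b)) ` G)"
proof (clarify)
  fix a b assume ab: "a \<in> span F" "b \<in> span G"
  let ?S = "(\<lambda>a. (a, 0)) ` F \<union> (\<lambda>b. (0, b)) ` G"
  have l: "linear (\<lambda>a. (a, 0))" "linear (\<lambda>b. (0, b))" by (auto intro!: linearI)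
  have "(a, 0) \<in> span ?S"
    using ab(1) span_linear_image[OF l(1), of F] span_mono[of "(\<lambda>a. (a, 0)) ` F" ?S] by auto
  moreover have "(0, b) \<in> span ?S"
    using ab(2) span_linear_image[OF l(2), of G] span_mono[of "(\<lambda>b. (0, b)) ` G" ?S] by auto
  ultimately have "(a, 0) + (0, b) \<in> span ?S" by (rule span_add)
  then show "(a, b) \<in> span ?S" by simp
qed

section \<open>Dual norms\<close>

lemma dual_norm_bound:
  fixes W :: "'v::real_vector set"
  assumes W: "subspace W" and N: "\<And>x. 0 \<le> N x" "\<And>c x. x \<in> W \<Longrightarrow> N (c *\<^sub>R x) = \<bar>c\<bar> * N x"
    and l: "l \<in> dual_space W N"
  shows "y \<in> W \<Longrightarrow> \<bar>l y\<bar> \<le> dual_norm W N l * N y" "0 \<le> dual_norm W N l"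
proof -
  obtain M where M: "\<And>x. x \<in> W \<Longrightarrow> \<bar>l x\<bar> \<le> M * N x" using l unfolding dual_space_def by blast
  have scale: "l (c *\<^sub>R x) = c * l x" if "x \<in> W" for c x using l that by (auto simp: dual_space_def)
  have "\<bar>l x\<bar> \<le> \<bar>M\<bar>" if "x \<in> W" "N x \<le> 1" for x
  proof -
    have "\<bar>l x\<bar> \<le> \<bar>M\<bar> * N x" using M[OF that(1)] N(1)[of x] by (meson abs_ge_self mult_right_mono order_trans)
    also have "\<dots> \<le> \<bar>M\<bar>" using that N(1)[of x] by (simp add: mult_left_le)
    finally show ?thesis .
  qed
  then have bdd: "bdd_above ((\<lambda>x. \<bar>l x\<bar>) ` {x \<in> W. N x \<le> 1})" by (auto intro!: bdd_aboveI)
  have ball: "\<bar>l x\<bar> \<le> dual_norm W N l" if "x \<in> W" "N x \<le> 1" for x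
    unfolding dual_norm_def by (rule cSUP_upper[OF _ bdd]) (use that in auto)
  have "N 0 = 0" using N(2)[of 0 0] subspace_0[OF W] by simp
  then show "0 \<le> dual_norm W N l" using ball[of 0] subspace_0[OF W] by (auto intro: order_trans[OF abs_ge_zero])
  show "\<bar>l y\<bar> \<le> dual_norm W N l * N y" if y: "y \<in> W"
  proof (cases "N y = 0")
    case True
    then show ?thesis using M[OF y] by simp
  next
    case False
    then have pos: "N y > 0" using N(1)[of y] by simp
    have "\<bar>l ((1 / N y) *\<^sub>R y)\<bar> \<le> dual_norm W N l"
      using y W pos N(2)[OF y, of "1 / N y"] by (intro ball subspace_scale) auto
    then show ?thesis using scale[OF y, of "1 / N y"] pos by (simp add: abs_mult field_simps)
  qed
qed

section \<open>The weak curl\<close>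

lemma cross3_borel_measurable:
  assumes f: "f \<in> borel_measurable M" and g: "g \<in> borel_measurable M"
  shows "(\<lambda>x. cross3 (f x) (g x)) \<in> borel_measurable M"
proof (rule borel_measurable_vec_lambda)
  have c: "(\<lambda>x. h x $ i) \<in> borel_measurable M" if "h \<in> borel_measurable M" for h :: "'a \<Rightarrow> real^3" and i
    using measurable_compose[OF that borel_measurable_continuous_onI[of "\<lambda>y. y $ i"]]
    by (simp add: continuous_on_component)
  fix i :: 3
  show "(\<lambda>x. cross3 (f x) (g x) $ i) \<in> borel_measurable M"
    using exhaust_3[of i] c[OF f] c[OF g]
    by (auto simp: cross3_def vector_3 intro!: borel_measurable_diff borel_measurable_times)
qed

lemma norm_cross3_le: "norm (cross3 a b) \<le> norm a * norm b"
proof -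
  have "(norm (cross3 a b))\<^sup>2 \<le> (norm a * norm b)\<^sup>2"
    using norm_cross_dot[of a b] zero_le_power2[of "a \<bullet> b"] by linarith
  then show ?thesis by (rule power2_le_imp_le) simp
qed

lemma cross3_linear: "linear (\<lambda>a. cross3 a b)"
  by (rule linearI) (simp_all add: cross_add_left cross_mult_left)

lemma cross3_L2:
  assumes f: "f \<in> L2 \<Omega>" and b: "b \<in> L_infinity \<Omega>"
  shows "(\<lambda>x. cross3 (f x) (b x)) \<in> L2 \<Omega>"
proof -
  obtain M where bm: "b \<in> borel_measurable (lebesgue_on \<Omega>)" and M: "AE x in lebesgue_on \<Omega>. norm (b x) \<le> M"
    using b by (auto simp: L_infinity_def)
  show ?thesis
  proof (rule L2_bounded_mult[OF f cross3_borel_measurable[OF L2_D(1)[OF f] bm]])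
    show "AE x in lebesgue_on \<Omega>. norm (cross3 (f x) (b x)) \<le> M * norm (f x)"
      using M
    proof eventually_elim
      case (elim x)
      have "norm (cross3 (f x) (b x)) \<le> norm (f x) * norm (b x)" by (rule norm_cross3_le)
      also have "\<dots> \<le> norm (f x) * M" using elim by (intro mult_left_mono) auto
      finally show ?case by (simp add: mult.commute)
    qed
  qed
qed

text \<open>The first identity couples Lorentz force and electromotive force, the second removes the Hall term.\<close>

lemma cross_cancel:
  "L2_inner \<Omega> (\<lambda>x. cross3 (u x) (b x)) k = - L2_inner \<Omega> (\<lambda>x. cross3 (k x) (b x)) u"
  "L2_inner \<Omega> (\<lambda>x. cross3 (k x) (b x)) k = 0"
proof -
  have "cross3 (u x) (b x) \<bullet> k x = - (cross3 (k x) (b x) \<bullet> u x)" for x by (simp add: cross3_simps)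
  then show "L2_inner \<Omega> (\<lambda>x. cross3 (u x) (b x)) k = - L2_inner \<Omega> (\<lambda>x. cross3 (k x) (b x)) u"
    by (simp add: L2_inner_def)
  have "cross3 (k x) (b x) \<bullet> k x = 0" for x by (simp add: cross3_simps)
  then show "L2_inner \<Omega> (\<lambda>x. cross3 (k x) (b x)) k = 0" by (simp add: L2_inner_def)
qed

lemma linear_fst_fst: "linear (\<lambda>z :: ('a::real_vector \<times> 'b::real_vector) \<times> 'c::real_vector. fst (fst z))"
  and linear_snd_fst: "linear (\<lambda>z :: ('a::real_vector \<times> 'b::real_vector) \<times> 'c::real_vector. snd (fst z))"
  by (auto intro!: linearI)

text \<open>One Picard step.  From the de Rham sequence it uses exactness at the space of magnetic fields: a
  divergence-free discrete field is a curl.\<close>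

locale picard_step = bounded_open_domain \<Omega> for \<Omega> :: "(real^3) set" +
  fixes T :: "(real^3) set set" and Rey Rem S RH :: real
    and Q :: "sfield set" and Hcurl Hdiv V :: "vfield set" and um Bm :: vfield
  assumes mesh: "is_mesh \<Omega> T"
    and pos: "Rey > 0" "Rem > 0" "S > 0"
    and fe: "fe_space T Hcurl" "fe_space T Hdiv" "fe_space T V" "fe_space T Q"
    and sub_curl: "Hcurl \<subseteq> H_curl \<Omega>" and sub_div: "Hdiv \<subseteq> H_div \<Omega>"
    and sub_V: "V \<subseteq> H1_0_vec \<Omega>" and sub_Q: "Q \<subseteq> L2 \<Omega>"
    and exact_div: "\<And>B. B \<in> Hdiv \<Longrightarrow> ae_eq \<Omega> (wdiv \<Omega> B) (\<lambda>_. 0) \<Longrightarrow> \<exists>k\<in>Hcurl. ae_eq \<Omega> (wcurl \<Omega> k) B"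
    and inf_sup: "inf_sup_stable \<Omega> V Q"
    and um: "um \<in> V" "ae_eq \<Omega> (wdiv \<Omega> um) (\<lambda>_. 0)" and Bm: "Bm \<in> L_infinity \<Omega>"
begin

abbreviation "W \<equiv> W_space V Hdiv"
abbreviation "norm_X \<equiv> X_norm \<Omega> Hcurl"
abbreviation "weak_curl \<equiv> dcurl \<Omega> Hcurl"
abbreviation "solves \<equiv> is_solution \<Omega> V Hcurl Hdiv Q Rey Rem S RH um Bm"

lemma spaces: "subspace Hcurl" "subspace Hdiv" "subspace V" "subspace Q"
  using fe by (auto simp: fe_space_def)

lemma Hcurl_L2: "Hcurl \<subseteq> L2 \<Omega>" and Hdiv_L2: "Hdiv \<subseteq> L2 \<Omega>" and V_H1: "V \<subseteq> H1_vec \<Omega>" and V_L2: "V \<subseteq> L2 \<Omega>"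
  using sub_curl sub_div sub_V H1_0_vec_subset_H1_vec H1_vec_L2 by (auto simp: H_curl_def H_div_def)

lemmas wcurl_lin = ae_linear_wcurl[OF spaces(1) sub_curl]

text \<open>Riesz representation in the discrete curl space, by solving with a biorthogonal system for the \<open>L\<^sup>2\<close>
  inner product.  The functional vanishes on null vectors because the curl of a null field is null.\<close>

lemma dcurl_represents:
  assumes B: "B \<in> L2 \<Omega>"
  shows "weakly_represents \<Omega> Hcurl Hcurl (wcurl \<Omega>) (\<lambda>k. k) B (weak_curl B)"
proof -
  have A: "bilinear_on Hcurl (ae_zero \<Omega>) (L2_inner \<Omega>)"
    using ae_linear_bilinear_on[OF ae_linear_id[OF Hcurl_L2] ae_linear_id[OF Hcurl_L2] spaces(1)] .
  obtain F where F: "finite F" "restrict_to (mesh_interior T) ` Hcurl \<subseteq> span F"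
    using fe_space_finite_dimensional[OF mesh fe(1)] .
  obtain n e w where bi: "biorthogonal Hcurl (L2_inner \<Omega>) n e w"
    and complete: "\<And>y z. y \<in> Hcurl \<Longrightarrow> z \<in> Hcurl \<Longrightarrow> L2_inner \<Omega> y z = (\<Sum>i<n. L2_inner \<Omega> y (w i) * L2_inner \<Omega> (e i) z)"
    using biorthogonal_complete[OF spaces(1) A linear_restrict_to
        restrict_to_zero_imp_ae_zero[OF mesh domain_sets] F] by blast
  let ?L = "\<lambda>k. L2_inner \<Omega> B (wcurl \<Omega> k)"
  have inL: "wcurl \<Omega> k \<in> L2 \<Omega>" if "k \<in> Hcurl" for k using ae_linearD(1)[OF wcurl_lin that that] .
  have L1: "?L (x + y) = ?L x + ?L y" if "x \<in> Hcurl" "y \<in> Hcurl" for x y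
  proof -
    have "L2_inner \<Omega> (wcurl \<Omega> (x + y)) B = L2_inner \<Omega> (\<lambda>t. wcurl \<Omega> x t + wcurl \<Omega> y t) B"
      using that B inL spaces(1) by (intro L2_inner_cong ae_linearD(2)[OF wcurl_lin] L2_add) (auto intro: subspace_add)
    then show ?thesis using L2_inner_add[OF inL inL B] that by (simp add: L2_inner_commute[of \<Omega> B])
  qed
  have L2: "?L (c *\<^sub>R x) = c * ?L x" if "x \<in> Hcurl" for c x
  proof -
    have "L2_inner \<Omega> (wcurl \<Omega> (c *\<^sub>R x)) B = L2_inner \<Omega> (\<lambda>t. c *\<^sub>R wcurl \<Omega> x t) B"
      using that B inL spaces(1) by (intro L2_inner_cong ae_linearD(3)[OF wcurl_lin] L2_scale) (auto intro: subspace_scale)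
    then show ?thesis by (simp add: L2_inner_commute[of \<Omega> B] L2_inner_scale)
  qed
  have L3: "?L r = 0" if r: "r \<in> Hcurl" "\<And>y. y \<in> Hcurl \<Longrightarrow> L2_inner \<Omega> y r = 0" for r
  proof -
    have "L2_norm \<Omega> r = 0" using r(2)[OF r(1)] by (simp add: L2_norm_def)
    then have "ae_eq \<Omega> r (\<lambda>_. 0)" using L2_norm_zero_iff r(1) Hcurl_L2 by blast
    then have "ae_eq \<Omega> (wcurl \<Omega> r) (\<lambda>_. 0)"
      using ae_linearD(4)[OF wcurl_lin r(1) r(1)] by (simp add: ae_zero_def)
    then show ?thesis using L2_inner_zero_left by (subst L2_inner_commute) blast
  qed
  have solve: "(\<Sum>i<n. ?L (w i) *\<^sub>R e i) \<in> Hcurl" "L2_inner \<Omega> (\<Sum>i<n. ?L (w i) *\<^sub>R e i) k = ?L k"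
    if k: "k \<in> Hcurl" for k
    by (rule biorthogonal_solve[where L="?L", OF spaces(1) A bi];
        (rule k | rule complete | rule L1 | rule L2 | rule L3); blast)+
  have "\<exists>j. j \<in> Hcurl \<and> (\<forall>k\<in>Hcurl. L2_inner \<Omega> j k = ?L k)"
    using solve(1)[OF subspace_0[OF spaces(1)]] solve(2) by blast
  from someI_ex[OF this] show ?thesis
    unfolding dcurl_def weakly_represents_def by auto
qed

lemma dcurl_inner:
  assumes "B \<in> L2 \<Omega>" "k \<in> Hcurl"
  shows "L2_inner \<Omega> (weak_curl B) k = L2_inner \<Omega> B (wcurl \<Omega> k)"
  using dcurl_represents[OF assms(1)] assms(2) by (simp add: weakly_represents_def)

lemma dcurl_lin: "ae_linear \<Omega> Hdiv (ae_zero \<Omega>) weak_curl"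
proof (rule ae_linear_weak_operator[OF Hcurl_L2 _ _ _ _ _ spaces(2) Hdiv_L2 dcurl_represents])
  show "(\<lambda>x. g x + h x) \<in> Hcurl" if "g \<in> Hcurl" "h \<in> Hcurl" for g h
    using subspace_add[OF spaces(1) that] by (simp add: plus_fun_def)
  show "(\<lambda>x. c *\<^sub>R g x) \<in> Hcurl" if "g \<in> Hcurl" for c g
    using subspace_scale[OF spaces(1) that, of c] by (simp add: scaleR_fun_def)
  show "wcurl \<Omega> t \<in> L2 \<Omega>" if "t \<in> Hcurl" for t using ae_linearD(1)[OF wcurl_lin that that] .
  show "t \<in> L2 \<Omega>" if "t \<in> Hcurl" for t using that Hcurl_L2 by auto
  show "B \<in> L2 \<Omega>" if "B \<in> Hdiv" for B using that Hdiv_L2 by auto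
  fix g assume g: "g \<in> Hcurl" "\<And>t. t \<in> Hcurl \<Longrightarrow> L2_inner \<Omega> g t = 0"
  then have "L2_norm \<Omega> g = 0" by (simp add: L2_norm_def)
  then show "ae_eq \<Omega> g (\<lambda>_. 0)" using L2_norm_zero_iff g(1) Hcurl_L2 by blast
qed

text \<open>A divergence-free \<open>B\<close> is \<open>\<nabla> \<times> k\<close>, and then \<open>\<parallel>B\<parallel>\<^sup>2 = (B, \<nabla> \<times> k)\<close> is the weak curl of \<open>B\<close> tested with \<open>k\<close>.
  Hence the energy norm, which sees only divergence and weak curl, is definite on the magnetic field.\<close>

lemma divergence_and_curl_zero:
  assumes B: "B \<in> Hdiv" and div: "ae_eq \<Omega> (wdiv \<Omega> B) (\<lambda>_. 0)"
    and curl: "ae_eq \<Omega> (weak_curl B) (\<lambda>_. 0)"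
  shows "ae_eq \<Omega> B (\<lambda>_. 0)"
proof -
  obtain k where k: "k \<in> Hcurl" "ae_eq \<Omega> (wcurl \<Omega> k) B" using exact_div[OF B div] by blast
  have BL: "B \<in> L2 \<Omega>" using B Hdiv_L2 by auto
  have cL: "wcurl \<Omega> k \<in> L2 \<Omega>" using ae_linearD(1)[OF wcurl_lin k(1) k(1)] .
  have "L2_inner \<Omega> B B = L2_inner \<Omega> B (wcurl \<Omega> k)"
    using BL cL ae_eq_sym[OF k(2)] by (intro L2_inner_cong) auto
  also have "\<dots> = L2_inner \<Omega> (weak_curl B) k" using dcurl_inner[OF BL k(1)] by simp
  also have "\<dots> = 0" by (rule L2_inner_zero_left[OF curl])
  finally show ?thesis using L2_norm_zero_iff[OF BL] by (simp add: L2_norm_def)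
qed

section \<open>The saddle point form\<close>

definition Z :: "((vfield \<times> vfield) \<times> sfield) set" where
  "Z = W \<times> Q"

definition null :: "((vfield \<times> vfield) \<times> sfield) set" where
  "null = (ae_zero \<Omega> \<times> ae_zero \<Omega>) \<times> ae_zero \<Omega>"

text \<open>Both equations of the mixed problem in a single form on \<open>W\<^sub>h \<times> Q\<^sub>h\<close>.\<close>

definition saddle :: "(vfield \<times> vfield) \<times> sfield \<Rightarrow> (vfield \<times> vfield) \<times> sfield \<Rightarrow> real" where
  "saddle z w = a_form \<Omega> Hcurl Rey Rem S RH um Bm (fst z) (fst w) + b_form \<Omega> (fst w) (snd z) + b_form \<Omega> (fst z) (snd w)"

abbreviation "velocity z \<equiv> fst (fst z)"
abbreviation "velocity_grad z \<equiv> wjac \<Omega> (fst (fst z))"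
abbreviation "velocity_div z \<equiv> wdiv \<Omega> (fst (fst z))"
abbreviation "field_div z \<equiv> wdiv \<Omega> (snd (fst z))"
abbreviation "field_curl z \<equiv> weak_curl (snd (fst z))"
abbreviation "convected z \<equiv> \<lambda>x. outer (fst (fst z) x) (um x)"
abbreviation "lorentz z \<equiv> \<lambda>x. cross3 (weak_curl (snd (fst z)) x) (Bm x)"
abbreviation "emf z \<equiv> \<lambda>x. cross3 (fst (fst z) x) (Bm x)"

text \<open>Every summand is an \<open>L\<^sup>2\<close> product of an operator applied to \<open>z\<close> and an operator applied to \<open>w\<close>, which makes
  bilinearity a consequence of \<open>ae_linear_bilinear_on\<close>.\<close>

lemma saddle_eq:
  "saddle z w =
     inverse Rey * L2_inner \<Omega> (velocity_grad z) (velocity_grad w)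
     + L2_inner \<Omega> (velocity_grad z) (convected w)
     - S * L2_inner \<Omega> (lorentz z) (velocity w)
     + L2_inner \<Omega> (field_div z) (field_div w)
     + inverse Rem * L2_inner \<Omega> (field_curl z) (field_curl w)
     - L2_inner \<Omega> (emf z) (field_curl w)
     + RH * L2_inner \<Omega> (lorentz z) (field_curl w)
     + L2_inner \<Omega> (snd z) (velocity_div w)
     + L2_inner \<Omega> (velocity_div z) (snd w)"
proof -
  have "b_form \<Omega> (fst w) (snd z) = L2_inner \<Omega> (snd z) (velocity_div w)"
    by (cases "fst w") (simp add: L2_inner_commute[of \<Omega> "snd z"])
  moreover have "b_form \<Omega> (fst z) (snd w) = L2_inner \<Omega> (velocity_div z) (snd w)"
    by (cases "fst z") simp
  ultimately show ?thesis
    unfolding saddle_def by (cases "fst z"; cases "fst w") (simp add: convection_eq)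
qed

lemma subspace_W: "subspace W"
proof -
  have "W = V \<times> Hdiv" by (auto simp: W_space_def)
  then show ?thesis using subspace_Times[OF spaces(3,2)] by simp
qed

lemma subspace_Z: "subspace Z"
  unfolding Z_def by (rule subspace_Times[OF subspace_W spaces(4)])

lemma Z_iff: "z \<in> Z \<longleftrightarrow> fst (fst z) \<in> V \<and> snd (fst z) \<in> Hdiv \<and> snd z \<in> Q"
  by (cases z) (auto simp: Z_def W_space_def)

lemma ops_lin:
  shows grad_lin: "ae_linear \<Omega> Z null velocity_grad" and divu_lin: "ae_linear \<Omega> Z null velocity_div"
    and u_lin: "ae_linear \<Omega> Z null velocity" and divB_lin: "ae_linear \<Omega> Z null field_div"
    and curl_lin: "ae_linear \<Omega> Z null field_curl" and p_lin: "ae_linear \<Omega> Z null snd"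
proof -
  have V_Hdiv: "V \<subseteq> H_div \<Omega>" using V_H1 H1_vec_subset_H_div by auto
  show "ae_linear \<Omega> Z null velocity_grad"
    by (rule ae_linear_comp[OF ae_linear_wjac[OF spaces(3) V_H1] linear_fst_fst]) (auto simp: Z_iff null_def)
  show "ae_linear \<Omega> Z null velocity_div"
    by (rule ae_linear_comp[OF ae_linear_wdiv[OF spaces(3) V_Hdiv] linear_fst_fst]) (auto simp: Z_iff null_def)
  show "ae_linear \<Omega> Z null velocity"
    by (rule ae_linear_comp[OF ae_linear_id[OF V_L2] linear_fst_fst]) (auto simp: Z_iff null_def)
  show "ae_linear \<Omega> Z null field_div"
    by (rule ae_linear_comp[OF ae_linear_wdiv[OF spaces(2) sub_div] linear_snd_fst]) (auto simp: Z_iff null_def)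
  show "ae_linear \<Omega> Z null field_curl"
    by (rule ae_linear_comp[OF dcurl_lin linear_snd_fst]) (auto simp: Z_iff null_def)
  show "ae_linear \<Omega> Z null snd"
    by (rule ae_linear_comp[OF ae_linear_id[OF sub_Q]]) (auto simp: Z_iff null_def intro: linear_snd)
qed

lemma force_lin: "ae_linear \<Omega> Z null lorentz"
  by (rule ae_linear_pointwise[OF curl_lin cross3_linear]) (intro cross3_L2[OF _ Bm] ae_linearD(1)[OF curl_lin])

lemma emf_lin: "ae_linear \<Omega> Z null emf"
  by (rule ae_linear_pointwise[OF u_lin cross3_linear]) (intro cross3_L2[OF _ Bm] ae_linearD(1)[OF u_lin])

lemma conv_lin: "ae_linear \<Omega> Z null convected"
  by (rule ae_linear_pointwise[OF u_lin outer_linear]) (use sub_V um(1) in \<open>auto simp: Z_iff intro!: outer_L2\<close>)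

lemma saddle_bilinear: "bilinear_on Z null saddle"
  unfolding saddle_eq[abs_def]
  by (intro bilinear_on_add bilinear_on_diff bilinear_on_scale ae_linear_bilinear_on[OF _ _ subspace_Z])
     (rule ops_lin force_lin emf_lin conv_lin)+

text \<open>The weight \<open>S\<close> on the magnetic test field equalises the coefficients of the Lorentz and the
  electromotive term, and the sign of the pressure makes the two divergence terms opposite.\<close>

lemma saddle_energy:
  assumes z: "((u, B), p) \<in> Z"
  shows "saddle ((u, B), p) ((u, S *\<^sub>R B), - p) =
     inverse Rey * (L2_norm \<Omega> (wjac \<Omega> u))\<^sup>2 + S * (L2_norm \<Omega> (wdiv \<Omega> B))\<^sup>2
     + S * inverse Rem * (L2_norm \<Omega> (weak_curl B))\<^sup>2"
proof -
  have uBp: "u \<in> V" "B \<in> Hdiv" "p \<in> Q" using z by (auto simp: Z_iff)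
  have conv: "L2_inner \<Omega> (wjac \<Omega> u) (\<lambda>x. outer (u x) (um x)) = 0"
    using convection_zero[of um u] um sub_V uBp(1) by (auto simp: convection_eq)
  have div: "L2_inner \<Omega> f (wdiv \<Omega> (S *\<^sub>R B)) = S * L2_inner \<Omega> f (wdiv \<Omega> B)" if "f \<in> L2 \<Omega>" for f
    by (rule ae_linear_inner_scale[OF ae_linear_wdiv[OF spaces(2) sub_div] spaces(2) uBp(2) that])
  have curl: "L2_inner \<Omega> f (weak_curl (S *\<^sub>R B)) = S * L2_inner \<Omega> f (weak_curl B)" if "f \<in> L2 \<Omega>" for f
    by (rule ae_linear_inner_scale[OF dcurl_lin spaces(2) uBp(2) that])
  have L: "wdiv \<Omega> B \<in> L2 \<Omega>" "weak_curl B \<in> L2 \<Omega>" "u \<in> L2 \<Omega>"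
    using ae_linearD(1)[OF divB_lin z z] ae_linearD(1)[OF curl_lin z z] ae_linearD(1)[OF u_lin z z] by auto
  have pp: "L2_inner \<Omega> (wdiv \<Omega> u) (- p) = - L2_inner \<Omega> p (wdiv \<Omega> u)"
    by (simp add: L2_inner_def mult.commute)
  show ?thesis
    unfolding saddle_eq fst_conv snd_conv conv div[OF L(1)] curl[OF L(2)] curl[OF cross3_L2[OF L(3) Bm]]
      curl[OF cross3_L2[OF L(2) Bm]] cross_cancel(1)[where u=u and b=Bm and k="weak_curl B"] cross_cancel(2) pp L2_norm_power2
    by simp
qed

lemma energy_zero:
  assumes z: "((u, B), p) \<in> Z" and zero: "saddle ((u, B), p) ((u, S *\<^sub>R B), - p) = 0"
  shows "L2_norm \<Omega> (wjac \<Omega> u) = 0" "L2_norm \<Omega> (wdiv \<Omega> B) = 0" "L2_norm \<Omega> (weak_curl B) = 0"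
    "u \<in> ae_zero \<Omega>" "B \<in> ae_zero \<Omega>"
proof -
  let ?a = "inverse Rey * (L2_norm \<Omega> (wjac \<Omega> u))\<^sup>2" and ?b = "S * (L2_norm \<Omega> (wdiv \<Omega> B))\<^sup>2"
    and ?c = "S * inverse Rem * (L2_norm \<Omega> (weak_curl B))\<^sup>2"
  have "0 \<le> ?a" "0 \<le> ?b" "0 \<le> ?c" "?a + ?b + ?c = 0"
    using pos zero saddle_energy[OF z] by auto
  then have "?a = 0" "?b = 0" "?c = 0" by linarith+
  then show n: "L2_norm \<Omega> (wjac \<Omega> u) = 0" "L2_norm \<Omega> (wdiv \<Omega> B) = 0" "L2_norm \<Omega> (weak_curl B) = 0"
    using pos by auto
  have uBp: "u \<in> V" "B \<in> Hdiv" using z by (auto simp: Z_iff)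
  show "u \<in> ae_zero \<Omega>" using H1_0_vec_Poincare[OF _ n(1)] sub_V uBp by (auto simp: ae_zero_def)
  have L: "wdiv \<Omega> B \<in> L2 \<Omega>" "weak_curl B \<in> L2 \<Omega>"
    using ae_linearD(1)[OF divB_lin z z] ae_linearD(1)[OF curl_lin z z] by auto
  show "B \<in> ae_zero \<Omega>"
    using divergence_and_curl_zero[OF uBp(2)] n(2,3) L2_norm_zero_iff[OF L(1)] L2_norm_zero_iff[OF L(2)]
    by (auto simp: ae_zero_def)
qed

text \<open>The supremum in the inf-sup condition runs over a nonempty set, as \<open>v = 0\<close> belongs to it; if every
  value is \<open>0\<close>, so is the supremum.\<close>

lemma inf_sup_zero:
  assumes p: "p \<in> Q" and zero: "\<And>v. v \<in> V \<Longrightarrow> L2_inner \<Omega> (wdiv \<Omega> v) p = 0"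
  shows "L2_norm \<Omega> p = 0"
proof -
  obtain \<beta> where \<beta>: "\<beta> > 0"
    "\<beta> * L2_norm \<Omega> p \<le> (SUP v\<in>{v \<in> V. L2_norm \<Omega> (wjac \<Omega> v) \<le> 1}. L2_inner \<Omega> (wdiv \<Omega> v) p)"
    using inf_sup p unfolding inf_sup_stable_def by blast
  have z: "((0, 0), 0) \<in> Z" using subspace_0[OF subspace_Z] by (simp add: zero_prod_def)
  have "((0, 0), 0) \<in> null" by (simp add: null_def)
  from ae_linearD(4)[OF grad_lin z z this] ae_linearD(1)[OF grad_lin z z]
  have "L2_norm \<Omega> (wjac \<Omega> 0) = 0" by (simp add: L2_norm_zero_iff)
  then have ne: "{v \<in> V. L2_norm \<Omega> (wjac \<Omega> v) \<le> 1} \<noteq> {}" using subspace_0[OF spaces(3)] by auto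
  have "(SUP v\<in>{v \<in> V. L2_norm \<Omega> (wjac \<Omega> v) \<le> 1}. L2_inner \<Omega> (wdiv \<Omega> v) p) = 0"
    using ne zero by (subst SUP_cong[OF refl, of _ _ "\<lambda>_. 0"]) auto
  then have "L2_norm \<Omega> p \<le> 0" using \<beta> by (simp add: mult_le_0_iff)
  then show ?thesis using L2_norm_nonneg[of \<Omega> p] by simp
qed

text \<open>The energy identity removes velocity and magnetic field.  Testing with \<open>((v, 0), 0)\<close> then leaves only
  \<open>(p, \<nabla> \<cdot> v)\<close>, and the inf-sup condition removes the pressure.\<close>

lemma left_kernel:
  assumes z: "z \<in> Z" and zero: "\<And>w. w \<in> Z \<Longrightarrow> saddle z w = 0"
  shows "z \<in> null" "L2_norm \<Omega> (velocity_grad z) = 0" "L2_norm \<Omega> (field_div z) = 0" "L2_norm \<Omega> (field_curl z) = 0"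
    "L2_norm \<Omega> (snd z) = 0"
proof -
  obtain u B p where uBp: "z = ((u, B), p)" by (metis prod.collapse)
  have z': "((u, B), p) \<in> Z" using z uBp by simp
  have "((u, S *\<^sub>R B), - p) \<in> Z"
    using z' spaces by (auto simp: Z_iff intro: subspace_scale subspace_neg)
  from zero[OF this] have "saddle ((u, B), p) ((u, S *\<^sub>R B), - p) = 0" by (simp add: uBp)
  note E = energy_zero[OF z' this]
  show "L2_norm \<Omega> (velocity_grad z) = 0" "L2_norm \<Omega> (field_div z) = 0" "L2_norm \<Omega> (field_curl z) = 0"
    using E by (auto simp: uBp)
  have z0: "((u, B), 0) \<in> Z" "((u, B), 0) \<in> null"
    using z' subspace_0[OF spaces(4)] E(4,5) by (auto simp: Z_iff null_def)
  have "L2_inner \<Omega> (wdiv \<Omega> v) p = 0" if v: "v \<in> V" for v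
  proof -
    have w: "((v, 0), 0) \<in> Z" using v subspace_0[OF spaces(2)] subspace_0[OF spaces(4)] by (simp add: Z_iff)
    have "saddle ((u, B), p) ((v, 0), 0) = saddle ((u, B), 0) ((v, 0), 0) + L2_inner \<Omega> p (wdiv \<Omega> v)"
      unfolding saddle_eq fst_conv snd_conv by (simp add: L2_inner_def)
    moreover have "saddle ((u, B), 0) ((v, 0), 0) = 0"
      using bilinear_onD(5)[OF saddle_bilinear z0(1) w w z0(2)] .
    ultimately show ?thesis using zero[OF w] by (simp add: uBp L2_inner_commute[of \<Omega> p])
  qed
  then show p: "L2_norm \<Omega> (snd z) = 0" using inf_sup_zero[of p] z' by (simp add: uBp Z_iff)
  then have "p \<in> ae_zero \<Omega>"
    using L2_norm_zero_iff[of p \<Omega>] z' sub_Q by (auto simp: uBp Z_iff ae_zero_def)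
  then show "z \<in> null" using E(4,5) by (simp add: uBp null_def)
qed

text \<open>As for the left kernel, with the energy identity read backwards: \<open>((v, C), q)\<close> is the test vector that
  belongs to \<open>((v, C / S), - q)\<close>.\<close>

lemma right_kernel:
  assumes s: "s \<in> Z" and zero: "\<And>z. z \<in> Z \<Longrightarrow> saddle z s = 0"
  shows "norm_X (fst s) = 0" "L2_norm \<Omega> (snd s) = 0"
proof -
  obtain v C q where vCq: "s = ((v, C), q)" by (metis prod.collapse)
  \<comment> \<open>The magnetic field whose S-fold is C.\<close>
  let ?D = "(1 / S) *\<^sub>R C"
  have s': "v \<in> V" "C \<in> Hdiv" "q \<in> Q" using s by (auto simp: Z_iff vCq)
  have z: "((v, ?D), - q) \<in> Z"
    using s' spaces by (auto simp: Z_iff intro: subspace_scale subspace_neg)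
  have "((v, S *\<^sub>R ?D), - (- q)) = s" using pos by (simp add: vCq)
  then have "saddle ((v, ?D), - q) ((v, S *\<^sub>R ?D), - (- q)) = 0" using zero[OF z] by simp
  note E = energy_zero[OF z this]
  have "L2_norm \<Omega> (wdiv \<Omega> ?D) = \<bar>1 / S\<bar> * L2_norm \<Omega> (wdiv \<Omega> C)"
    "L2_norm \<Omega> (weak_curl ?D) = \<bar>1 / S\<bar> * L2_norm \<Omega> (weak_curl C)"
    using ae_linear_norm(2)[OF ae_linear_wdiv[OF spaces(2) sub_div] spaces(2) s'(2) s'(2)]
      ae_linear_norm(2)[OF dcurl_lin spaces(2) s'(2) s'(2)] by auto
  then show "norm_X (fst s) = 0" using E(1-3) pos by (simp add: vCq)
  have "L2_inner \<Omega> (wdiv \<Omega> w) q = 0" if w: "w \<in> V" for w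
  proof -
    have wZ: "((w, 0), 0) \<in> Z" using w subspace_0[OF spaces(2)] subspace_0[OF spaces(4)] by (simp add: Z_iff)
    have sZ: "((v, C), 0) \<in> Z" using s' subspace_0[OF spaces(4)] by (simp add: Z_iff)
    have Cz: "C \<in> ae_zero \<Omega>" using E(5) pos by (auto simp: ae_zero_def ae_eq_def scaleR_fun_def)
    have n: "((v, C), 0) \<in> null" using E(4) Cz by (simp add: null_def)
    have "ae_eq \<Omega> (velocity_grad ((v, C), 0)) (\<lambda>_. 0)" "ae_eq \<Omega> (convected ((v, C), 0)) (\<lambda>_. 0)"
      "ae_eq \<Omega> (velocity ((v, C), 0)) (\<lambda>_. 0)" "ae_eq \<Omega> (field_div ((v, C), 0)) (\<lambda>_. 0)"
      "ae_eq \<Omega> (field_curl ((v, C), 0)) (\<lambda>_. 0)" "ae_eq \<Omega> (velocity_div ((v, C), 0)) (\<lambda>_. 0)"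
      using ae_linearD(4)[OF grad_lin sZ sZ n] ae_linearD(4)[OF conv_lin sZ sZ n] ae_linearD(4)[OF u_lin sZ sZ n]
        ae_linearD(4)[OF divB_lin sZ sZ n] ae_linearD(4)[OF curl_lin sZ sZ n] ae_linearD(4)[OF divu_lin sZ sZ n]
      by auto
    note zeros = this[THEN L2_inner_zero_right, unfolded fst_conv snd_conv]
    have "saddle ((w, 0), 0) s = L2_inner \<Omega> (wdiv \<Omega> w) q"
      unfolding saddle_eq vCq fst_conv snd_conv
      by (simp add: zeros)
    then show ?thesis using zero[OF wZ] by simp
  qed
  then show "L2_norm \<Omega> (snd s) = 0" using inf_sup_zero[of q] s' by (simp add: vCq)
qed

section \<open>Well-posedness\<close>

lemma saddle_biorthogonal:
  obtains n e w where "biorthogonal Z saddle n e w"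
    "\<And>y z. y \<in> Z \<Longrightarrow> z \<in> Z \<Longrightarrow> saddle y z = (\<Sum>i<n. saddle y (w i) * saddle (e i) z)"
proof -
  let ?r = "\<lambda>z :: (vfield \<times> vfield) \<times> sfield.
    ((restrict_to (mesh_interior T) (fst (fst z)), restrict_to (mesh_interior T) (snd (fst z))),
      restrict_to (mesh_interior T) (snd z))"
  obtain F where F: "finite F" "restrict_to (mesh_interior T) ` V \<subseteq> span F"
    using fe_space_finite_dimensional[OF mesh fe(3)] .
  obtain G where G: "finite G" "restrict_to (mesh_interior T) ` Hdiv \<subseteq> span G"
    using fe_space_finite_dimensional[OF mesh fe(2)] .
  obtain H where H: "finite H" "restrict_to (mesh_interior T) ` Q \<subseteq> span H"
    using fe_space_finite_dimensional[OF mesh fe(4)] .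
  define FG where "FG = (\<lambda>a. (a, 0)) ` F \<union> (\<lambda>b. (0, b)) ` G"
  define FGH where "FGH = (\<lambda>a. (a, 0)) ` FG \<union> (\<lambda>b. (0, b)) ` H"
  have lin: "linear ?r"
    by (rule linearI) (simp_all add: linear_add[OF linear_restrict_to] linear_scale[OF linear_restrict_to])
  have null: "z \<in> null" if "z \<in> Z" "?r z = 0" for z
    using that by (cases z)
      (auto simp: null_def zero_prod_def intro: restrict_to_zero_imp_ae_zero[OF mesh domain_sets])
  have fin: "finite FGH" using F(1) G(1) H(1) by (simp add: FGH_def FG_def)
  have "?r z \<in> (span F \<times> span G) \<times> span H" if "z \<in> Z" for z
    using that F(2) G(2) H(2) by (auto simp: Z_iff)
  then have "?r ` Z \<subseteq> (span F \<times> span G) \<times> span H" by blast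
  also have "\<dots> \<subseteq> span FG \<times> span H"
    unfolding FG_def by (intro Sigma_mono span_Times_subset order_refl)
  also have "\<dots> \<subseteq> span FGH" unfolding FGH_def by (rule span_Times_subset)
  finally show thesis
    using biorthogonal_complete[OF subspace_Z saddle_bilinear lin null fin] that by blast
qed

text \<open>Testing with \<open>q = 0\<close> separates the first equation from the second.\<close>

lemma is_solution_iff:
  assumes l: "l \<in> dual_space W norm_X" and g: "g \<in> dual_space Q (L2_norm \<Omega>)"
  shows "solves l g x p \<longleftrightarrow>
     (x, p) \<in> Z \<and> (\<forall>w\<in>Z. saddle (x, p) w = l (fst w) + g (snd w))"
    (is "?sol \<longleftrightarrow> ?var")
proof
  assume ?sol
  then show ?var by (auto simp: is_solution_def Z_def saddle_def)
next
  assume var: ?var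
  have g0: "g (0 *\<^sub>R 0) = 0 * g 0"
    using g subspace_0[OF spaces(4)] unfolding dual_space_def by blast
  have b0: "b_form \<Omega> x 0 = 0" by (cases x) (simp add: L2_inner_def)
  have *: "a_form \<Omega> Hcurl Rey Rem S RH um Bm x y + b_form \<Omega> y p + b_form \<Omega> x q = l y + g q"
    if "y \<in> W" "q \<in> Q" for y q
    using var that by (simp add: Z_def saddle_def)
  show ?sol
    unfolding is_solution_def
  proof (intro conjI ballI)
    fix y q assume yq: "y \<in> W" "q \<in> Q"
    show eq: "a_form \<Omega> Hcurl Rey Rem S RH um Bm x y + b_form \<Omega> y p = l y"
      using *[OF yq(1) subspace_0[OF spaces(4)]] b0 g0 by simp
    show "b_form \<Omega> x q = g q" using *[OF yq] eq by simp
  qed (use var in \<open>auto simp: Z_def\<close>)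
qed

lemma X_norm_eq:
  "norm_X x = sqrt ((L2_norm \<Omega> (wjac \<Omega> (fst x)))\<^sup>2 + (L2_norm \<Omega> (wdiv \<Omega> (snd x)))\<^sup>2
     + (L2_norm \<Omega> (weak_curl (snd x)))\<^sup>2)"
  by (cases x) simp

lemma X_norm_nonneg: "0 \<le> norm_X x"
  by (simp add: X_norm_eq)

lemma X_norm_scale:
  assumes "x \<in> W"
  shows "norm_X (c *\<^sub>R x) = \<bar>c\<bar> * norm_X x"
proof -
  have z: "(x, 0) \<in> Z" using assms subspace_0[OF spaces(4)] by (simp add: Z_def)
  have scaled: "L2_norm \<Omega> (wjac \<Omega> (fst (c *\<^sub>R x))) = \<bar>c\<bar> * L2_norm \<Omega> (wjac \<Omega> (fst x))"
    "L2_norm \<Omega> (wdiv \<Omega> (snd (c *\<^sub>R x))) = \<bar>c\<bar> * L2_norm \<Omega> (wdiv \<Omega> (snd x))"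
    "L2_norm \<Omega> (weak_curl (snd (c *\<^sub>R x))) = \<bar>c\<bar> * L2_norm \<Omega> (weak_curl (snd x))"
    using ae_linear_norm(2)[OF grad_lin subspace_Z z z, of c] ae_linear_norm(2)[OF divB_lin subspace_Z z z, of c]
      ae_linear_norm(2)[OF curl_lin subspace_Z z z, of c] by simp_all
  show ?thesis
    unfolding X_norm_eq scaled power_mult_distrib power2_abs distrib_left[symmetric]
    by (simp add: real_sqrt_mult)
qed

text \<open>Equivalent to \<open>\<parallel>\<cdot>\<parallel>\<^sub>X + \<parallel>\<cdot>\<parallel>\<^sub>Q\<close>; being a sum of seminorms it makes the triangle inequality immediate.\<close>

definition energy_norm :: "(vfield \<times> vfield) \<times> sfield \<Rightarrow> real" where
  "energy_norm z = L2_norm \<Omega> (velocity_grad z) + L2_norm \<Omega> (field_div z) + L2_norm \<Omega> (field_curl z) + L2_norm \<Omega> (snd z)"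

lemma energy_norm_add:
  assumes "y \<in> Z" "z \<in> Z"
  shows "energy_norm (y + z) \<le> energy_norm y + energy_norm z"
  using ae_linear_norm(1)[OF grad_lin subspace_Z assms] ae_linear_norm(1)[OF divB_lin subspace_Z assms]
    ae_linear_norm(1)[OF curl_lin subspace_Z assms] ae_linear_norm(1)[OF p_lin subspace_Z assms]
  unfolding energy_norm_def by linarith

lemma energy_norm_scale:
  assumes "z \<in> Z"
  shows "energy_norm (c *\<^sub>R z) = \<bar>c\<bar> * energy_norm z"
  unfolding energy_norm_def ae_linear_norm(2)[OF grad_lin subspace_Z assms assms]
    ae_linear_norm(2)[OF divB_lin subspace_Z assms assms] ae_linear_norm(2)[OF curl_lin subspace_Z assms assms]
    ae_linear_norm(2)[OF p_lin subspace_Z assms assms]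
  by (simp add: algebra_simps)

lemma energy_norm_nonneg: "0 \<le> energy_norm z"
  by (simp add: energy_norm_def)

lemma energy_norm_sum:
  assumes "finite I" "\<And>i. i \<in> I \<Longrightarrow> e i \<in> Z"
  shows "energy_norm (\<Sum>i\<in>I. c i *\<^sub>R e i) \<le> (\<Sum>i\<in>I. \<bar>c i\<bar> * energy_norm (e i))"
  using assms
proof (induction I rule: finite_induct)
  case empty
  have "energy_norm (0 *\<^sub>R 0) = \<bar>0\<bar> * energy_norm 0"
    by (rule energy_norm_scale[OF subspace_0[OF subspace_Z]])
  then show ?case by simp
next
  case (insert i I)
  have "(\<Sum>i\<in>I. c i *\<^sub>R e i) \<in> Z" "c i *\<^sub>R e i \<in> Z"
    using insert subspace_Z by (auto intro!: subspace_sum subspace_scale)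
  then have "energy_norm (c i *\<^sub>R e i + (\<Sum>i\<in>I. c i *\<^sub>R e i)) \<le>
      energy_norm (c i *\<^sub>R e i) + energy_norm (\<Sum>i\<in>I. c i *\<^sub>R e i)"
    by (intro energy_norm_add)
  then show ?case using insert energy_norm_scale[of "e i" "c i"] by simp
qed

lemma X_norm_le_energy_norm: "norm_X x + L2_norm \<Omega> p \<le> energy_norm (x, p)"
proof -
  have "sqrt (a\<^sup>2 + b\<^sup>2 + c\<^sup>2) \<le> a + b + c" if "0 \<le> a" "0 \<le> b" "0 \<le> c" for a b c :: real
    using that by (intro real_le_lsqrt) (auto simp: power2_eq_square algebra_simps)
  then show ?thesis unfolding X_norm_eq energy_norm_def by (simp add: add_mono)
qed

lemma data_bound:
  assumes l: "l \<in> dual_space W norm_X" and g: "g \<in> dual_space Q (L2_norm \<Omega>)"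
    and w: "w \<in> Z"
  shows "\<bar>l (fst w) + g (snd w)\<bar> \<le>
     (dual_norm W norm_X l + dual_norm Q (L2_norm \<Omega>) g) * energy_norm w"
proof -
  let ?l = "dual_norm W norm_X l" and ?g = "dual_norm Q (L2_norm \<Omega>) g"
  have w': "fst w \<in> W" "snd w \<in> Q" using w by (auto simp: Z_def)
  have Qs: "L2_norm \<Omega> (c *\<^sub>R q) = \<bar>c\<bar> * L2_norm \<Omega> q" for c and q :: sfield
    using L2_norm_scale[of \<Omega> c q] by (simp add: scaleR_fun_def)
  note bl = dual_norm_bound[OF subspace_W X_norm_nonneg X_norm_scale l]
    and bg = dual_norm_bound[OF spaces(4) L2_norm_nonneg Qs g]
  have le: "norm_X (fst w) \<le> energy_norm w" "L2_norm \<Omega> (snd w) \<le> energy_norm w"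
    using X_norm_le_energy_norm[of "fst w" "snd w"] X_norm_nonneg[of "fst w"] L2_norm_nonneg[of \<Omega> "snd w"]
    unfolding prod.collapse by linarith+
  have "\<bar>l (fst w)\<bar> \<le> ?l * energy_norm w"
    using bl(1)[OF _ w'(1)] mult_left_mono[OF le(1) bl(2)] by fastforce
  moreover have "\<bar>g (snd w)\<bar> \<le> ?g * energy_norm w"
    using bg(1)[OF w'(2)] mult_left_mono[OF le(2) bg(2)] by fastforce
  ultimately show ?thesis by (simp add: distrib_right)
qed

text \<open>The data vanish on the right kernel, since they are bounded by the norms that vanish there, so the
  system is solvable; the difference of two solutions lies in the left kernel.\<close>

lemma existence_and_uniqueness:
  assumes l: "l \<in> dual_space W norm_X" and g: "g \<in> dual_space Q (L2_norm \<Omega>)"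
  shows "\<exists>u B p. solves l g (u, B) p \<and>
          (\<forall>u' B' p'. solves l g (u', B') p' \<longrightarrow>
             ae_eq \<Omega> u' u \<and> ae_eq \<Omega> B' B \<and> ae_eq \<Omega> p' p)"
proof -
  let ?L = "\<lambda>w. l (fst w) + g (snd w)"
  obtain n e w where bi: "biorthogonal Z saddle n e w"
    and complete: "\<And>y z. y \<in> Z \<Longrightarrow> z \<in> Z \<Longrightarrow> saddle y z = (\<Sum>i<n. saddle y (w i) * saddle (e i) z)"
    using saddle_biorthogonal by blast
  have L1: "?L (x + y) = ?L x + ?L y" if "x \<in> Z" "y \<in> Z" for x y
  proof -
    have "fst x \<in> W" "fst y \<in> W" "snd x \<in> Q" "snd y \<in> Q" using that by (auto simp: Z_def)
    then have "l (fst x + fst y) = l (fst x) + l (fst y)" "g (snd x + snd y) = g (snd x) + g (snd y)"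
      using l g unfolding dual_space_def by blast+
    then show ?thesis by simp
  qed
  have L2: "?L (c *\<^sub>R x) = c * ?L x" if "x \<in> Z" for c x
  proof -
    have "fst x \<in> W" "snd x \<in> Q" using that by (auto simp: Z_def)
    then have "l (c *\<^sub>R fst x) = c * l (fst x)" "g (c *\<^sub>R snd x) = c * g (snd x)"
      using l g unfolding dual_space_def by blast+
    then show ?thesis by (simp add: distrib_left)
  qed
  have L3: "?L r = 0" if r: "r \<in> Z" "\<And>y. y \<in> Z \<Longrightarrow> saddle y r = 0" for r
  proof -
    have "fst r \<in> W" "snd r \<in> Q" using r(1) by (auto simp: Z_def)
    moreover obtain M M' where "\<forall>x\<in>W. \<bar>l x\<bar> \<le> M * norm_X x" "\<forall>q\<in>Q. \<bar>g q\<bar> \<le> M' * L2_norm \<Omega> q"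
      using l g unfolding dual_space_def by blast
    ultimately have "\<bar>l (fst r)\<bar> \<le> M * norm_X (fst r)" "\<bar>g (snd r)\<bar> \<le> M' * L2_norm \<Omega> (snd r)"
      by blast+
    then show ?thesis using right_kernel[OF r] by simp
  qed
  define z where "z = (\<Sum>i<n. ?L (w i) *\<^sub>R e i)"
  have z: "z \<in> Z" "saddle z k = ?L k" if k: "k \<in> Z" for k
    unfolding z_def
    by (rule biorthogonal_solve[where L="?L", OF subspace_Z saddle_bilinear bi];
        (rule k | rule complete | rule L1 | rule L2 | rule L3); blast)+
  have zZ: "z \<in> Z" using z(1)[OF subspace_0[OF subspace_Z]] .
  obtain u B p where uBp: "z = ((u, B), p)" by (metis prod.collapse)
  have "solves l g (u, B) p"
    using is_solution_iff[OF l g] zZ z(2) by (simp add: uBp)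
  moreover have "ae_eq \<Omega> u' u \<and> ae_eq \<Omega> B' B \<and> ae_eq \<Omega> p' p"
    if "solves l g (u', B') p'" for u' B' p'
  proof -
    let ?z' = "((u', B'), p')"
    have z': "?z' \<in> Z" "\<And>k. k \<in> Z \<Longrightarrow> saddle ?z' k = ?L k" using that is_solution_iff[OF l g] by auto
    have "saddle (?z' - z) k = 0" if "k \<in> Z" for k
      using bilinear_on_minus(1)[OF saddle_bilinear subspace_Z z'(1) zZ that] z'(2)[OF that] z(2)[OF that] by simp
    then have "?z' - z \<in> null" using left_kernel(1)[OF subspace_diff[OF subspace_Z z'(1) zZ]] by blast
    then show ?thesis by (auto simp: uBp null_def ae_zero_def ae_eq_def)
  qed
  ultimately show ?thesis by blast
qed

text \<open>A solution differs from \<open>\<Sum>\<^sub>i A(z, w\<^sub>i) e\<^sub>i\<close> by an element of the left kernel, on which the norm is zero, and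
  its coefficients \<open>A(z, w\<^sub>i)\<close> are values of the data at the fixed vectors \<open>w\<^sub>i\<close>.\<close>

lemma stability:
  "\<exists>C. \<forall>l\<in>dual_space W norm_X. \<forall>g\<in>dual_space Q (L2_norm \<Omega>). \<forall>x p.
     solves l g x p \<longrightarrow>
     norm_X x + L2_norm \<Omega> p
       \<le> C * (dual_norm W norm_X l + dual_norm Q (L2_norm \<Omega>) g)"
proof -
  obtain n e w where bi: "biorthogonal Z saddle n e w"
    and complete: "\<And>y z. y \<in> Z \<Longrightarrow> z \<in> Z \<Longrightarrow> saddle y z = (\<Sum>i<n. saddle y (w i) * saddle (e i) z)"
    using saddle_biorthogonal by blast
  have eZ: "e i \<in> Z" "w i \<in> Z" if "i < n" for i using bi that by (auto simp: biorthogonal_def)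
  let ?C = "\<Sum>i<n. energy_norm (w i) * energy_norm (e i)"
  have "norm_X x + L2_norm \<Omega> p
       \<le> ?C * (dual_norm W norm_X l + dual_norm Q (L2_norm \<Omega>) g)"
    if l: "l \<in> dual_space W norm_X" and g: "g \<in> dual_space Q (L2_norm \<Omega>)"
      and sol: "solves l g x p" for l g x p
  proof -
    let ?d = "dual_norm W norm_X l + dual_norm Q (L2_norm \<Omega>) g"
    let ?z = "(x, p)" and ?s = "\<Sum>i<n. saddle (x, p) (w i) *\<^sub>R e i"
    have z: "?z \<in> Z" "\<And>k. k \<in> Z \<Longrightarrow> saddle ?z k = l (fst k) + g (snd k)" using sol is_solution_iff[OF l g] by auto
    have s: "?s \<in> Z" using eZ subspace_Z by (auto intro!: subspace_sum subspace_scale)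
    have r: "?z - ?s \<in> Z" by (rule subspace_diff[OF subspace_Z z(1) s])
    have "saddle (?z - ?s) k = 0" if k: "k \<in> Z" for k
      using bilinear_on_minus(1)[OF saddle_bilinear subspace_Z z(1) s k]
        bilinear_on_sum(1)[OF saddle_bilinear subspace_Z k, of "{..<n}" e "\<lambda>i. saddle (x, p) (w i)"] eZ complete[OF z(1) k] by simp
    then have "energy_norm (?z - ?s) = 0" using left_kernel(2-5)[OF r] by (simp add: energy_norm_def)
    then have "energy_norm ?z \<le> energy_norm ?s" using energy_norm_add[OF r s] by simp
    also have "\<dots> \<le> (\<Sum>i<n. \<bar>saddle (x, p) (w i)\<bar> * energy_norm (e i))"
      by (rule energy_norm_sum) (use eZ in auto)
    also have "\<dots> \<le> (\<Sum>i<n. (?d * energy_norm (w i)) * energy_norm (e i))"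
    proof (intro sum_mono mult_right_mono energy_norm_nonneg)
      fix i assume "i \<in> {..<n}"
      then show "\<bar>saddle (x, p) (w i)\<bar> \<le> ?d * energy_norm (w i)"
        using z(2) eZ data_bound[OF l g] by simp
    qed
    also have "\<dots> = ?C * ?d" by (simp add: sum_distrib_left mult_ac)
    finally show ?thesis using X_norm_le_energy_norm[of x p] by linarith
  qed
  then show ?thesis by blast
qed

end

theorem theorem2:
  fixes \<Omega> :: "(real^3) set" and T :: "(real^3) set set"
    and Rey Rem S RH :: real
    and Hgrad L2h Q :: "sfield set" and Hcurl Hdiv V :: "vfield set"
    and um Bm :: vfield
  assumes "bounded \<Omega>" and "simply_connected \<Omega>" and "lipschitz_polyhedron \<Omega>"
    and "is_mesh \<Omega> T"
    and "Rey > 0" and "Rem > 0" and "S > 0" and "RH \<ge> 0"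
    and "fe_space T Hgrad" and "Hgrad \<subseteq> H1_0 \<Omega>"
    and "fe_space T Hcurl" and "Hcurl \<subseteq> H_curl_0 \<Omega>"
    and "fe_space T Hdiv" and "Hdiv \<subseteq> H_div_0 \<Omega>"
    and "fe_space T L2h" and "L2h \<subseteq> L2_mean_zero \<Omega>"
    and "exact_de_Rham \<Omega> Hgrad Hcurl Hdiv L2h"
    and "fe_space T V" and "V \<subseteq> H1_0_vec \<Omega>"
    and "fe_space T Q" and "Q \<subseteq> L2_mean_zero \<Omega>"
    and "inf_sup_stable \<Omega> V Q"
    and "(um, Bm) \<in> W_space V Hdiv"
    and "ae_eq \<Omega> (wdiv \<Omega> um) 0"
    and "Bm \<in> L_infinity \<Omega>"
  shows
    "(\<forall>l\<in>dual_space (W_space V Hdiv) (X_norm \<Omega> Hcurl). \<forall>g\<in>dual_space Q (L2_norm \<Omega>).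
        \<exists>u B p. is_solution \<Omega> V Hcurl Hdiv Q Rey Rem S RH um Bm l g (u, B) p \<and>
          (\<forall>u' B' p'. is_solution \<Omega> V Hcurl Hdiv Q Rey Rem S RH um Bm l g (u', B') p' \<longrightarrow>
             ae_eq \<Omega> u' u \<and> ae_eq \<Omega> B' B \<and> ae_eq \<Omega> p' p)) \<and>
     (\<exists>C. \<forall>l\<in>dual_space (W_space V Hdiv) (X_norm \<Omega> Hcurl). \<forall>g\<in>dual_space Q (L2_norm \<Omega>). \<forall>x p.
        is_solution \<Omega> V Hcurl Hdiv Q Rey Rem S RH um Bm l g x p \<longrightarrow>
        X_norm \<Omega> Hcurl x + L2_norm \<Omega> p
          \<le> C * (dual_norm (W_space V Hdiv) (X_norm \<Omega> Hcurl) l + dual_norm Q (L2_norm \<Omega>) g))"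
proof -
  have zero: "(0 :: sfield) = (\<lambda>_. 0)" by (rule ext) simp
  interpret picard_step \<Omega> T Rey Rem S RH Q Hcurl Hdiv V um Bm
  proof
    show "open \<Omega>" using \<open>lipschitz_polyhedron \<Omega>\<close> by (simp add: lipschitz_polyhedron_def)
    show "Hcurl \<subseteq> H_curl \<Omega>" using \<open>Hcurl \<subseteq> H_curl_0 \<Omega>\<close> by (auto simp: H_curl_0_def)
    show "Hdiv \<subseteq> H_div \<Omega>" using \<open>Hdiv \<subseteq> H_div_0 \<Omega>\<close> by (auto simp: H_div_0_def)
    show "Q \<subseteq> L2 \<Omega>" using \<open>Q \<subseteq> L2_mean_zero \<Omega>\<close> by (auto simp: L2_mean_zero_def)
    show "um \<in> V" using \<open>(um, Bm) \<in> W_space V Hdiv\<close> by (simp add: W_space_def)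
    show "ae_eq \<Omega> (wdiv \<Omega> um) (\<lambda>_. 0)" using \<open>ae_eq \<Omega> (wdiv \<Omega> um) 0\<close> by (simp add: zero)
    show "\<exists>k\<in>Hcurl. ae_eq \<Omega> (wcurl \<Omega> k) B" if "B \<in> Hdiv" "ae_eq \<Omega> (wdiv \<Omega> B) (\<lambda>_. 0)" for B
    proof -
      have "ae_eq \<Omega> (wdiv \<Omega> B) 0" using that(2) by (simp add: zero)
      then show ?thesis using \<open>exact_de_Rham \<Omega> Hgrad Hcurl Hdiv L2h\<close> that(1)
        unfolding exact_de_Rham_def by blast
    qed
  qed (fact assms)+
  show ?thesis using existence_and_uniqueness stability by blast
qed

end
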